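(* Let $0<\alpha\le 2$, let $\beta_1,\beta_2>\frac1\alpha$, and let $X_{k,l}=\sum_{i,j=0}^\infty c_{i,j}\varepsilon_{k-i,l-j}$, $(k,l)\in\mathbb Z^2$, be a linear random field with i.i.d. symmetric $\alpha$-stable innovations $\varepsilon_{k,l}$ (characteristic function $\theta\mapsto e^{-|\theta|^\alpha}$) and coefficients $$c_{i,j}=w_{(i,j)}(1+i)^{-\beta_1}(1+j)^{-\beta_2},\qquad i,j\ge 0,$$ where the $w_{(i,j)}$ are nonzero real numbers such that: (A1) $\lim_{i,j\to\infty}w_{(i,j)}=1$ (as $\min(i,j)\to\infty$); (A2) for every $i\ge 0$ the limit $w_{(i,\infty)}:=\lim_{j\to\infty}w_{(i,j)}$ exists and is $>0$; (A3) for every $j\ge 0$ the limit $w_{(\infty,j)}:=\lim_{i\to\infty}w_{(i,j)}$ exists and is $>0$. For positive integers $n,m$ let $\rho(n,m)=\rho(X_{0,0},X_{n,m})$ be the spectral covariance. Then, with $n,m\to\infty$ meaning $\min(n,m)\to\infty$, the following hold. 1. If $1<\alpha\le 2$ and $\beta_i>\frac1{\alpha-1}$, $i=1,2$, then $$\lim_{n,m\to\infty}\frac{\rho(n,m)}{n^{-\beta_1}m^{-\beta_2}}=\sum_{i=0}^\infty\sum_{j=0}^\infty w_{(i,j)}^{\langle\alpha-1\rangle}(1+i)^{-\beta_1(\alpha-1)}(1+j)^{-\beta_2(\alpha-1)}.$$ 2. If $1<\alpha\le 2$ and $\frac1\alpha<\beta_i<\frac1{\alpha-1}$, $i=1,2$,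 or if $0<\alpha\le 1$ and $\beta_i>\frac1\alpha$, $i=1,2$, then $$\lim_{n,m\to\infty}\frac{\rho(n,m)}{n^{1-\alpha\beta_1}m^{1-\alpha\beta_2}}=\int_0^\infty\int_0^\infty V\big(t^{-\beta_1}s^{-\beta_2},\,(t+1)^{-\beta_1}(s+1)^{-\beta_2}\big)\,dt\,ds.$$ 3. If $1<\alpha\le 2$, $\beta_1>\frac1{\alpha-1}$ and $\frac1\alpha<\beta_2<\frac1{\alpha-1}$, then $$\lim_{n,m\to\infty}\frac{\rho(n,m)}{n^{-\beta_1}m^{1-\beta_2\alpha}}=\sum_{i=0}^\infty w_{(i,\infty)}^{\alpha-1}(1+i)^{-\beta_1(\alpha-1)}\int_0^\infty u^{-\beta_2(\alpha-1)}(1+u)^{-\beta_2}\,du.$$ 4. If $1<\alpha\le 2$, $\beta_1=\frac1{\alpha-1}$ and $\frac1\alpha<\beta_2<\frac1{\alpha-1}$, then $$\lim_{n,m\to\infty}\frac{\rho(n,m)}{n^{-\beta_1}m^{1-\beta_2\alpha}\ln(n)}=\int_0^\infty v^{-\beta_2(\alpha-1)}(1+v)^{-\beta_2}\,dv.$$ 5. If $1<\alpha\le 2$, $\beta_1=\frac1{\alpha-1}$ and $\beta_2>\frac1{\alpha-1}$, then $$\lim_{n,m\to\infty}\frac{\rho(n,m)}{n^{-\beta_1}m^{-\beta_2}\ln(n)}=\sum_{j=0}^\infty w_{(\infty,j)}^{\alpha-1}(1+j)^{-\beta_2(\alpha-1)}.$$ 6. If $1<\alpha\le 2$, $\beta_1=\frac1{\alpha-1}$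 and $\beta_2=\frac1{\alpha-1}$, then $$\lim_{n,m\to\infty}\frac{\rho(n,m)}{n^{-\beta_1}m^{-\beta_2}\ln(n)\ln(m)}=1.$$
   Context: Notation: $b^{\langle a\rangle}=|b|^a\,\mathrm{sgn}(b)$. For the given $\alpha\in(0,2]$, $$V(x,y)=\frac{xy}{(x^2+y^2)^{(2-\alpha)/2}}\ \text{ if }x^2+y^2>0,\qquad V(0,0)=0.$$ Spectral covariance: for $0<\alpha<2$, a symmetric $\alpha$-stable random vector $(X_1,X_2)$ has characteristic function $\exp\{-\int_{S^1}|\theta_1s_1+\theta_2s_2|^\alpha\,\Gamma(ds)\}$ with a unique symmetric finite measure $\Gamma$ (the spectral measure) on the unit circle $S^1\subset\mathbb R^2$, and its spectral covariance is $\rho(X_1,X_2)=\int_{S^1}s_1s_2\,\Gamma(ds)$. For the field considered here, and $n,m>0$, the spectral covariance $\rho(n,m)=\rho(X_{0,0},X_{n,m})$ is given by the (absolutely convergent) series $$\rho(n,m)=\sum_{i=0}^\infty\sum_{j=0}^\infty V(c_{i,j},c_{i+n,j+m}).$$ For $\alpha=2$ (Gaussian case, where the spectral measure is not unique) $\rho(n,m)$ is understood as this series. The condition $\beta_1,\beta_2>1/\alpha$ ensures $\sum_{i,j}|c_{i,j}|^\alpha<\infty$, so that the field is well defined. *)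

theory Defs
  imports "HOL-Probability.Probability"
begin

definition signed_powr :: "real \<Rightarrow> real \<Rightarrow> real" where
  "signed_powr b a = \<bar>b\<bar> powr a * sgn b"

definition V :: "real \<Rightarrow> real \<Rightarrow> real \<Rightarrow> real" where
  "V \<alpha> x y =
     (if x\<^sup>2 + y\<^sup>2 > 0 then x * y / (x\<^sup>2 + y\<^sup>2) powr ((2 - \<alpha>) / 2) else 0)"

abbreviation unit_circle :: "(real \<times> real) set" where
  "unit_circle \<equiv> sphere 0 1"

definition spectral_measure ::
  "real \<Rightarrow> 'a measure \<Rightarrow> ('a \<Rightarrow> real) \<Rightarrow> ('a \<Rightarrow> real) \<Rightarrow> (real \<times> real) measure \<Rightarrow> bool" where
  "spectral_measure \<alpha> M X1 X2 \<Gamma> \<longleftrightarrow>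
     sets \<Gamma> = sets (restrict_space borel unit_circle) \<and>
     finite_measure \<Gamma> \<and>
     distr \<Gamma> \<Gamma> uminus = \<Gamma> \<and>
     (\<forall>\<theta>1 \<theta>2. (CLINT \<omega>|M. iexp (\<theta>1 * X1 \<omega> + \<theta>2 * X2 \<omega>)) =
        complex_of_real (exp (- (LINT s|\<Gamma>. \<bar>\<theta>1 * fst s + \<theta>2 * snd s\<bar> powr \<alpha>))))"

(* For 0 < \<alpha> < 2 the symmetric spectral measure of an \<alpha>-stable vector is unique,
   so the choice operator only names it. *)
definition spectral_covariance ::
  "real \<Rightarrow> 'a measure \<Rightarrow> ('a \<Rightarrow> real) \<Rightarrow> ('a \<Rightarrow> real) \<Rightarrow> real" where
  "spectral_covariance \<alpha> M X1 X2 =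
     (LINT s|(SOME \<Gamma>. spectral_measure \<alpha> M X1 X2 \<Gamma>). fst s * snd s)"

definition iid_symmetric_stable ::
  "real \<Rightarrow> 'a measure \<Rightarrow> (int \<times> int \<Rightarrow> 'a \<Rightarrow> real) \<Rightarrow> bool" where
  "iid_symmetric_stable \<alpha> M \<epsilon> \<longleftrightarrow>
     prob_space.indep_vars M (\<lambda>_. borel) \<epsilon> UNIV \<and>
     (\<forall>p \<theta>. char (distr M borel (\<epsilon> p)) \<theta> = complex_of_real (exp (- (\<bar>\<theta>\<bar> powr \<alpha>))))"

(* X k l is the sum of the double series of c i j * \<epsilon> (k - i, l - j) over i, j \<ge> 0.
   The series is read as an unordered sum converging in probability: for \<alpha> > 1 it need not
   converge absolutely, and this mode does not depend on an enumeration of the index set. *)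
definition linear_random_field ::
  "'a measure \<Rightarrow> (nat \<Rightarrow> nat \<Rightarrow> real) \<Rightarrow> (int \<times> int \<Rightarrow> 'a \<Rightarrow> real) \<Rightarrow>
     (int \<Rightarrow> int \<Rightarrow> 'a \<Rightarrow> real) \<Rightarrow> bool" where
  "linear_random_field M c \<epsilon> X \<longleftrightarrow>
     (\<forall>k l. X k l \<in> borel_measurable M \<and>
        (\<forall>\<delta>>0. ((\<lambda>F. measure M {\<omega> \<in> space M.
             \<bar>(\<Sum>(i, j)\<in>F. c i j * \<epsilon> (k - int i, l - int j) \<omega>) - X k l \<omega>\<bar> > \<delta>})
           \<longlongrightarrow> 0) (finite_subsets_at_top UNIV)))"

definition field_coeff ::
  "(nat \<Rightarrow> nat \<Rightarrow> real) \<Rightarrow> real \<Rightarrow> real \<Rightarrow> nat \<Rightarrow> nat \<Rightarrow> real" where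
  "field_coeff w \<beta>1 \<beta>2 i j = w i j * (1 + real i) powr (- \<beta>1) * (1 + real j) powr (- \<beta>2)"

(* In the Gaussian case the spectral measure is not unique, and \<rho> is by convention the series
   that represents the spectral covariance when \<alpha> < 2. *)
definition rho ::
  "real \<Rightarrow> 'a measure \<Rightarrow> (nat \<Rightarrow> nat \<Rightarrow> real) \<Rightarrow> (int \<Rightarrow> int \<Rightarrow> 'a \<Rightarrow> real) \<Rightarrow> nat \<Rightarrow> nat \<Rightarrow> real" where
  "rho \<alpha> M c X n m =
     (if \<alpha> < 2 then spectral_covariance \<alpha> M (X 0 0) (X (int n) (int m))
      else (\<Sum>i. \<Sum>j. V \<alpha> (c i j) (c (i + n) (j + m))))"

end

(* The spectral measure enters only through its mixed second moment. By rotation invariance,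
   integrating sin(2x) |s1 cos x + s2 sin x|^alpha over a period gives 2 K s1 s2 with a constant K > 0, so
   by Fubini this moment is determined by the characteristic function and may be computed from the
   discrete spectral measure carried by the coefficient pairs; this yields the series for rho(n,m).

   For the asymptotics put a = max(0, alpha - 1), b = alpha - a. By homogeneity of V each summand is a
   product of two kernels (1+i)^(-beta*a) (1+i+n)^(-beta*b), one per coordinate, and a uniformly bounded
   factor depending on the weights and on the ratios (1+i+n)/(1+i). Each coordinate is rescaled separately
   so that its normalised kernel converges dominatedly, and dominated convergence on the product space
   gives all six limits. When one ratio tends to infinity, the bounded factor tends to the signed power
   of the limiting weight. *)

theory Submission
  imports Defs
begin

section \<open>The mixed moment of a spectral measure\<close>

text \<open>The choice of a comes from the bound |V x y| <= |x|^a |y|^(alpha - a) in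
  \<open>abs_V_le\<close>, available when alpha - 1 <= a <= 1: a is its smallest nonnegative
  exponent, and for alpha > 1 the bound is then of exact order when |x| dominates |y|. The threshold
  1 / (alpha - 1) is where beta * a crosses 1, that is, where (1+i)^(-beta*a) stops being summable,
  whereas beta * (a + b) = beta * alpha > 1 always controls the tail. The obstacle is that the two
  coordinates may lie in different regimes while n and m grow without any relation to each other.
  Scaling is therefore a property of a single coordinate, and only the bounded factor couples the
  two. At the critical exponent the mass, of order 1 + 1/2 + ... + 1/n, lies on all scales between 1
  and n. Passing to the exponent of n makes it uniform. The function sin(2x) appears in the moment
  identity because s1 s2 is a second harmonic on the circle: testing the exponent of the
  characteristic function against that harmonic isolates the moment.\<close>

lemma integral_periodic_shift:
  fixes h :: "real \<Rightarrow> real"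
  assumes cont: "continuous_on UNIV h" and per: "\<And>x. h (x + 2 * pi) = h x"
    and t: "0 \<le> t" "t \<le> 2 * pi"
  shows "integral {-pi..pi} (\<lambda>x. h (x - t)) = integral {-pi..pi} h"
proof -
  have int: "h integrable_on {a..b}" for a b
    by (rule integrable_continuous_real) (rule continuous_on_subset[OF cont], simp)
  have "integral {-pi..pi} (\<lambda>x. h (x - t)) = integral {-pi - t..pi - t} h"
    using integral_shift_Icc_real[of "-pi" pi h "-t"] by (simp add: o_def)
  also have "\<dots> = integral {-pi - t..-pi} h + integral {-pi..pi - t} h"
    using t by (intro Henstock_Kurzweil_Integration.integral_combine[symmetric] int) auto
  also have "integral {-pi - t..-pi} h = integral {pi - t..pi} h"
    using integral_shift_Icc_real[of "-pi - t" "-pi" h "2 * pi"] per by (simp add: o_def add.commute)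
  also have "\<dots> + integral {-pi..pi - t} h = integral {-pi..pi} h"
    using Henstock_Kurzweil_Integration.integral_combine[of "-pi" "pi - t" pi h] t int by simp
  finally show ?thesis .
qed

text \<open>Up to normalisation, the Fourier coefficient of |cos|^alpha at frequency 2. Convolution
  with |cos|^alpha multiplies second harmonics by it.\<close>

definition angular_const :: "real \<Rightarrow> real" where
  "angular_const \<alpha> = integral {-pi..pi} (\<lambda>x. cos (2 * x) * \<bar>cos x\<bar> powr \<alpha>)"

text \<open>Since cos(2x) has mean zero over the period, subtracting the constant \<open>d\<close>
  from |cos x|^alpha does not change the integral. As \<open>d\<close> is the value of |cos x|^alpha
  at the zeros of cos(2x), both factors of \<open>f\<close> change sign together at |cos x| = 1 /
  sqrt 2. Hence \<open>f\<close> is nonnegative, and it does not vanish at 0.\<close>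

lemma angular_const_pos:
  assumes "\<alpha> > 0"
  shows "angular_const \<alpha> > 0"
proof -
  define d :: real where "d = (1 / sqrt 2) powr \<alpha>"
  define f where "f x = cos (2 * x) * (\<bar>cos x\<bar> powr \<alpha> - d)" for x
  have cont: "continuous_on A (\<lambda>x. cos (2 * x) * \<bar>cos x\<bar> powr \<alpha>)" for A
    using assms by (intro continuous_intros continuous_on_powr') auto
  have contf: "continuous_on A f" for A
    unfolding f_def using assms by (intro continuous_intros continuous_on_powr') auto
  have nonneg: "f x \<ge> 0" for x
  proof (cases "\<bar>cos x\<bar> \<ge> 1 / sqrt 2")
    case True
    then have "(1 / sqrt 2)\<^sup>2 \<le> \<bar>cos x\<bar>\<^sup>2" by (intro power_mono) auto
    then have "cos (2 * x) \<ge> 0"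
      by (simp add: cos_double_cos power_divide)
    moreover have "d \<le> \<bar>cos x\<bar> powr \<alpha>"
      unfolding d_def using True assms by (intro powr_mono2) auto
    ultimately show ?thesis unfolding f_def by simp
  next
    case False
    then have "\<bar>cos x\<bar>\<^sup>2 \<le> (1 / sqrt 2)\<^sup>2" by (intro power_mono) auto
    then have "cos (2 * x) \<le> 0"
      by (simp add: cos_double_cos power_divide)
    moreover have "\<bar>cos x\<bar> powr \<alpha> \<le> d"
      unfolding d_def using False assms by (intro powr_mono2) auto
    ultimately show ?thesis unfolding f_def by (simp add: mult_nonpos_nonpos)
  qed
  have "d < 1 powr \<alpha>" unfolding d_def using assms by (intro powr_less_mono2) auto
  then have "f 0 \<noteq> 0" by (simp add: f_def)
  have "((\<lambda>x. cos (2 * x)) has_integral (sin (2 * pi) / 2 - sin (2 * (-pi)) / 2)) {-pi..pi}"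
    by (intro fundamental_theorem_of_calculus)
       (auto simp: has_real_derivative_iff_has_vector_derivative[symmetric] intro!: derivative_eq_intros)
  then have c0: "((\<lambda>x. cos (2 * x)) has_integral 0) {-pi..pi}" by simp
  have "integral {-pi..pi} f \<noteq> 0"
    using integral_eq_0_iff[of "-pi" pi f] contf nonneg \<open>f 0 \<noteq> 0\<close> by (auto simp: box_real)
  moreover have "integral {-pi..pi} f \<ge> 0"
    using nonneg by (intro Henstock_Kurzweil_Integration.integral_nonneg integrable_continuous_real contf) auto
  moreover have "integral {-pi..pi} f = angular_const \<alpha>"
  proof -
    have "integral {-pi..pi} f = integral {-pi..pi} (\<lambda>x. cos (2 * x) * \<bar>cos x\<bar> powr \<alpha> - cos (2 * x) * d)"
      by (simp add: f_def[abs_def] algebra_simps)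
    also have "\<dots> = angular_const \<alpha> - integral {-pi..pi} (\<lambda>x. cos (2 * x) * d)"
      unfolding angular_const_def
      by (intro Henstock_Kurzweil_Integration.integral_diff integrable_continuous_real cont continuous_intros)
    also have "integral {-pi..pi} (\<lambda>x. cos (2 * x) * d) = 0"
      using integral_unique[OF has_integral_mult_left[OF c0, of d]] by (simp only: mult_zero_left)
    finally show ?thesis by simp
  qed
  ultimately show ?thesis by linarith
qed

text \<open>For s = (cos t, sin t) the inner product is cos(x - t). Translation by t moves the phase
  into sin(2x + 2t); the addition formula leaves sin(2t) times the even part, and the part with
  sin(2x) is odd and integrates to zero. Finally sin(2t) = 2 s1 s2.\<close>

lemma angular_integral:
  assumes "\<alpha> > 0" and s: "s \<in> unit_circle"
  shows "(LINT x:{-pi..pi}|lborel. sin (2 * x) * \<bar>cos x * fst s + sin x * snd s\<bar> powr \<alpha>)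
     = 2 * angular_const \<alpha> * (fst s * snd s)"
proof -
  from s have "norm s = 1" by simp
  then have "(fst s)\<^sup>2 + (snd s)\<^sup>2 = 1"
    by (cases s) (simp add: norm_Pair real_sqrt_eq_1_iff)
  then obtain t where t: "0 \<le> t" "t < 2 * pi" "fst s = cos t" "snd s = sin t"
    by (rule sincos_total_2pi)
  define h where "h u = sin (2 * u + 2 * t) * \<bar>cos u\<bar> powr \<alpha>" for u
  have conth: "continuous_on A h" for A
    unfolding h_def using assms by (intro continuous_intros continuous_on_powr') auto
  have cosp: "cos (x + 2 * pi) = cos x" "sin (x + 2 * pi + 2 * pi) = sin x" for x :: real
    by (simp_all add: cos_add sin_add)
  have per: "h (x + 2 * pi) = h x" for x
    using cosp(2)[of "2 * x + 2 * t"] cosp(1)[of x] by (simp add: h_def algebra_simps)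
  have eq: "sin (2 * x) * \<bar>cos x * fst s + sin x * snd s\<bar> powr \<alpha> = h (x - t)" for x
    by (simp add: h_def t cos_diff algebra_simps)
  have cont1: "continuous_on A (\<lambda>x. cos (2 * x) * \<bar>cos x\<bar> powr \<alpha>)"
    and cont2: "continuous_on A (\<lambda>x. sin (2 * x) * \<bar>cos x\<bar> powr \<alpha>)" for A
    using assms by (intro continuous_intros continuous_on_powr'; auto)+
  have odd: "integral {-pi..pi} (\<lambda>x. sin (2 * x) * \<bar>cos x\<bar> powr \<alpha>) = 0"
    using Henstock_Kurzweil_Integration.integral_reflect_real[of pi "-pi" "\<lambda>x. sin (2 * x) * \<bar>cos x\<bar> powr \<alpha>"] by simp
  have conts: "continuous_on A (\<lambda>x. h (x - t))" for A
    unfolding h_def using assms by (intro continuous_intros continuous_on_powr') auto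
  have "(LINT x:{-pi..pi}|lborel. sin (2 * x) * \<bar>cos x * fst s + sin x * snd s\<bar> powr \<alpha>)
      = integral {-pi..pi} (\<lambda>x. h (x - t))"
    unfolding eq by (rule set_borel_integral_eq_integral(2) borel_integrable_atLeastAtMost' conts)+
  also have "\<dots> = integral {-pi..pi} h"
    using t by (intro integral_periodic_shift conth per) auto
  also have "\<dots> = integral {-pi..pi} (\<lambda>x. sin (2 * t) * (cos (2 * x) * \<bar>cos x\<bar> powr \<alpha>)
                     + cos (2 * t) * (sin (2 * x) * \<bar>cos x\<bar> powr \<alpha>))"
    by (rule Henstock_Kurzweil_Integration.integral_cong) (simp add: h_def sin_add algebra_simps)
  also have "\<dots> = sin (2 * t) * angular_const \<alpha> + cos (2 * t) * 0"
    unfolding angular_const_def odd[symmetric]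
    by (subst Henstock_Kurzweil_Integration.integral_add)
       (auto intro!: integrable_continuous_real continuous_intros cont1 cont2 simp del: odd)
  also have "\<dots> = 2 * angular_const \<alpha> * (fst s * snd s)"
    by (simp add: t sin_double)
  finally show ?thesis .
qed

text \<open>The left-hand side sees \<open>\<Gamma>\<close> only through the exponent of the
  characteristic function in the directions (cos x, sin x). After exchanging the integrals, the
  identity is \<open>angular_integral\<close> for each \<open>s\<close>.\<close>

lemma spectral_moment:
  fixes \<Gamma> :: "(real \<times> real) measure"
  assumes "\<alpha> > 0" and sets[measurable_cong]: "sets \<Gamma> = sets (restrict_space borel unit_circle)"
    and "finite_measure \<Gamma>"
  shows "(LINT x:{-pi..pi}|lborel. sin (2 * x) *
            (LINT s|\<Gamma>. \<bar>cos x * fst s + sin x * snd s\<bar> powr \<alpha>))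
         = 2 * angular_const \<alpha> * (LINT s|\<Gamma>. fst s * snd s)"
proof -
  interpret finite_measure \<Gamma> by fact
  \<comment> \<open>Restriction to one period makes this factor finite as well, so a bounded
    function is integrable on the product.\<close>
  define L :: "real measure" where "L = restrict_space lborel {-pi..pi}"
  have space: "space \<Gamma> = unit_circle"
    using sets_eq_imp_space_eq[OF sets] by (simp add: space_restrict_space)
  have bor[measurable]: "id \<in> \<Gamma> \<rightarrow>\<^sub>M borel"
    by (subst measurable_cong_sets[OF sets refl]) (simp add: measurable_restrict_space1)
  have [measurable]: "(\<lambda>s. fst s) \<in> \<Gamma> \<rightarrow>\<^sub>M borel" "(\<lambda>s. snd s) \<in> \<Gamma> \<rightarrow>\<^sub>M borel"
    using measurable_compose[OF bor, of fst] measurable_compose[OF bor, of snd] by (auto simp: borel_prod[symmetric])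
  have [measurable]: "(\<lambda>x. x) \<in> L \<rightarrow>\<^sub>M borel"
    unfolding L_def by (auto intro!: measurable_restrict_space1)
  interpret L: finite_measure L
    by (rule finite_measureI) (simp add: L_def emeasure_restrict_space space_restrict_space)
  interpret P: pair_sigma_finite \<Gamma> L ..
  interpret PF: finite_measure "\<Gamma> \<Otimes>\<^sub>M L"
    by (rule finite_measureI)
       (simp add: space_pair_measure L.emeasure_pair_measure_Times emeasure_eq_measure L.emeasure_eq_measure ennreal_mult[symmetric])
  define f where "f s x = sin (2 * x) * \<bar>cos x * fst s + sin x * snd s\<bar> powr \<alpha>" for s :: "real \<times> real" and x
  have [measurable]: "case_prod f \<in> borel_measurable (\<Gamma> \<Otimes>\<^sub>M L)"
    unfolding f_def by measurable
  have bound: "norm (f s x) \<le> 2 powr \<alpha>" if "s \<in> unit_circle" for s x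
  proof -
    have n: "norm s = 1" using that by simp
    have 1: "\<bar>fst s\<bar> \<le> 1" "\<bar>snd s\<bar> \<le> 1"
      using norm_fst_le[of "fst s" "snd s"] norm_snd_le[of "snd s" "fst s"] n by auto
    have "\<bar>cos x * fst s + sin x * snd s\<bar> \<le> \<bar>cos x\<bar> * \<bar>fst s\<bar> + \<bar>sin x\<bar> * \<bar>snd s\<bar>"
      by (metis abs_mult abs_triangle_ineq)
    also have "\<dots> \<le> 1 * 1 + 1 * 1"
      by (intro add_mono mult_mono) (use 1 in auto)
    finally have "\<bar>cos x * fst s + sin x * snd s\<bar> powr \<alpha> \<le> 2 powr \<alpha>"
      using assms by (intro powr_mono2) auto
    then have "\<bar>sin (2 * x)\<bar> * \<bar>cos x * fst s + sin x * snd s\<bar> powr \<alpha> \<le> 1 * 2 powr \<alpha>"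
      by (intro mult_mono) auto
    then show ?thesis by (simp add: f_def abs_mult)
  qed
  have int: "integrable (\<Gamma> \<Otimes>\<^sub>M L) (case_prod f)"
    by (rule PF.integrable_const_bound[of _ "2 powr \<alpha>"])
       (use bound space in \<open>force intro!: AE_I2 simp: space_pair_measure\<close>)+
  have setL: "(LINT x|L. g x) = (LINT x:{-pi..pi}|lborel. g x)" for g :: "real \<Rightarrow> real"
    unfolding L_def by (simp add: integral_restrict_space set_lebesgue_integral_def)
  have "(LINT x|L. LINT s|\<Gamma>. f s x) = (LINT s|\<Gamma>. LINT x|L. f s x)"
    using P.Fubini_integral[OF int] by simp
  also have "\<dots> = (LINT s|\<Gamma>. 2 * angular_const \<alpha> * (fst s * snd s))"
    by (rule Bochner_Integration.integral_cong) (use angular_integral[OF \<open>\<alpha> > 0\<close>] space in \<open>auto simp: setL f_def\<close>)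
  also have "\<dots> = 2 * angular_const \<alpha> * (LINT s|\<Gamma>. fst s * snd s)" by simp
  finally show ?thesis by (simp add: setL f_def)
qed

text \<open>Two spectral measures of the same vector have the same exponent function, hence the same
  mixed moment. So the value does not depend on which of them \<open>SOME\<close> selects.\<close>

lemma spectral_covariance_eq:
  assumes "\<alpha> > 0" and \<Gamma>: "spectral_measure \<alpha> M X1 X2 \<Gamma>"
  shows "spectral_covariance \<alpha> M X1 X2 = (LINT s|\<Gamma>. fst s * snd s)"
proof -
  define \<Delta> where "\<Delta> = (SOME \<Gamma>. spectral_measure \<alpha> M X1 X2 \<Gamma>)"
  have \<Delta>: "spectral_measure \<alpha> M X1 X2 \<Delta>" unfolding \<Delta>_def by (rule someI) (rule \<Gamma>)
  have eq: "(LINT s|\<Gamma>. \<bar>x * fst s + y * snd s\<bar> powr \<alpha>) = (LINT s|\<Delta>. \<bar>x * fst s + y * snd s\<bar> powr \<alpha>)" for x y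
  proof -
    have "complex_of_real (exp (- (LINT s|\<Gamma>. \<bar>x * fst s + y * snd s\<bar> powr \<alpha>))) =
          complex_of_real (exp (- (LINT s|\<Delta>. \<bar>x * fst s + y * snd s\<bar> powr \<alpha>)))"
      using \<Gamma> \<Delta> unfolding spectral_measure_def by metis
    then show ?thesis by simp
  qed
  have "2 * angular_const \<alpha> * (LINT s|\<Gamma>. fst s * snd s) = 2 * angular_const \<alpha> * (LINT s|\<Delta>. fst s * snd s)"
    using \<Gamma> \<Delta> unfolding spectral_measure_def
    by (subst (1 2) spectral_moment[OF \<open>\<alpha> > 0\<close>, symmetric]) (simp_all only: eq)
  then have "(LINT s|\<Gamma>. fst s * snd s) = (LINT s|\<Delta>. fst s * snd s)"
    using angular_const_pos[OF \<open>\<alpha> > 0\<close>] by simp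
  then show ?thesis by (simp add: spectral_covariance_def \<Delta>_def)
qed

section \<open>Characteristic functions and discrete spectral measures\<close>

lemma norm_iexp_diff_le: "norm (iexp x - iexp y) \<le> \<bar>x - y\<bar>"
proof -
  have "norm (iexp x - iexp y) = norm (iexp y * (iexp (x - y) - 1))"
    by (simp add: algebra_simps exp_add[symmetric])
  also have "\<dots> = norm (iexp (x - y) - 1)" by (simp add: norm_mult)
  also have "\<dots> \<le> \<bar>x - y\<bar>" using iexp_approx1[of "x - y" 0] by simp
  finally show ?thesis .
qed

text \<open>Where both deviations are at most \<open>\<delta>\<close>, the Lipschitz bound for
  \<open>iexp\<close> applies; elsewhere the difference is at most 2, on a set whose probability
  tends to 0.\<close>

lemma (in prob_space) tendsto_iexp_of_tendsto_in_prob: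
  fixes S T :: "nat \<Rightarrow> 'a \<Rightarrow> real"
  assumes [measurable]: "\<And>N. S N \<in> borel_measurable M" "\<And>N. T N \<in> borel_measurable M"
      "Y \<in> borel_measurable M" "Z \<in> borel_measurable M"
    and S: "\<And>\<delta>. \<delta> > 0 \<Longrightarrow> (\<lambda>N. prob {\<omega> \<in> space M. \<bar>S N \<omega> - Y \<omega>\<bar> > \<delta>}) \<longlonglongrightarrow> 0"
    and T: "\<And>\<delta>. \<delta> > 0 \<Longrightarrow> (\<lambda>N. prob {\<omega> \<in> space M. \<bar>T N \<omega> - Z \<omega>\<bar> > \<delta>}) \<longlonglongrightarrow> 0"
  shows "(\<lambda>N. CLINT \<omega>|M. iexp (x * S N \<omega> + y * T N \<omega>)) \<longlonglongrightarrow> (CLINT \<omega>|M. iexp (x * Y \<omega> + y * Z \<omega>))"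
proof (rule LIMSEQ_I)
  fix e :: real assume "e > 0"
  \<comment> \<open>The \<open>+ 1\<close> keeps \<open>C\<close> positive when x = y = 0;
    \<open>\<delta>\<close> is chosen so that the Lipschitz part equals e / 2.\<close>
  define C where "C = \<bar>x\<bar> + \<bar>y\<bar> + 1"
  define \<delta> where "\<delta> = e / (2 * C)"
  have "C > 0" by (simp add: C_def add_nonneg_pos)
  then have "\<delta> > 0" using \<open>e > 0\<close> by (simp add: \<delta>_def)
  define E1 where "E1 N = {\<omega> \<in> space M. \<bar>S N \<omega> - Y \<omega>\<bar> > \<delta>}" for N
  define E2 where "E2 N = {\<omega> \<in> space M. \<bar>T N \<omega> - Z \<omega>\<bar> > \<delta>}" for N
  have [measurable]: "E1 N \<in> sets M" "E2 N \<in> sets M" for N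
    unfolding E1_def E2_def by measurable
  have bound: "norm ((CLINT \<omega>|M. iexp (x * S N \<omega> + y * T N \<omega>)) - (CLINT \<omega>|M. iexp (x * Y \<omega> + y * Z \<omega>)))
      \<le> C * \<delta> + 2 * prob (E1 N) + 2 * prob (E2 N)" for N
  proof -
    have "(CLINT \<omega>|M. iexp (x * S N \<omega> + y * T N \<omega>)) - (CLINT \<omega>|M. iexp (x * Y \<omega> + y * Z \<omega>))
        = (CLINT \<omega>|M. iexp (x * S N \<omega> + y * T N \<omega>) - iexp (x * Y \<omega> + y * Z \<omega>))"
      by (intro Bochner_Integration.integral_diff[symmetric] integrable_iexp) auto
    also have "norm \<dots> \<le> (LINT \<omega>|M. norm (iexp (x * S N \<omega> + y * T N \<omega>) - iexp (x * Y \<omega> + y * Z \<omega>)))"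
      by (rule integral_norm_bound)
    also have "\<dots> \<le> (LINT \<omega>|M. C * \<delta> + 2 * indicator (E1 N) \<omega> + 2 * indicator (E2 N) \<omega>)"
    proof (rule integral_mono)
      show "integrable M (\<lambda>\<omega>. norm (iexp (x * S N \<omega> + y * T N \<omega>) - iexp (x * Y \<omega> + y * Z \<omega>)))"
        by (intro integrable_norm Bochner_Integration.integrable_diff integrable_iexp) auto
      show "integrable M (\<lambda>\<omega>. C * \<delta> + 2 * indicator (E1 N) \<omega> + 2 * indicator (E2 N) \<omega>)"
        by (intro Bochner_Integration.integrable_add integrable_const integrable_mult_right)
           (auto simp: emeasure_eq_measure)
      fix \<omega> assume \<omega>: "\<omega> \<in> space M"
      have two: "norm (iexp (x * S N \<omega> + y * T N \<omega>) - iexp (x * Y \<omega> + y * Z \<omega>)) \<le> 2"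
        by (rule order_trans[OF norm_triangle_ineq4]) simp
      show "norm (iexp (x * S N \<omega> + y * T N \<omega>) - iexp (x * Y \<omega> + y * Z \<omega>))
          \<le> C * \<delta> + 2 * indicator (E1 N) \<omega> + 2 * indicator (E2 N) \<omega>"
      proof (cases "\<omega> \<in> E1 N \<or> \<omega> \<in> E2 N")
        case True
        have "C * \<delta> \<ge> 0" using \<open>C > 0\<close> \<open>\<delta> > 0\<close> by simp
        with True two show ?thesis by (auto simp: indicator_def)
      next
        case False
        then have *: "\<bar>S N \<omega> - Y \<omega>\<bar> \<le> \<delta>" "\<bar>T N \<omega> - Z \<omega>\<bar> \<le> \<delta>"
          using \<omega> by (auto simp: E1_def E2_def)
        have "norm (iexp (x * S N \<omega> + y * T N \<omega>) - iexp (x * Y \<omega> + y * Z \<omega>))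
            \<le> \<bar>x * S N \<omega> + y * T N \<omega> - (x * Y \<omega> + y * Z \<omega>)\<bar>"
          by (rule norm_iexp_diff_le)
        also have "\<dots> = \<bar>x * (S N \<omega> - Y \<omega>) + y * (T N \<omega> - Z \<omega>)\<bar>" by (simp add: algebra_simps)
        also have "\<dots> \<le> \<bar>x\<bar> * \<bar>S N \<omega> - Y \<omega>\<bar> + \<bar>y\<bar> * \<bar>T N \<omega> - Z \<omega>\<bar>"
          by (metis abs_mult abs_triangle_ineq)
        also have "\<dots> \<le> \<bar>x\<bar> * \<delta> + \<bar>y\<bar> * \<delta>" using * by (intro add_mono mult_left_mono) auto
        also have "\<dots> \<le> C * \<delta>" using \<open>\<delta> > 0\<close> by (simp add: C_def algebra_simps)
        finally show ?thesis by (simp add: add_increasing2)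
      qed
    qed
    also have "\<dots> = C * \<delta> + 2 * prob (E1 N) + 2 * prob (E2 N)"
      by (simp add: prob_space emeasure_eq_measure)
    finally show ?thesis .
  qed
  have "(\<lambda>N. C * \<delta> + 2 * prob (E1 N) + 2 * prob (E2 N)) \<longlonglongrightarrow> C * \<delta> + 2 * 0 + 2 * 0"
    unfolding E1_def E2_def by (intro tendsto_intros S T \<open>\<delta> > 0\<close>)
  moreover have "C * \<delta> + 2 * 0 + 2 * 0 < e" using \<open>C > 0\<close> \<open>e > 0\<close> by (simp add: \<delta>_def)
  ultimately have "\<forall>\<^sub>F N in sequentially. C * \<delta> + 2 * prob (E1 N) + 2 * prob (E2 N) < e"
    by (rule order_tendstoD(2))
  then show "\<exists>no. \<forall>N\<ge>no. norm ((CLINT \<omega>|M. iexp (x * S N \<omega> + y * T N \<omega>)) -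
      (CLINT \<omega>|M. iexp (x * Y \<omega> + y * Z \<omega>))) < e"
    unfolding eventually_sequentially using bound by (meson le_less_trans)
qed

lemma iexp_stable_sum:
  assumes "prob_space M" and eps: "iid_symmetric_stable \<alpha> M \<epsilon>" and "finite F" and "inj_on g F"
  shows "(CLINT \<omega>|M. iexp (\<Sum>p\<in>F. t p * \<epsilon> (g p) \<omega>)) = complex_of_real (exp (- (\<Sum>p\<in>F. \<bar>t p\<bar> powr \<alpha>)))"
proof -
  interpret prob_space M by fact
  from eps have ind: "indep_vars (\<lambda>_. borel) \<epsilon> UNIV"
    and ch: "char (distr M borel (\<epsilon> p)) \<theta> = complex_of_real (exp (- (\<bar>\<theta>\<bar> powr \<alpha>)))" for p \<theta>
    unfolding iid_symmetric_stable_def by blast+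
  have [measurable]: "\<epsilon> p \<in> borel_measurable M" for p
    using ind unfolding indep_vars_def by blast
  \<comment> \<open>Independence is indexed by lattice sites, so the coefficients are transported
    from \<open>F\<close> to the sites along the inverse of \<open>g\<close>.\<close>
  define s where "s q = t (the_inv_into F g q)" for q
  have s: "s (g p) = t p" if "p \<in> F" for p
    using that assms by (simp add: s_def the_inv_into_f_f)
  have "indep_vars (\<lambda>_. borel) (\<lambda>q \<omega>. s q * \<epsilon> q \<omega>) (g ` F)"
    by (rule indep_vars_compose2[OF indep_vars_subset[OF ind]]) auto
  then have "char (distr M borel (\<lambda>\<omega>. \<Sum>q\<in>g ` F. s q * \<epsilon> q \<omega>)) 1
      = (\<Prod>q\<in>g ` F. char (distr M borel (\<lambda>\<omega>. s q * \<epsilon> q \<omega>)) 1)"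
    by (rule char_distr_sum)
  also have "\<dots> = (\<Prod>q\<in>g ` F. complex_of_real (exp (- (\<bar>s q\<bar> powr \<alpha>))))"
  proof (rule prod.cong[OF refl])
    fix q
    show "char (distr M borel (\<lambda>\<omega>. s q * \<epsilon> q \<omega>)) 1 = complex_of_real (exp (- (\<bar>s q\<bar> powr \<alpha>)))"
      unfolding ch[of q, symmetric] by (simp add: char_def integral_distr)
  qed
  also have "\<dots> = complex_of_real (exp (- (\<Sum>q\<in>g ` F. \<bar>s q\<bar> powr \<alpha>)))"
    using \<open>finite F\<close> by (simp add: exp_sum sum_negf[symmetric])
  also have "(\<Sum>q\<in>g ` F. \<bar>s q\<bar> powr \<alpha>) = (\<Sum>p\<in>F. \<bar>t p\<bar> powr \<alpha>)"
    using assms(4) by (simp add: sum.reindex s)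
  also have "char (distr M borel (\<lambda>\<omega>. \<Sum>q\<in>g ` F. s q * \<epsilon> q \<omega>)) 1 = (CLINT \<omega>|M. iexp (\<Sum>q\<in>g ` F. s q * \<epsilon> q \<omega>))"
    by (simp add: char_def integral_distr)
  also have "(\<lambda>\<omega>. \<Sum>q\<in>g ` F. s q * \<epsilon> q \<omega>) = (\<lambda>\<omega>. \<Sum>p\<in>F. t p * \<epsilon> (g p) \<omega>)"
    using assms(4) by (simp add: sum.reindex s)
  finally show ?thesis .
qed

text \<open>Boxes are cofinal among the finite index sets and turn the unordered limit into a
  sequential one. The offsets let the partial sums of \<open>X 0 0\<close> and \<open>X n m\<close>
  end at the same innovation site (-N, -N).\<close>

lemma filterlim_box_finite_subsets_at_top:
  "filterlim (\<lambda>N. {..N + n} \<times> {..N + m}) (finite_subsets_at_top (UNIV :: (nat \<times> nat) set)) sequentially"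
  unfolding filterlim_finite_subsets_at_top
proof (intro allI impI)
  fix Y :: "(nat \<times> nat) set" assume "finite Y \<and> Y \<subseteq> UNIV"
  then have "finite Y" by simp
  define K where "K = Max (insert 0 (fst ` Y \<union> snd ` Y))"
  have K: "a \<le> K" "b \<le> K" if "(a, b) \<in> Y" for a b
    using \<open>finite Y\<close> that by (auto simp: K_def intro!: Max_ge image_eqI[of _ fst "(a, b)"] image_eqI[of _ snd "(a, b)"])
  show "\<forall>\<^sub>F N in sequentially. finite ({..N + n} \<times> {..N + m}) \<and> Y \<subseteq> {..N + n} \<times> {..N + m} \<and> {..N + n} \<times> {..N + m} \<subseteq> UNIV"
    using eventually_ge_at_top[of K]
  proof eventually_elim
    case (elim N)
    then show ?case using K by (force intro: order_trans)
  qed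
qed

text \<open>The coefficient of \<open>X 0 0\<close> at the innovation site (n - a, m - b). It is 0
  at sites that are not in the past quadrant of the origin.\<close>

definition shifted :: "(nat \<Rightarrow> nat \<Rightarrow> real) \<Rightarrow> nat \<Rightarrow> nat \<Rightarrow> nat \<times> nat \<Rightarrow> real" where
  "shifted c n m = (\<lambda>(a, b). if n \<le> a \<and> m \<le> b then c (a - n) (b - m) else 0)"

text \<open>Both components are written as series in the innovations at the sites \<open>(n - a, m - b)\<close>.\<close>

lemma iexp_linear_random_field:
  assumes "prob_space M" and eps: "iid_symmetric_stable \<alpha> M \<epsilon>" and X: "linear_random_field M c \<epsilon> X"
    and int: "integrable (count_space UNIV) (\<lambda>p. \<bar>x * shifted c n m p + y * case_prod c p\<bar> powr \<alpha>)"
  shows "(CLINT \<omega>|M. iexp (x * X 0 0 \<omega> + y * X (int n) (int m) \<omega>)) =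
    complex_of_real (exp (- (LINT p|count_space UNIV. \<bar>x * shifted c n m p + y * case_prod c p\<bar> powr \<alpha>)))"
proof -
  interpret prob_space M by fact
  define g where "g = (\<lambda>(a, b). (int n - int a, int m - int b))"
  have "inj g" by (auto simp: g_def inj_on_def)
  define box where "box N = {..N + n} \<times> {..N + m}" for N
  have [measurable]: "\<epsilon> p \<in> borel_measurable M" for p
    using eps unfolding iid_symmetric_stable_def indep_vars_def by blast
  have Xm[measurable]: "X k l \<in> borel_measurable M" for k l
    using X unfolding linear_random_field_def by auto
  define S where "S N \<omega> = (\<Sum>p\<in>box N. shifted c n m p * \<epsilon> (g p) \<omega>)" for N \<omega>
  define T where "T N \<omega> = (\<Sum>p\<in>box N. case_prod c p * \<epsilon> (g p) \<omega>)" for N \<omega>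
  have lim: "((\<lambda>F. prob {\<omega> \<in> space M. \<bar>(\<Sum>(i, j)\<in>F. c i j * \<epsilon> (k - int i, l - int j) \<omega>) - X k l \<omega>\<bar> > \<delta>})
           \<longlongrightarrow> 0) (finite_subsets_at_top UNIV)" if "\<delta> > 0" for k l \<delta>
    using X that unfolding linear_random_field_def by auto
  \<comment> \<open>Only the translate of \<open>{..N} \<times> {..N}\<close> by (n, m) contributes
    to \<open>S N\<close>, which is therefore a box sum of the series for
    \<open>X 0 0\<close>.\<close>
  have S_eq: "S N \<omega> = (\<Sum>(i, j)\<in>{..N + 0} \<times> {..N + 0}. c i j * \<epsilon> (0 - int i, 0 - int j) \<omega>)" for N \<omega>
  proof -
    have im: "(\<lambda>(i, j). (i + n, j + m)) ` ({..N} \<times> {..N}) = {p \<in> box N. n \<le> fst p \<and> m \<le> snd p}"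
    proof -
      have "(a, b) \<in> (\<lambda>(i, j). (i + n, j + m)) ` ({..N} \<times> {..N})" if "a \<le> N + n" "b \<le> N + m" "n \<le> a" "m \<le> b" for a b
        using that by (intro image_eqI[of _ _ "(a - n, b - m)"]) auto
      then show ?thesis by (auto simp: box_def)
    qed
    have "S N \<omega> = (\<Sum>p\<in>{p \<in> box N. n \<le> fst p \<and> m \<le> snd p}. shifted c n m p * \<epsilon> (g p) \<omega>)"
      unfolding S_def by (intro sum.mono_neutral_right) (auto simp: box_def shifted_def split: if_splits)
    also have "\<dots> = (\<Sum>p\<in>{..N} \<times> {..N}. shifted c n m (case p of (i, j) \<Rightarrow> (i + n, j + m)) * \<epsilon> (g (case p of (i, j) \<Rightarrow> (i + n, j + m))) \<omega>)"
      unfolding im[symmetric] by (subst sum.reindex) (auto simp: inj_on_def)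
    also have "\<dots> = (\<Sum>(i, j)\<in>{..N + 0} \<times> {..N + 0}. c i j * \<epsilon> (0 - int i, 0 - int j) \<omega>)"
      by (intro sum.cong) (auto simp: shifted_def g_def)
    finally show ?thesis .
  qed
  have T_eq: "T N \<omega> = (\<Sum>(i, j)\<in>{..N + n} \<times> {..N + m}. c i j * \<epsilon> (int n - int i, int m - int j) \<omega>)" for N \<omega>
    unfolding T_def box_def by (intro sum.cong) (auto simp: g_def)
  have "(\<lambda>N. CLINT \<omega>|M. iexp (x * S N \<omega> + y * T N \<omega>)) \<longlonglongrightarrow> (CLINT \<omega>|M. iexp (x * X 0 0 \<omega> + y * X (int n) (int m) \<omega>))"
  proof (rule tendsto_iexp_of_tendsto_in_prob)
    show "S N \<in> borel_measurable M" "T N \<in> borel_measurable M" for N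
      unfolding S_def T_def by measurable
    fix \<delta> :: real assume "\<delta> > 0"
    show "(\<lambda>N. prob {\<omega> \<in> space M. \<bar>S N \<omega> - X 0 0 \<omega>\<bar> > \<delta>}) \<longlonglongrightarrow> 0"
      unfolding S_eq by (rule filterlim_compose[OF lim[OF \<open>\<delta> > 0\<close>] filterlim_box_finite_subsets_at_top])
    show "(\<lambda>N. prob {\<omega> \<in> space M. \<bar>T N \<omega> - X (int n) (int m) \<omega>\<bar> > \<delta>}) \<longlonglongrightarrow> 0"
      unfolding T_eq by (rule filterlim_compose[OF lim[OF \<open>\<delta> > 0\<close>] filterlim_box_finite_subsets_at_top])
  qed measurable
  moreover have "(CLINT \<omega>|M. iexp (x * S N \<omega> + y * T N \<omega>)) =
     complex_of_real (exp (- (\<Sum>p\<in>box N. \<bar>x * shifted c n m p + y * case_prod c p\<bar> powr \<alpha>)))" for N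
  proof -
    \<comment> \<open>Collecting both sums by innovation site gives a single sum of independent
      terms.\<close>
    have "x * S N \<omega> + y * T N \<omega> = (\<Sum>p\<in>box N. (x * shifted c n m p + y * case_prod c p) * \<epsilon> (g p) \<omega>)" for \<omega>
      by (simp add: S_def T_def sum_distrib_left sum.distrib[symmetric] algebra_simps)
    then show ?thesis
      using iexp_stable_sum[OF assms(1,2), of "box N" g "\<lambda>p. x * shifted c n m p + y * case_prod c p"] \<open>inj g\<close>
      by (simp add: box_def inj_on_subset)
  qed
  moreover have "(\<lambda>N. \<Sum>p\<in>box N. \<bar>x * shifted c n m p + y * case_prod c p\<bar> powr \<alpha>) \<longlonglongrightarrow>
      (LINT p|count_space UNIV. \<bar>x * shifted c n m p + y * case_prod c p\<bar> powr \<alpha>)"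
  proof -
    let ?f = "\<lambda>p. \<bar>x * shifted c n m p + y * case_prod c p\<bar> powr \<alpha>"
    have abs: "Infinite_Set_Sum.abs_summable_on ?f UNIV"
      using int by (simp add: abs_summable_on_def)
    then have "?f summable_on UNIV"
      using abs_summable_equivalent abs_summable_summable by blast
    then have "(?f has_sum infsum ?f UNIV) UNIV" by (rule has_sum_infsum)
    then have "(sum ?f \<longlongrightarrow> infsum ?f UNIV) (finite_subsets_at_top UNIV)" by (simp add: has_sum_def)
    then have "(\<lambda>N. sum ?f (box N)) \<longlonglongrightarrow> infsum ?f UNIV"
      unfolding box_def by (rule filterlim_compose[OF _ filterlim_box_finite_subsets_at_top])
    then show ?thesis using infsetsum_infsum[OF abs] by (simp add: infsetsum_def)
  qed
  then have "(\<lambda>N. complex_of_real (exp (- (\<Sum>p\<in>box N. \<bar>x * shifted c n m p + y * case_prod c p\<bar> powr \<alpha>)))) \<longlonglongrightarrow>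
      complex_of_real (exp (- (LINT p|count_space UNIV. \<bar>x * shifted c n m p + y * case_prod c p\<bar> powr \<alpha>)))"
    by (intro tendsto_intros)
  ultimately show ?thesis using LIMSEQ_unique by simp
qed

text \<open>Each vector \<open>v p\<close> puts mass |v p|^alpha on its direction, split equally
  between the direction and its antipode. The measure is a push-forward of a weighted counting
  measure in which the boolean carries the sign. For even \<open>h\<close> the two halves
  recombine.\<close>

lemma spectral_measure_discrete:
  fixes v :: "'i::countable \<Rightarrow> real \<times> real"
  assumes v: "\<And>p. v p \<noteq> 0" and int: "integrable (count_space UNIV) (\<lambda>p. norm (v p) powr \<alpha>)"
  obtains \<Gamma> where "sets \<Gamma> = sets (restrict_space borel unit_circle)" "finite_measure \<Gamma>"
    "distr \<Gamma> \<Gamma> uminus = \<Gamma>"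
    "\<And>h :: real \<times> real \<Rightarrow> real. h \<in> borel_measurable borel \<Longrightarrow> (\<And>s. h (- s) = h s) \<Longrightarrow>
      integrable (count_space UNIV) (\<lambda>p. norm (v p) powr \<alpha> * h (v p /\<^sub>R norm (v p))) \<Longrightarrow>
      (LINT s|\<Gamma>. h s) = (LINT p|count_space UNIV. norm (v p) powr \<alpha> * h (v p /\<^sub>R norm (v p)))"
proof -
  define C where "C = count_space (UNIV :: ('i \<times> bool) set)"
  define W where "W p = norm (v p) powr \<alpha>" for p
  define wt where "wt = (\<lambda>(p, b :: bool). W p / 2)"
  define D where "D = density C (\<lambda>x. ennreal (wt x))"
  define f where "f = (\<lambda>(p, b). (if b then 1 else - 1) *\<^sub>R (v p /\<^sub>R norm (v p)))"
  define R where "R = (restrict_space borel unit_circle :: (real \<times> real) measure)"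
  define \<Gamma> where "\<Gamma> = distr D R f"
  define flip where "flip = (\<lambda>(p :: 'i, b). (p, \<not> b))"
  have W0: "W p \<ge> 0" for p by (simp add: W_def)
  have prodC: "C = count_space UNIV \<Otimes>\<^sub>M count_space UNIV"
    unfolding C_def by (simp add: pair_measure_countable)
  interpret P: pair_sigma_finite "count_space (UNIV :: 'i set)" "count_space (UNIV :: bool set)"
    by (simp add: pair_sigma_finite_def sigma_finite_measure_count_space_countable)
  \<comment> \<open>Every index occurs with both signs, which undoes the factor 1/2.\<close>
  have double: "integrable C (\<lambda>(p, b). u p / 2)" "(LINT x|C. (case x of (p, b) \<Rightarrow> u p / 2)) = (LINT p|count_space UNIV. u p)"
    if "integrable (count_space UNIV) u" for u :: "'i \<Rightarrow> real"
  proof -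
    show i: "integrable C (\<lambda>(p, b). u p / 2)"
      unfolding prodC using that
      by (intro P.Fubini_integrable)
         (auto simp: pair_measure_countable lebesgue_integral_count_space_finite UNIV_bool integrable_count_space)
    show "(LINT x|C. (case x of (p, b) \<Rightarrow> u p / 2)) = (LINT p|count_space UNIV. u p)"
      using P.integral_fst'[of "\<lambda>(p, b). u p / 2"] i unfolding prodC
      by (simp add: lebesgue_integral_count_space_finite UNIV_bool)
  qed
  have fm[measurable]: "f \<in> C \<rightarrow>\<^sub>M R"
    by (auto simp: C_def R_def f_def space_restrict_space v)
  then have fD[measurable]: "f \<in> D \<rightarrow>\<^sub>M R" by (simp add: D_def)
  have um: "uminus \<in> R \<rightarrow>\<^sub>M R"
    unfolding R_def by (intro measurable_restrict_space3) auto
  have "integrable C wt"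
    using double(1)[of W] int unfolding wt_def W_def[symmetric] by simp
  then have "(\<integral>\<^sup>+x. ennreal (wt x) \<partial>C) < \<infinity>"
    using W0 unfolding integrable_iff_bounded by (simp add: wt_def case_prod_unfold)
  then have fin: "emeasure D (space D) < \<infinity>"
    by (simp add: D_def emeasure_density C_def)
  show ?thesis
  proof
    show "sets \<Gamma> = sets (restrict_space borel unit_circle)" by (simp add: \<Gamma>_def R_def)
    have "emeasure \<Gamma> (space \<Gamma>) = emeasure D (f -` space R \<inter> space D)"
      unfolding \<Gamma>_def by (simp add: emeasure_distr)
    also have "\<dots> \<le> emeasure D (space D)" by (rule emeasure_mono) auto
    finally show "finite_measure \<Gamma>" using fin by (intro finite_measureI) (auto simp: top_unique)
    \<comment> \<open>Flipping the sign bit preserves the weights and turns \<open>f\<close> into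
      its negative; this is the symmetry of \<open>\<Gamma>\<close>.\<close>
    have bij: "bij flip" by (rule o_bij[of flip]) (auto simp: flip_def fun_eq_iff)
    have "distr D C flip = D"
    proof -
      have "D = density (distr C C flip) (\<lambda>x. ennreal (wt x))"
        unfolding D_def C_def using distr_bij_count_space[OF bij] by simp
      also have "\<dots> = distr (density C (\<lambda>x. ennreal (wt (flip x)))) C flip"
        by (subst density_distr) (auto simp: C_def)
      also have "(\<lambda>x. ennreal (wt (flip x))) = (\<lambda>x. ennreal (wt x))"
        by (auto simp: wt_def flip_def)
      finally show ?thesis by (simp add: D_def)
    qed
    have "distr \<Gamma> \<Gamma> uminus = distr \<Gamma> R uminus" by (rule distr_cong) (auto simp: \<Gamma>_def)
    also have "\<dots> = distr D R (uminus \<circ> f)" unfolding \<Gamma>_def by (rule distr_distr[OF um fD])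
    also have "uminus \<circ> f = f \<circ> flip" by (auto simp: f_def flip_def fun_eq_iff)
    also have "distr D R (f \<circ> flip) = distr (distr D C flip) R f"
      by (rule distr_distr[symmetric, OF fm]) (simp add: D_def C_def)
    also have "\<dots> = \<Gamma>" by (simp add: \<open>distr D C flip = D\<close> \<Gamma>_def)
    finally show "distr \<Gamma> \<Gamma> uminus = \<Gamma>" .
    fix h :: "real \<times> real \<Rightarrow> real"
    assume hm: "h \<in> borel_measurable borel" and even: "\<And>s. h (- s) = h s"
      and i: "integrable (count_space UNIV) (\<lambda>p. norm (v p) powr \<alpha> * h (v p /\<^sub>R norm (v p)))"
    have "(LINT s|\<Gamma>. h s) = (LINT x|D. h (f x))"
      unfolding \<Gamma>_def by (rule integral_distr[OF fD]) (simp add: R_def hm measurable_restrict_space1)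
    also have "\<dots> = (LINT x|C. wt x * h (f x))"
      unfolding D_def by (subst integral_real_density) (auto simp: C_def wt_def W0)
    also have "\<dots> = (LINT x|C. (case x of (p, b) \<Rightarrow> (W p * h (v p /\<^sub>R norm (v p))) / 2))"
    proof (intro Bochner_Integration.integral_cong refl)
      fix x
      show "wt x * h (f x) = (case x of (p, b) \<Rightarrow> (W p * h (v p /\<^sub>R norm (v p))) / 2)"
        using even[of "v (fst x) /\<^sub>R norm (v (fst x))"] by (cases x) (auto simp: wt_def f_def simp del: scaleR_scaleR)
    qed
    also have "\<dots> = (LINT p|count_space UNIV. W p * h (v p /\<^sub>R norm (v p)))"
      by (rule double(2)) (use i in \<open>simp add: W_def\<close>)
    finally show "(LINT s|\<Gamma>. h s) = (LINT p|count_space UNIV. norm (v p) powr \<alpha> * h (v p /\<^sub>R norm (v p)))"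
      by (simp add: W_def)
  qed
qed

section \<open>The series for the spectral covariance\<close>

lemma
  fixes f :: "nat \<times> nat \<Rightarrow> real"
  assumes 0: "\<And>a b. \<not> (n \<le> a \<and> m \<le> b) \<Longrightarrow> f (a, b) = 0"
  shows integrable_count_space_shift: "integrable (count_space UNIV) f \<longleftrightarrow> integrable (count_space UNIV) (\<lambda>(i, j). f (i + n, j + m))"
    and integral_count_space_shift: "(LINT p|count_space UNIV. f p) = (LINT p|count_space UNIV. (case p of (i, j) \<Rightarrow> f (i + n, j + m)))"
proof -
  define g where "g = (\<lambda>(i, j). (i + n, j + m))"
  have g: "inj g" by (auto simp: g_def inj_on_def)
  have zero: "f p = 0" if "p \<notin> range g" for p
  proof (rule ccontr)
    assume "f p \<noteq> 0"
    then have "n \<le> fst p" "m \<le> snd p" using 0[of "fst p" "snd p"] by auto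
    then have "p = g (fst p - n, snd p - m)" by (simp add: g_def)
    with that show False by blast
  qed
  have eq: "(\<lambda>(i, j). f (i + n, j + m)) = (\<lambda>p. f (g p))" by (auto simp: g_def)
  have "Infinite_Set_Sum.abs_summable_on f UNIV \<longleftrightarrow> Infinite_Set_Sum.abs_summable_on f (range g)"
    by (intro abs_summable_on_cong_neutral) (auto simp: zero)
  also have "\<dots> \<longleftrightarrow> Infinite_Set_Sum.abs_summable_on (\<lambda>p. f (g p)) UNIV"
    using abs_summable_on_reindex_iff[OF g, of f] by simp
  finally show "integrable (count_space UNIV) f \<longleftrightarrow> integrable (count_space UNIV) (\<lambda>(i, j). f (i + n, j + m))"
    by (simp add: abs_summable_on_def eq)
  have "infsetsum f UNIV = infsetsum f (range g)"
    by (intro infsetsum_cong_neutral) (auto simp: zero)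
  also have "\<dots> = infsetsum (\<lambda>p. f (g p)) UNIV"
    using infsetsum_reindex[OF g, of f] by simp
  finally show "(LINT p|count_space UNIV. f p) = (LINT p|count_space UNIV. (case p of (i, j) \<Rightarrow> f (i + n, j + m)))"
    unfolding infsetsum_def eq .
qed

text \<open>This links the integral against counting measure to the iterated series, which occurs in
  \<open>rho\<close> for alpha = 2 and in the limit of the first case.\<close>

lemma integral_count_space_nat_prod:
  fixes f :: "nat \<times> nat \<Rightarrow> real"
  assumes f: "integrable (count_space UNIV) f"
  shows "(LINT p|count_space UNIV. f p) = (\<Sum>i. \<Sum>j. f (i, j))"
proof -
  let ?C = "count_space (UNIV :: nat set)"
  interpret pair_sigma_finite ?C ?C
    by (simp add: pair_sigma_finite_def sigma_finite_measure_count_space_countable)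
  have C: "count_space (UNIV :: (nat \<times> nat) set) = ?C \<Otimes>\<^sub>M ?C" by (simp add: pair_measure_countable)
  have i: "integrable (?C \<Otimes>\<^sub>M ?C) f" using f by (simp add: C)
  have inner: "integrable ?C (\<lambda>j. f (k, j))" for k
    using AE_integrable_fst'[OF i] by (simp add: AE_count_space)
  have "(LINT p|count_space UNIV. f p) = (LINT k|?C. LINT j|?C. f (k, j))"
    unfolding C by (rule integral_fst'[OF i, symmetric])
  also have "\<dots> = (\<Sum>k. LINT j|?C. f (k, j))"
    by (rule integral_count_space_nat) (rule integrable_fst'[OF i])
  also have "\<dots> = (\<Sum>k. \<Sum>j. f (k, j))"
    by (simp add: integral_count_space_nat[OF inner])
  finally show ?thesis .
qed

lemma sqrt_powr: "x \<ge> 0 \<Longrightarrow> sqrt x powr a = x powr (a / 2)"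
  by (simp add: powr_half_sqrt[symmetric] powr_powr)

lemma V_altdef: "V \<alpha> x y = (if (x, y) = 0 then 0 else x * y / norm (x, y) powr (2 - \<alpha>))"
proof -
  have "x\<^sup>2 + y\<^sup>2 > 0 \<longleftrightarrow> (x, y) \<noteq> 0" by (auto simp: zero_prod_def sum_power2_gt_zero_iff)
  then show ?thesis by (simp add: V_def norm_Pair sqrt_powr)
qed

lemma V_0_left [simp]: "V \<alpha> 0 y = 0"
  by (simp add: V_def)

lemma abs_V_le_norm: "\<bar>V \<alpha> x y\<bar> \<le> norm (x, y) powr \<alpha>"
proof (cases "(x, y) = 0")
  case False
  then have pos: "norm (x, y) > 0" by simp
  have "\<bar>x\<bar> \<le> norm (x, y)" "\<bar>y\<bar> \<le> norm (x, y)"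
    using norm_fst_le[of x y] norm_snd_le[of y x] by auto
  then have "\<bar>x\<bar> * \<bar>y\<bar> \<le> norm (x, y) * norm (x, y)" by (intro mult_mono) auto
  also have "\<dots> = norm (x, y) powr 2" using pos by (simp add: powr_numeral power2_eq_square)
  also have "\<dots> = norm (x, y) powr \<alpha> * norm (x, y) powr (2 - \<alpha>)"
    by (simp add: powr_add[symmetric])
  finally show ?thesis using False pos
    by (simp add: V_altdef abs_mult divide_le_eq)
qed (simp add: V_altdef)

lemma norm_powr_Pair_le:
  fixes x y :: real
  assumes "\<alpha> > 0"
  shows "norm (x, y) powr \<alpha> \<le> 2 powr \<alpha> * (\<bar>x\<bar> powr \<alpha> + \<bar>y\<bar> powr \<alpha>)"
proof -
  have "norm (x, y) powr \<alpha> \<le> (2 * max \<bar>x\<bar> \<bar>y\<bar>) powr \<alpha>"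
    using norm_Pair_le[of x y] assms by (intro powr_mono2) auto
  also have "\<dots> = 2 powr \<alpha> * max \<bar>x\<bar> \<bar>y\<bar> powr \<alpha>" by (simp add: powr_mult)
  also have "max \<bar>x\<bar> \<bar>y\<bar> powr \<alpha> \<le> \<bar>x\<bar> powr \<alpha> + \<bar>y\<bar> powr \<alpha>" by (simp add: max_def)
  finally show ?thesis by simp
qed

context
  fixes \<alpha> :: real and c :: "nat \<Rightarrow> nat \<Rightarrow> real"
  assumes \<alpha>: "0 < \<alpha>"
    and int: "integrable (count_space UNIV) (\<lambda>(i, j). \<bar>c i j\<bar> powr \<alpha>)"
begin

text \<open>This is the finiteness of the total mass of the discrete spectral measure.\<close>

lemma integrable_norm_shifted:
  "integrable (count_space UNIV) (\<lambda>p. norm (shifted c n m p, case_prod c p) powr \<alpha>)"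
proof (rule Bochner_Integration.integrable_bound[OF _ _ AE_I2])
  have "integrable (count_space UNIV) (\<lambda>p. \<bar>shifted c n m p\<bar> powr \<alpha>)"
    by (subst integrable_count_space_shift[of n m]) (use int \<alpha> in \<open>auto simp: shifted_def\<close>)
  then show "integrable (count_space UNIV) (\<lambda>p. 2 powr \<alpha> * (\<bar>shifted c n m p\<bar> powr \<alpha> + \<bar>case_prod c p\<bar> powr \<alpha>))"
    using int by (intro integrable_mult_right Bochner_Integration.integrable_add) (auto simp: case_prod_unfold)
  fix p :: "nat \<times> nat"
  show "norm (norm (shifted c n m p, case_prod c p) powr \<alpha>) \<le> norm (2 powr \<alpha> * (\<bar>shifted c n m p\<bar> powr \<alpha> + \<bar>case_prod c p\<bar> powr \<alpha>))"
    using norm_powr_Pair_le[OF \<alpha>, of "shifted c n m p" "case_prod c p"] by simp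
qed auto

lemma integrable_V_shifted:
  "integrable (count_space UNIV) (\<lambda>p. V \<alpha> (shifted c n m p) (case_prod c p))"
  by (rule Bochner_Integration.integrable_bound[OF integrable_norm_shifted[of n m] _ AE_I2])
     (simp_all add: abs_V_le_norm)

lemma V_shift:
  "integrable (count_space UNIV) (\<lambda>(i, j). V \<alpha> (c i j) (c (i + n) (j + m)))"
  "(LINT p|count_space UNIV. V \<alpha> (shifted c n m p) (case_prod c p)) =
   (LINT p|count_space UNIV. (case p of (i, j) \<Rightarrow> V \<alpha> (c i j) (c (i + n) (j + m))))"
proof -
  let ?f = "\<lambda>p. V \<alpha> (shifted c n m p) (case_prod c p)"
  have 0: "?f (a, b) = 0" if "\<not> (n \<le> a \<and> m \<le> b)" for a b
    using that by (auto simp: shifted_def)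
  have eq: "(\<lambda>(i, j). ?f (i + n, j + m)) = (\<lambda>(i, j). V \<alpha> (c i j) (c (i + n) (j + m)))"
    by (auto simp: shifted_def)
  show "integrable (count_space UNIV) (\<lambda>(i, j). V \<alpha> (c i j) (c (i + n) (j + m)))"
    using integrable_V_shifted integrable_count_space_shift[of n m ?f, OF 0] unfolding eq by blast
  show "(LINT p|count_space UNIV. V \<alpha> (shifted c n m p) (case_prod c p)) =
   (LINT p|count_space UNIV. (case p of (i, j) \<Rightarrow> V \<alpha> (c i j) (c (i + n) (j + m))))"
    using integral_count_space_shift[of n m ?f, OF 0] unfolding eq by blast
qed

text \<open>For alpha < 2 the atoms sit at the directions of the pairs \<open>v p\<close> of
  coefficients belonging to a common innovation. V is the mass |v|^alpha times the product of the
  two coordinates of the direction, which is where its formula comes from. For alpha = 2 the series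
  is the definition.\<close>

lemma rho_eq_integral:
  assumes M: "prob_space M" and eps: "iid_symmetric_stable \<alpha> M \<epsilon>" and X: "linear_random_field M c \<epsilon> X"
    and nz: "\<And>i j. c i j \<noteq> 0" and "\<alpha> \<le> 2"
  shows "rho \<alpha> M c X n m = (LINT p|count_space UNIV. (case p of (i, j) \<Rightarrow> V \<alpha> (c i j) (c (i + n) (j + m))))"
proof (cases "\<alpha> < 2")
  case True
  define v where "v p = (shifted c n m p, case_prod c p)" for p
  \<comment> \<open>The second component is a coefficient of the field and never vanishes, so every
    pair has a direction.\<close>
  have v0: "v p \<noteq> 0" for p using nz by (cases p) (simp add: v_def zero_prod_def)
  have pos: "norm (v p) > 0" for p using v0[of p] by simp
  have intv: "integrable (count_space UNIV) (\<lambda>p. norm (v p) powr \<alpha>)"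
    unfolding v_def by (rule integrable_norm_shifted)
  obtain \<Gamma> where \<Gamma>: "sets \<Gamma> = sets (restrict_space borel unit_circle)" "finite_measure \<Gamma>" "distr \<Gamma> \<Gamma> uminus = \<Gamma>"
    and \<Gamma>_int: "\<And>h :: real \<times> real \<Rightarrow> real. h \<in> borel_measurable borel \<Longrightarrow> (\<And>s. h (- s) = h s) \<Longrightarrow>
      integrable (count_space UNIV) (\<lambda>p. norm (v p) powr \<alpha> * h (v p /\<^sub>R norm (v p))) \<Longrightarrow>
      (LINT s|\<Gamma>. h s) = (LINT p|count_space UNIV. norm (v p) powr \<alpha> * h (v p /\<^sub>R norm (v p)))"
    by (rule spectral_measure_discrete[of v \<alpha>, OF v0 intv]) blast
  have [measurable]: "fst \<in> borel_measurable (borel :: (real \<times> real) measure)" "snd \<in> borel_measurable (borel :: (real \<times> real) measure)"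
    by (simp_all add: borel_prod[symmetric])
  have "spectral_measure \<alpha> M (X 0 0) (X (int n) (int m)) \<Gamma>"
    unfolding spectral_measure_def
  proof (intro conjI allI \<Gamma>)
    fix x y
    define h where "h s = \<bar>x * fst s + y * snd s\<bar> powr \<alpha>" for s :: "real \<times> real"
    \<comment> \<open>Homogeneity of degree alpha: the mass of an atom cancels the normalisation of
      its direction.\<close>
    have h: "norm (v p) powr \<alpha> * h (v p /\<^sub>R norm (v p)) = \<bar>x * shifted c n m p + y * case_prod c p\<bar> powr \<alpha>" for p
    proof -
      have "h (v p /\<^sub>R norm (v p)) = \<bar>inverse (norm (v p)) * (x * shifted c n m p + y * case_prod c p)\<bar> powr \<alpha>"
        by (simp add: h_def v_def algebra_simps)
      also have "\<dots> = inverse (norm (v p)) powr \<alpha> * \<bar>x * shifted c n m p + y * case_prod c p\<bar> powr \<alpha>"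
        by (simp add: abs_mult powr_mult)
      also have "inverse (norm (v p)) powr \<alpha> = inverse (norm (v p) powr \<alpha>)"
        using pos[of p] by (simp add: inverse_powr)
      finally show ?thesis using pos[of p] by (simp add: field_simps)
    qed
    have i: "integrable (count_space UNIV) (\<lambda>p. \<bar>x * shifted c n m p + y * case_prod c p\<bar> powr \<alpha>)"
    proof (rule Bochner_Integration.integrable_bound[OF _ _ AE_I2])
      show "integrable (count_space UNIV) (\<lambda>p. (\<bar>x\<bar> + \<bar>y\<bar>) powr \<alpha> * norm (v p) powr \<alpha>)"
        by (intro integrable_mult_right intv)
      fix p :: "nat \<times> nat"
      have "\<bar>x * shifted c n m p + y * case_prod c p\<bar> \<le> \<bar>x\<bar> * \<bar>shifted c n m p\<bar> + \<bar>y\<bar> * \<bar>case_prod c p\<bar>"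
        by (metis abs_mult abs_triangle_ineq)
      also have "\<dots> \<le> \<bar>x\<bar> * norm (v p) + \<bar>y\<bar> * norm (v p)"
        using norm_fst_le[of "shifted c n m p" "case_prod c p"] norm_snd_le[of "case_prod c p" "shifted c n m p"]
        unfolding v_def by (intro add_mono mult_left_mono) auto
      finally have "\<bar>x * shifted c n m p + y * case_prod c p\<bar> powr \<alpha> \<le> ((\<bar>x\<bar> + \<bar>y\<bar>) * norm (v p)) powr \<alpha>"
        using \<alpha> by (intro powr_mono2) (auto simp: algebra_simps)
      then show "norm (\<bar>x * shifted c n m p + y * case_prod c p\<bar> powr \<alpha>) \<le> norm ((\<bar>x\<bar> + \<bar>y\<bar>) powr \<alpha> * norm (v p) powr \<alpha>)"
        by (simp add: powr_mult)
    qed auto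
    have "(LINT s|\<Gamma>. h s) = (LINT p|count_space UNIV. \<bar>x * shifted c n m p + y * case_prod c p\<bar> powr \<alpha>)"
    proof (subst \<Gamma>_int)
      show "h \<in> borel_measurable borel" unfolding h_def[abs_def] by measurable
      show "h (- s) = h s" for s
        using abs_minus_cancel[of "x * fst s + y * snd s"] by (simp add: h_def)
    qed (simp_all add: h i)
    then show "(CLINT \<omega>|M. iexp (x * X 0 0 \<omega> + y * X (int n) (int m) \<omega>)) =
        complex_of_real (exp (- (LINT s|\<Gamma>. \<bar>x * fst s + y * snd s\<bar> powr \<alpha>)))"
      using iexp_linear_random_field[OF M eps X i] unfolding h_def by simp
  qed
  then have "rho \<alpha> M c X n m = (LINT s|\<Gamma>. fst s * snd s)"
    using True \<alpha> by (simp add: rho_def spectral_covariance_eq)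
  also have "\<dots> = (LINT p|count_space UNIV. V \<alpha> (shifted c n m p) (case_prod c p))"
  proof -
    have h: "norm (v p) powr \<alpha> * (fst (v p /\<^sub>R norm (v p)) * snd (v p /\<^sub>R norm (v p))) = V \<alpha> (shifted c n m p) (case_prod c p)" for p
    proof -
      have "norm (v p) powr 2 = norm (v p) powr \<alpha> * norm (v p) powr (2 - \<alpha>)" by (simp add: powr_add[symmetric])
      then have "norm (v p) * norm (v p) = norm (v p) powr \<alpha> * norm (v p) powr (2 - \<alpha>)"
        using pos[of p] by (simp add: powr_numeral power2_eq_square)
      then show ?thesis using pos[of p] v0[of p]
        by (simp add: V_altdef v_def[symmetric] field_simps) (simp add: v_def)
    qed
    have "(\<lambda>s. fst s * snd s) \<in> borel_measurable (borel :: (real \<times> real) measure)" by measurable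
    moreover have "fst (- s) * snd (- s) = fst s * snd s" for s :: "real \<times> real" by simp
    ultimately show ?thesis
      using \<Gamma>_int[of "\<lambda>s. fst s * snd s"] integrable_V_shifted[of n m] unfolding h by blast
  qed
  also have "\<dots> = (LINT p|count_space UNIV. (case p of (i, j) \<Rightarrow> V \<alpha> (c i j) (c (i + n) (j + m))))"
    by (rule V_shift)
  finally show ?thesis .
next
  case False
  then show ?thesis
    using integral_count_space_nat_prod[OF V_shift(1), of n m] by (simp add: rho_def)
qed

end

section \<open>Rescaled double sums\<close>

text \<open>If the limit failed, there would be a bad pair beyond k + 3 for every k, hence a bad
  pair of sequences. Along sequences dominated convergence is available. The offset 3 exceeds e, so
  that ln n >= 1 along them, which the logarithmic regime uses.\<close>

lemma tendsto_prod_sequentiallyI: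
  fixes f :: "nat \<Rightarrow> nat \<Rightarrow> 'b::topological_space"
  assumes "\<And>n m. (\<And>k. n k \<ge> k + 3) \<Longrightarrow> (\<And>k. m k \<ge> k + 3) \<Longrightarrow> (\<lambda>k. f (n k) (m k)) \<longlonglongrightarrow> L"
  shows "((\<lambda>(n, m). f n m) \<longlongrightarrow> L) (sequentially \<times>\<^sub>F sequentially)"
proof (rule topological_tendstoI, rule ccontr)
  fix S assume S: "open S" "L \<in> S"
    and not: "\<not> (\<forall>\<^sub>F p in sequentially \<times>\<^sub>F sequentially. (case p of (n, m) \<Rightarrow> f n m) \<in> S)"
  have "\<exists>n m. n \<ge> k + 3 \<and> m \<ge> k + 3 \<and> f n m \<notin> S" for k
  proof (rule ccontr)
    assume "\<not> ?thesis"
    then have *: "f n m \<in> S" if "n \<ge> k + 3" "m \<ge> k + 3" for n m using that by blast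
    have "\<forall>\<^sub>F p in sequentially \<times>\<^sub>F sequentially. (case p of (n, m) \<Rightarrow> f n m) \<in> S"
      unfolding eventually_prod_filter
      by (rule exI[of _ "\<lambda>n. n \<ge> k + 3"], rule exI[of _ "\<lambda>n. n \<ge> k + 3"])
         (simp add: eventually_ge_at_top *)
    with not show False by simp
  qed
  then have "\<forall>k. \<exists>p. fst p \<ge> k + 3 \<and> snd p \<ge> k + 3 \<and> f (fst p) (snd p) \<notin> S" by simp
  then obtain p where "\<forall>k. fst (p k) \<ge> k + 3 \<and> snd (p k) \<ge> k + 3 \<and> f (fst (p k)) (snd (p k)) \<notin> S"
    by (rule choice[THEN exE])
  then obtain n m where nm: "\<And>k. n k \<ge> k + 3" "\<And>k. m k \<ge> k + 3" "\<And>k. f (n k) (m k) \<notin> S"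
    using that[of "\<lambda>k. fst (p k)" "\<lambda>k. snd (p k)"] by blast
  from assms[OF nm(1,2)] S have "\<forall>\<^sub>F k in sequentially. f (n k) (m k) \<in> S"
    by (rule topological_tendstoD)
  then obtain k where "f (n k) (m k) \<in> S" using eventually_happens' sequentially_bot by blast
  with nm(3) show False by simp
qed

lemma (in pair_sigma_finite) AE_pair_conj:
  assumes "AE x in M1. P x" "AE y in M2. Q y"
  shows "AE z in M1 \<Otimes>\<^sub>M M2. P (fst z) \<and> Q (snd z)"
proof -
  obtain A where A: "{x \<in> space M1. \<not> P x} \<subseteq> A" "A \<in> sets M1" "emeasure M1 A = 0"
    using assms(1) by (auto elim: AE_E)
  obtain B where B: "{x \<in> space M2. \<not> Q x} \<subseteq> B" "B \<in> sets M2" "emeasure M2 B = 0"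
    using assms(2) by (auto elim: AE_E)
  have "A \<times> space M2 \<in> null_sets (M1 \<Otimes>\<^sub>M M2)" "space M1 \<times> B \<in> null_sets (M1 \<Otimes>\<^sub>M M2)"
    using A B by (auto simp: null_sets_def M2.emeasure_pair_measure_Times)
  then have "A \<times> space M2 \<union> space M1 \<times> B \<in> null_sets (M1 \<Otimes>\<^sub>M M2)" by auto
  then show ?thesis
    by (rule AE_I') (use A(1) B(1) in \<open>auto simp: space_pair_measure\<close>)
qed

lemma (in pair_sigma_finite)
  fixes f :: "'a \<Rightarrow> real" and g :: "'b \<Rightarrow> real"
  assumes f: "integrable M1 f" and g: "integrable M2 g"
  shows integrable_pair_mult: "integrable (M1 \<Otimes>\<^sub>M M2) (\<lambda>(x, y). f x * g y)"
    and integral_pair_mult: "(LINT z|(M1 \<Otimes>\<^sub>M M2). (case z of (x, y) \<Rightarrow> f x * g y)) = (LINT x|M1. f x) * (LINT y|M2. g y)"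
proof -
  have [measurable]: "f \<in> borel_measurable M1" "g \<in> borel_measurable M2" using f g by auto
  show i: "integrable (M1 \<Otimes>\<^sub>M M2) (\<lambda>(x, y). f x * g y)"
    using f g by (intro Fubini_integrable) (auto simp: abs_mult)
  show "(LINT z|(M1 \<Otimes>\<^sub>M M2). (case z of (x, y) \<Rightarrow> f x * g y)) = (LINT x|M1. f x) * (LINT y|M2. g y)"
    using integral_fst'[OF i] by simp
qed

definition kern :: "real \<Rightarrow> real \<Rightarrow> real \<Rightarrow> nat \<Rightarrow> nat \<Rightarrow> real" where
  "kern \<beta> a b n i = (1 + real i) powr (- (\<beta> * a)) * (1 + real i + real n) powr (- (\<beta> * b))"

text \<open>A parametrisation \<open>\<iota> k\<close> of the summation index by a measure space, with density \<open>J k\<close>, in which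
  the kernel normalised by \<open>\<nu> k\<close> converges dominatedly to \<open>\<kappa>\<close>. The three instances below are the identity
  for a summable kernel, \<open>\<lfloor>n t\<rfloor>\<close> for a kernel living on the scale \<open>n\<close>, and \<open>\<lfloor>n\<^sup>t\<rfloor> - 1\<close> for the critical
  exponent, whose mass spreads evenly over the logarithmic scale \<open>0 < t < 1\<close>.\<close>

locale index_scaling = sigma_finite_measure \<mu> for \<mu> :: "'x measure" +
  fixes \<beta> a b :: real and n :: "nat \<Rightarrow> nat" and \<iota> :: "nat \<Rightarrow> 'x \<Rightarrow> nat" and J :: "nat \<Rightarrow> 'x \<Rightarrow> real"
    and \<nu> :: "nat \<Rightarrow> real" and \<kappa> K :: "'x \<Rightarrow> real"
  assumes measurable_index[measurable]: "\<And>k. \<iota> k \<in> \<mu> \<rightarrow>\<^sub>M count_space UNIV"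
    and measurable_density[measurable]: "\<And>k. J k \<in> borel_measurable \<mu>"
    and density_nonneg: "\<And>k x. J k x \<ge> 0"
    and normalisation_pos: "\<And>k. \<nu> k > 0"
    and distr_index: "\<And>k. distr (density \<mu> (\<lambda>x. ennreal (J k x))) (count_space UNIV) (\<iota> k) = count_space UNIV"
    and dominated: "\<And>k x. x \<in> space \<mu> \<Longrightarrow> J k x * kern \<beta> a b (n k) (\<iota> k x) / \<nu> k \<le> K x"
    and limit: "AE x in \<mu>. (\<lambda>k. J k x * kern \<beta> a b (n k) (\<iota> k x) / \<nu> k) \<longlonglongrightarrow> \<kappa> x"
    and measurable_limit[measurable]: "\<kappa> \<in> borel_measurable \<mu>"
    and integrable_bound: "integrable \<mu> K"

text \<open>Counting measure on pairs is a product of push-forwards, hence the push-forward of a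
  product with density. This is the change of variables for both coordinates at once.\<close>

lemma integral_count_space_scaling:
  fixes f :: "nat \<times> nat \<Rightarrow> real"
  assumes "index_scaling \<mu>1 \<beta>1 a1 b1 n \<iota>1 J1 \<nu>1 \<kappa>1 K1" "index_scaling \<mu>2 \<beta>2 a2 b2 m \<iota>2 J2 \<nu>2 \<kappa>2 K2"
  shows "(LINT p|count_space UNIV. f p) = (LINT z|(\<mu>1 \<Otimes>\<^sub>M \<mu>2). J1 k (fst z) * J2 k (snd z) * f (\<iota>1 k (fst z), \<iota>2 k (snd z)))"
proof -
  interpret s1: index_scaling \<mu>1 \<beta>1 a1 b1 n \<iota>1 J1 \<nu>1 \<kappa>1 K1 by fact
  interpret s2: index_scaling \<mu>2 \<beta>2 a2 b2 m \<iota>2 J2 \<nu>2 \<kappa>2 K2 by fact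
  let ?C = "count_space (UNIV :: nat set)"
  let ?D1 = "density \<mu>1 (\<lambda>x. ennreal (J1 k x))" and ?D2 = "density \<mu>2 (\<lambda>x. ennreal (J2 k x))"
  have sf: "sigma_finite_measure ?C" by (rule sigma_finite_measure_count_space_countable) simp
  \<comment> \<open>Sigma-finiteness is pulled back from the image, which is counting
    measure.\<close>
  have sfD: "sigma_finite_measure ?D2"
    by (rule sigma_finite_measure_distr[of _ ?C "\<iota>2 k"]) (simp_all add: s2.distr_index sf)
  have "count_space (UNIV :: (nat \<times> nat) set) = ?C \<Otimes>\<^sub>M ?C" by (simp add: pair_measure_countable)
  also have "\<dots> = distr ?D1 ?C (\<iota>1 k) \<Otimes>\<^sub>M distr ?D2 ?C (\<iota>2 k)"
    by (simp add: s1.distr_index s2.distr_index)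
  also have "\<dots> = distr (?D1 \<Otimes>\<^sub>M ?D2) (?C \<Otimes>\<^sub>M ?C) (\<lambda>(x, y). (\<iota>1 k x, \<iota>2 k y))"
    by (rule pair_measure_distr) (simp_all add: s2.distr_index sf)
  also have "?D1 \<Otimes>\<^sub>M ?D2 = density (\<mu>1 \<Otimes>\<^sub>M \<mu>2) (\<lambda>(x, y). ennreal (J1 k x) * ennreal (J2 k y))"
    by (rule pair_measure_density) (simp_all add: sfD s2.sigma_finite_measure_axioms)
  also have "(\<lambda>(x, y). ennreal (J1 k x) * ennreal (J2 k y)) = (\<lambda>z. ennreal (J1 k (fst z) * J2 k (snd z)))"
    by (auto simp: ennreal_mult s1.density_nonneg s2.density_nonneg)
  finally have eq: "count_space UNIV = distr (density (\<mu>1 \<Otimes>\<^sub>M \<mu>2) (\<lambda>z. ennreal (J1 k (fst z) * J2 k (snd z))))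
      (?C \<Otimes>\<^sub>M ?C) (\<lambda>(x, y). (\<iota>1 k x, \<iota>2 k y))" .
  have [measurable]: "f \<in> borel_measurable (?C \<Otimes>\<^sub>M ?C)" by (simp add: pair_measure_countable)
  have "(LINT p|count_space UNIV. f p) = (LINT z|(density (\<mu>1 \<Otimes>\<^sub>M \<mu>2) (\<lambda>z. ennreal (J1 k (fst z) * J2 k (snd z)))).
      f (case z of (x, y) \<Rightarrow> (\<iota>1 k x, \<iota>2 k y)))"
    by (subst eq) (rule integral_distr; measurable)
  also have "\<dots> = (LINT z|(\<mu>1 \<Otimes>\<^sub>M \<mu>2). J1 k (fst z) * J2 k (snd z) * f (case z of (x, y) \<Rightarrow> (\<iota>1 k x, \<iota>2 k y)))"
    by (subst integral_real_density) (auto simp: s1.density_nonneg s2.density_nonneg)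
  finally show ?thesis by (simp add: case_prod_unfold)
qed

text \<open>The dominating function is C * K1 * K2. The limit of \<open>G\<close> is required only
  where neither limiting kernel vanishes: elsewhere the product of the normalised kernels tends to 0
  and boundedness of \<open>G\<close> suffices. This matters on the linear and logarithmic scales,
  where parts of the line carry no mass in the limit.\<close>

lemma tendsto_double_sum_scaling:
  fixes G :: "nat \<Rightarrow> nat \<Rightarrow> nat \<Rightarrow> real"
  assumes s1: "index_scaling \<mu>1 \<beta>1 a1 b1 n \<iota>1 J1 \<nu>1 \<kappa>1 K1"
    and s2: "index_scaling \<mu>2 \<beta>2 a2 b2 m \<iota>2 J2 \<nu>2 \<kappa>2 K2"
    and G: "\<And>k i j. \<bar>G k i j\<bar> \<le> C"
    and lim: "AE z in \<mu>1 \<Otimes>\<^sub>M \<mu>2. \<kappa>1 (fst z) \<noteq> 0 \<longrightarrow> \<kappa>2 (snd z) \<noteq> 0 \<longrightarrow>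
        (\<lambda>k. G k (\<iota>1 k (fst z)) (\<iota>2 k (snd z))) \<longlonglongrightarrow> H z"
    and [measurable]: "H \<in> borel_measurable (\<mu>1 \<Otimes>\<^sub>M \<mu>2)"
  shows "(\<lambda>k. (LINT p|count_space UNIV. kern \<beta>1 a1 b1 (n k) (fst p) * kern \<beta>2 a2 b2 (m k) (snd p) * G k (fst p) (snd p))
        / (\<nu>1 k * \<nu>2 k)) \<longlonglongrightarrow> (LINT z|(\<mu>1 \<Otimes>\<^sub>M \<mu>2). \<kappa>1 (fst z) * \<kappa>2 (snd z) * H z)"
    and "integrable (\<mu>1 \<Otimes>\<^sub>M \<mu>2) (\<lambda>z. \<kappa>1 (fst z) * \<kappa>2 (snd z) * H z)"
proof -
  interpret s1: index_scaling \<mu>1 \<beta>1 a1 b1 n \<iota>1 J1 \<nu>1 \<kappa>1 K1 by fact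
  interpret s2: index_scaling \<mu>2 \<beta>2 a2 b2 m \<iota>2 J2 \<nu>2 \<kappa>2 K2 by fact
  interpret pair_sigma_finite \<mu>1 \<mu>2 ..
  define A1 where "A1 k x = J1 k x * kern \<beta>1 a1 b1 (n k) (\<iota>1 k x) / \<nu>1 k" for k x
  define A2 where "A2 k y = J2 k y * kern \<beta>2 a2 b2 (m k) (\<iota>2 k y) / \<nu>2 k" for k y
  define F where "F k z = A1 k (fst z) * A2 k (snd z) * G k (\<iota>1 k (fst z)) (\<iota>2 k (snd z))" for k z
  have A0: "A1 k x \<ge> 0" "A2 k y \<ge> 0" for k x y
    using s1.density_nonneg s2.density_nonneg s1.normalisation_pos s2.normalisation_pos
    by (auto simp: A1_def A2_def kern_def less_imp_le)
  have [measurable]: "A1 k \<in> borel_measurable \<mu>1" "A2 k \<in> borel_measurable \<mu>2" for k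
    unfolding A1_def[abs_def] A2_def[abs_def] by measurable
  have [measurable]: "(\<lambda>z. G k (\<iota>1 k (fst z)) (\<iota>2 k (snd z))) \<in> borel_measurable (\<mu>1 \<Otimes>\<^sub>M \<mu>2)" for k
  proof -
    have "(\<lambda>p. G k (fst p) (snd p)) \<in> borel_measurable (count_space UNIV \<Otimes>\<^sub>M count_space UNIV)"
      by (simp add: pair_measure_countable)
    from measurable_compose[OF _ this, of "\<lambda>z. (\<iota>1 k (fst z), \<iota>2 k (snd z))" "\<mu>1 \<Otimes>\<^sub>M \<mu>2"]
    show ?thesis by simp
  qed
  have [measurable]: "F k \<in> borel_measurable (\<mu>1 \<Otimes>\<^sub>M \<mu>2)" for k
    unfolding F_def[abs_def] by measurable
  have "C \<ge> 0" using G[of 0 0 0] by linarith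
  have bound: "norm (F k z) \<le> C * (case z of (x, y) \<Rightarrow> K1 x * K2 y)" if "z \<in> space (\<mu>1 \<Otimes>\<^sub>M \<mu>2)" for k z
  proof -
    obtain x y where z: "z = (x, y)" "x \<in> space \<mu>1" "y \<in> space \<mu>2"
      using \<open>z \<in> space (\<mu>1 \<Otimes>\<^sub>M \<mu>2)\<close> by (auto simp: space_pair_measure)
    have K: "A1 k x \<le> K1 x" "A2 k y \<le> K2 y"
      using s1.dominated[OF z(2)] s2.dominated[OF z(3)] by (auto simp: A1_def A2_def)
    have "norm (F k z) = A1 k x * A2 k y * \<bar>G k (\<iota>1 k x) (\<iota>2 k y)\<bar>"
      by (simp add: F_def z abs_mult A0)
    also have "\<dots> \<le> K1 x * K2 y * C"
      using A0(1)[of k x] A0(2)[of k y] K by (intro mult_mono G) (auto intro: order_trans)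
    finally show ?thesis by (simp add: z mult_ac)
  qed
  have conv: "AE z in \<mu>1 \<Otimes>\<^sub>M \<mu>2. (\<lambda>k. F k z) \<longlonglongrightarrow> \<kappa>1 (fst z) * \<kappa>2 (snd z) * H z"
    using lim AE_pair_conj[OF s1.limit s2.limit]
  proof eventually_elim
    case (elim z)
    then have l: "(\<lambda>k. A1 k (fst z)) \<longlonglongrightarrow> \<kappa>1 (fst z)" "(\<lambda>k. A2 k (snd z)) \<longlonglongrightarrow> \<kappa>2 (snd z)"
      by (auto simp: A1_def A2_def)
    show ?case
    proof (cases "\<kappa>1 (fst z) * \<kappa>2 (snd z) = 0")
      case True
      have "(\<lambda>k. A1 k (fst z) * A2 k (snd z) * C) \<longlonglongrightarrow> \<kappa>1 (fst z) * \<kappa>2 (snd z) * C"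
        by (intro tendsto_intros l)
      then have "(\<lambda>k. A1 k (fst z) * A2 k (snd z) * C) \<longlonglongrightarrow> 0" using True by simp
      moreover have "norm (F k z) \<le> A1 k (fst z) * A2 k (snd z) * C" for k
        unfolding F_def by (simp add: abs_mult A0 G mult_left_mono)
      ultimately have "(\<lambda>k. F k z) \<longlonglongrightarrow> 0"
        by (rule Lim_null_comparison[OF always_eventually, OF allI, rotated])
      then show ?thesis unfolding True by simp
    next
      case False
      then show ?thesis unfolding F_def using elim(1) by (intro tendsto_mult l) auto
    qed
  qed
  have intb: "integrable (\<mu>1 \<Otimes>\<^sub>M \<mu>2) (\<lambda>z. C * (case z of (x, y) \<Rightarrow> K1 x * K2 y))"
    by (intro integrable_mult_right integrable_pair_mult s1.integrable_bound s2.integrable_bound)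
  have eq: "(LINT p|count_space UNIV. kern \<beta>1 a1 b1 (n k) (fst p) * kern \<beta>2 a2 b2 (m k) (snd p) * G k (fst p) (snd p))
        / (\<nu>1 k * \<nu>2 k) = (LINT z|(\<mu>1 \<Otimes>\<^sub>M \<mu>2). F k z)" for k
  proof -
    have "(LINT p|count_space UNIV. kern \<beta>1 a1 b1 (n k) (fst p) * kern \<beta>2 a2 b2 (m k) (snd p) * G k (fst p) (snd p))
        / (\<nu>1 k * \<nu>2 k) = (LINT z|(\<mu>1 \<Otimes>\<^sub>M \<mu>2). J1 k (fst z) * J2 k (snd z) *
          (kern \<beta>1 a1 b1 (n k) (\<iota>1 k (fst z)) * kern \<beta>2 a2 b2 (m k) (\<iota>2 k (snd z)) * G k (\<iota>1 k (fst z)) (\<iota>2 k (snd z)))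
          / (\<nu>1 k * \<nu>2 k))"
      by (subst integral_count_space_scaling[OF s1 s2, of _ k]) simp
    also have "\<dots> = (LINT z|(\<mu>1 \<Otimes>\<^sub>M \<mu>2). F k z)"
      by (rule Bochner_Integration.integral_cong) (simp_all add: F_def A1_def A2_def)
    finally show ?thesis .
  qed
  show "(\<lambda>k. (LINT p|count_space UNIV. kern \<beta>1 a1 b1 (n k) (fst p) * kern \<beta>2 a2 b2 (m k) (snd p) * G k (fst p) (snd p))
        / (\<nu>1 k * \<nu>2 k)) \<longlonglongrightarrow> (LINT z|(\<mu>1 \<Otimes>\<^sub>M \<mu>2). \<kappa>1 (fst z) * \<kappa>2 (snd z) * H z)"
    unfolding eq
    by (rule integral_dominated_convergence[where w = "\<lambda>z. C * (case z of (x, y) \<Rightarrow> K1 x * K2 y)"])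
       (use conv intb bound in \<open>auto intro!: AE_I2\<close>)
  show "integrable (\<mu>1 \<Otimes>\<^sub>M \<mu>2) (\<lambda>z. \<kappa>1 (fst z) * \<kappa>2 (snd z) * H z)"
    by (rule integrable_dominated_convergence[where w = "\<lambda>z. C * (case z of (x, y) \<Rightarrow> K1 x * K2 y)" and s = F])
       (use conv intb bound in \<open>auto intro!: AE_I2\<close>)
qed

section \<open>The three scaling regimes\<close>

text \<open>A nonnegative gauge-integrable function is absolutely integrable, and Borel
  measurability brings it back from the completion to \<open>lborel\<close>.\<close>

lemma integrable_lborel_nonneg_hk:
  fixes f :: "real \<Rightarrow> real"
  assumes "f integrable_on S" "\<And>x. x \<in> S \<Longrightarrow> f x \<ge> 0" and [measurable]: "f \<in> borel_measurable borel" "S \<in> sets borel"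
  shows "integrable lborel (\<lambda>x. indicator S x * f x)"
proof -
  have "f absolutely_integrable_on S"
    using assms by (intro nonnegative_absolutely_integrable_1) auto
  then have "integrable lebesgue (\<lambda>x. indicator S x *\<^sub>R f x)" by (simp add: set_integrable_def)
  then have "integrable lborel (\<lambda>x. indicator S x *\<^sub>R f x)"
    by (subst (asm) integrable_completion) auto
  then show ?thesis by simp
qed

text \<open>Near 0 the kernel is at most t^(-p), beyond 1 at most t^(-(p+q)).\<close>

lemma integrable_powr_kernel:
  assumes "p < 1" "1 < p + q" "0 \<le> p" "0 \<le> q"
  shows "integrable lborel (\<lambda>t::real. indicator {0<..} t * (t powr - p * (1 + t) powr - q))"
proof (rule Bochner_Integration.integrable_bound[OF _ _ AE_I2])
  have "integrable lborel (\<lambda>t::real. indicator {0..1} t * t powr - p)"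
    by (rule integrable_lborel_nonneg_hk)
       (use assms has_integral_powr_from_0[of "-p" 1] in \<open>auto simp: integrable_on_def\<close>)
  moreover have "integrable lborel (\<lambda>t::real. indicator {1..} t * t powr - (p + q))"
    by (rule integrable_lborel_nonneg_hk)
       (use assms has_integral_powr_to_inf[of "-(p+q)" 1] in \<open>auto simp: integrable_on_def\<close>)
  ultimately show "integrable lborel (\<lambda>t::real. indicator {0..1} t * t powr - p + indicator {1..} t * t powr - (p + q))"
    by (rule Bochner_Integration.integrable_add)
  fix t :: real
  show "norm (indicator {0<..} t * (t powr - p * (1 + t) powr - q))
      \<le> norm (indicator {0..1} t * t powr - p + indicator {1..} t * t powr - (p + q))"
  proof (cases "t > 0")
    case t: True
    show ?thesis
    proof (cases "t \<le> 1")
      case True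
      have "(1 + t) powr - q \<le> 1 powr - q" using t assms by (intro powr_mono2') auto
      then have "t powr - p * (1 + t) powr - q \<le> t powr - p * 1" by (intro mult_left_mono) auto
      then show ?thesis using t True by (simp add: indicator_def add_increasing2)
    next
      case False
      have "(1 + t) powr - q \<le> t powr - q" using t assms by (intro powr_mono2') auto
      then have "t powr - p * (1 + t) powr - q \<le> t powr - p * t powr - q" by (intro mult_left_mono) auto
      also have "\<dots> = t powr - (p + q)" by (simp add: powr_add[symmetric])
      finally show ?thesis using t False by (simp add: indicator_def)
    qed
  qed (simp add: indicator_def)
qed auto

text \<open>The quotient of the power weights (1+i)^(-beta) and (1+i+n)^(-beta) in one coordinate.
  It measures how strongly the coefficient at i dominates the one at i + n.\<close>

definition ratio :: "real \<Rightarrow> nat \<Rightarrow> nat \<Rightarrow> real" where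
  "ratio \<beta> n i = ((1 + real i + real n) / (1 + real i)) powr \<beta>"

lemma ratio_ge_1: "\<beta> \<ge> 0 \<Longrightarrow> ratio \<beta> n i \<ge> 1"
  by (simp add: ratio_def ge_one_powr_ge_zero)

lemma ratio_rescale:
  fixes p q :: real
  assumes "p > 0" "q > 0"
  shows "(p / q + 1) / (p / q) = (p + q) / p" "1 + inverse (p / q) = (p + q) / p"
  using assms by (simp_all add: field_simps)

lemma filterlim_ratio_at_top:
  assumes "\<beta> > 0" and "(\<lambda>k. (1 + real (i k)) / real (n k)) \<longlonglongrightarrow> 0" and n: "\<And>k. n k \<ge> k + 3"
  shows "filterlim (\<lambda>k. ratio \<beta> (n k) (i k)) at_top sequentially"
proof -
  have npos: "real (n k) > 0" for k using n[of k] by simp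
  have "filterlim (\<lambda>k. (1 + real (i k)) / real (n k)) (at_right 0) sequentially"
    using assms(2) npos by (intro tendsto_imp_filterlim_at_right always_eventually) (auto simp: add_pos_nonneg)
  then have "filterlim (\<lambda>k. inverse ((1 + real (i k)) / real (n k))) at_top sequentially"
    by (rule filterlim_compose[OF filterlim_inverse_at_top_right])
  then have "filterlim (\<lambda>k. 1 + inverse ((1 + real (i k)) / real (n k))) at_top sequentially"
    by (intro filterlim_tendsto_add_at_top[OF tendsto_const])
  then have "filterlim (\<lambda>k. (1 + inverse ((1 + real (i k)) / real (n k))) powr \<beta>) at_top sequentially"
    by (rule filterlim_compose[OF real_powr_at_top[OF \<open>\<beta> > 0\<close>]])
  moreover have "1 + inverse ((1 + real (i k)) / real (n k)) = (1 + real (i k) + real (n k)) / (1 + real (i k))" for k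
    using ratio_rescale(2)[of "1 + real (i k)" "real (n k)"] npos[of k] by (simp add: add_pos_nonneg)
  ultimately show ?thesis by (simp add: ratio_def)
qed

lemma tendsto_ratio:
  assumes "t > 0" and "(\<lambda>k. (1 + real (i k)) / real (n k)) \<longlonglongrightarrow> t" and n: "\<And>k. n k \<ge> k + 3"
  shows "(\<lambda>k. ratio \<beta> (n k) (i k)) \<longlonglongrightarrow> ((t + 1) / t) powr \<beta>"
proof -
  have npos: "real (n k) > 0" for k using n[of k] by simp
  have "(\<lambda>k. (((1 + real (i k)) / real (n k) + 1) / ((1 + real (i k)) / real (n k))) powr \<beta>) \<longlonglongrightarrow> ((t + 1) / t) powr \<beta>"
    using assms by (intro tendsto_intros) auto
  moreover have "((1 + real (i k)) / real (n k) + 1) / ((1 + real (i k)) / real (n k)) = (1 + real (i k) + real (n k)) / (1 + real (i k))" for k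
    using ratio_rescale(1)[of "1 + real (i k)" "real (n k)"] npos[of k] by (simp add: add_pos_nonneg)
  ultimately show ?thesis by (simp add: ratio_def)
qed

lemma filterlim_real_shift: 
  assumes n: "\<And>k. n k \<ge> k + 3"
  shows "filterlim (\<lambda>k. real (n k)) at_top sequentially"
proof (rule filterlim_at_top_mono[OF filterlim_real_sequentially])
  show "\<forall>\<^sub>F k in sequentially. real k \<le> real (n k)"
  proof (rule always_eventually, rule allI)
    fix k show "real k \<le> real (n k)" using n[of k] by simp
  qed
qed

text \<open>On a countable space it suffices that every cell of the parametrisation has mass
  1.\<close>

lemma distr_count_space_eqI:
  assumes [measurable]: "\<iota> \<in> \<mu> \<rightarrow>\<^sub>M count_space (UNIV :: nat set)" "J \<in> borel_measurable \<mu>"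
    and "\<And>i. (\<integral>\<^sup>+x. ennreal (J x) * indicator (\<iota> -` {i} \<inter> space \<mu>) x \<partial>\<mu>) = 1"
  shows "distr (density \<mu> (\<lambda>x. ennreal (J x))) (count_space UNIV) \<iota> = count_space UNIV"
proof (rule measure_eqI_countable)
  fix i :: nat
  have "emeasure (distr (density \<mu> (\<lambda>x. ennreal (J x))) (count_space UNIV) \<iota>) {i}
      = emeasure (density \<mu> (\<lambda>x. ennreal (J x))) (\<iota> -` {i} \<inter> space \<mu>)"
    by (subst emeasure_distr) auto
  also have "\<dots> = (\<integral>\<^sup>+x. ennreal (J x) * indicator (\<iota> -` {i} \<inter> space \<mu>) x \<partial>\<mu>)"
    by (rule emeasure_density) measurable
  finally show "emeasure (distr (density \<mu> (\<lambda>x. ennreal (J x))) (count_space UNIV) \<iota>) {i} = emeasure (count_space UNIV) {i}"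
    using assms(3) by simp
qed auto

lemma integrable_count_space_powr:
  assumes "s > 1"
  shows "integrable (count_space UNIV) (\<lambda>i. (1 + real i) powr - s)"
proof -
  have "summable (\<lambda>i. real i powr - s)" using assms by (simp add: summable_real_powr_iff)
  then have "summable (\<lambda>i. real (Suc i) powr - s)" by (subst summable_Suc_iff)
  then show ?thesis by (simp add: integrable_count_space_nat_iff add.commute)
qed

context
  fixes \<beta> a b :: real and n :: "nat \<Rightarrow> nat"
  assumes n: "\<And>k. n k \<ge> k + 3" and b: "\<beta> * b > 0"
begin

lemma n_pos: "real (n k) > 0" "n k > 0"
  using n[of k] by auto

lemma one_over_n: "(\<lambda>k. 1 / real (n k)) \<longlonglongrightarrow> 0"
  using tendsto_divide_0[OF tendsto_const filterlim_at_top_imp_at_infinity[OF filterlim_real_shift[of n, OF n]]] .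

section \<open>Summable kernels: the index is not rescaled\<close>

lemma index_scaling_identity:
  assumes "\<beta> * a > 1"
  shows "index_scaling (count_space UNIV) \<beta> a b n (\<lambda>k i. i) (\<lambda>k i. 1) (\<lambda>k. real (n k) powr (- (\<beta> * b)))
     (\<lambda>i. (1 + real i) powr (- (\<beta> * a))) (\<lambda>i. (1 + real i) powr (- (\<beta> * a)))"
proof -
  interpret sigma_finite_measure "count_space (UNIV :: nat set)"
    by (rule sigma_finite_measure_count_space_countable) simp
  show ?thesis
  proof
    show "distr (density (count_space UNIV) (\<lambda>x. ennreal 1)) (count_space UNIV) (\<lambda>i. i) = (count_space UNIV :: nat measure)"
      by (simp add: density_1)
    fix k i :: nat
    show "real (n k) powr - (\<beta> * b) > 0" using n_pos[of k] by simp
    \<comment> \<open>Replacing 1 + i + n by n in the decreasing factor gives a bound uniform in n;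
      for fixed i this replacement is asymptotically exact.\<close>
    have "(1 + real i + real (n k)) powr - (\<beta> * b) \<le> real (n k) powr - (\<beta> * b)"
      using n_pos[of k] b by (intro powr_mono2') auto
    then have "(1 + real i) powr - (\<beta> * a) * (1 + real i + real (n k)) powr - (\<beta> * b)
       \<le> (1 + real i) powr - (\<beta> * a) * real (n k) powr - (\<beta> * b)" by (intro mult_left_mono) auto
    then show "1 * kern \<beta> a b (n k) i / real (n k) powr - (\<beta> * b) \<le> (1 + real i) powr - (\<beta> * a)"
      using n_pos[of k] by (simp add: kern_def divide_le_eq)
  next
    have "(\<lambda>k. 1 * kern \<beta> a b (n k) i / real (n k) powr - (\<beta> * b)) \<longlonglongrightarrow> (1 + real i) powr - (\<beta> * a)" for i
    proof -
      have "(\<lambda>k. (1 + real i) powr - (\<beta> * a) * ((1 + real i) * (1 / real (n k)) + 1) powr - (\<beta> * b))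
          \<longlonglongrightarrow> (1 + real i) powr - (\<beta> * a) * ((1 + real i) * 0 + 1) powr - (\<beta> * b)"
        by (intro tendsto_intros one_over_n) auto
      moreover have "(1 + real i) powr - (\<beta> * a) * ((1 + real i) * (1 / real (n k)) + 1) powr - (\<beta> * b)
          = 1 * kern \<beta> a b (n k) i / real (n k) powr - (\<beta> * b)" for k
      proof -
        have "(1 + real i) * (1 / real (n k)) + 1 = (1 + real i + real (n k)) / real (n k)"
          using n_pos[of k] by (simp add: field_simps)
        then show ?thesis using n_pos[of k] by (simp add: kern_def powr_divide)
      qed
      ultimately show ?thesis by simp
    qed
    then show "AE x in count_space UNIV. (\<lambda>k. 1 * kern \<beta> a b (n k) x / real (n k) powr - (\<beta> * b)) \<longlonglongrightarrow> (1 + real x) powr - (\<beta> * a)"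
      by (intro AE_I2)
    show "integrable (count_space UNIV) (\<lambda>i. (1 + real i) powr - (\<beta> * a))"
      using assms by (rule integrable_count_space_powr)
  qed auto
qed

lemma ratio_identity:
  assumes "\<beta> > 0"
  shows "filterlim (\<lambda>k. ratio \<beta> (n k) i) at_top sequentially"
  using tendsto_mult[OF tendsto_const one_over_n, of "1 + real i"] n
  by (intro filterlim_ratio_at_top assms) auto

section \<open>Kernels living on the scale n\<close>

lemma linear_index_tendsto:
  assumes "t > 0"
  shows "(\<lambda>k. (1 + real (nat \<lfloor>real (n k) * t\<rfloor>)) / real (n k)) \<longlonglongrightarrow> t"
    and "t \<le> (1 + real (nat \<lfloor>real (n k) * t\<rfloor>)) / real (n k)"
    and "filterlim (\<lambda>k. nat \<lfloor>real (n k) * t\<rfloor>) sequentially sequentially"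
proof -
  have f: "real (nat \<lfloor>real (n k) * t\<rfloor>) = of_int \<lfloor>real (n k) * t\<rfloor>" for k
    using assms n_pos[of k] by simp
  \<comment> \<open>The \<open>1 +\<close> puts the rescaled index at or to the right of t, and the
    floor keeps it within 1 / n of t.\<close>
  show lower: "t \<le> (1 + real (nat \<lfloor>real (n k) * t\<rfloor>)) / real (n k)" for k
    unfolding f using n_pos[of k] by (simp add: le_divide_eq mult.commute) linarith
  have upper: "(1 + real (nat \<lfloor>real (n k) * t\<rfloor>)) / real (n k) \<le> t + 1 / real (n k)" for k
    unfolding f using n_pos[of k] by (simp add: divide_le_eq field_simps)
  have "(\<lambda>k. t + 1 / real (n k)) \<longlonglongrightarrow> t + 0" by (intro tendsto_intros one_over_n)
  then have upper_lim: "(\<lambda>k. t + 1 / real (n k)) \<longlonglongrightarrow> t" by simp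
  show "(\<lambda>k. (1 + real (nat \<lfloor>real (n k) * t\<rfloor>)) / real (n k)) \<longlonglongrightarrow> t"
  proof (rule tendsto_sandwich[OF _ _ tendsto_const upper_lim])
    show "\<forall>\<^sub>F k in sequentially. t \<le> (1 + real (nat \<lfloor>real (n k) * t\<rfloor>)) / real (n k)"
      by (rule always_eventually, rule allI, rule lower)
    show "\<forall>\<^sub>F k in sequentially. (1 + real (nat \<lfloor>real (n k) * t\<rfloor>)) / real (n k) \<le> t + 1 / real (n k)"
      by (rule always_eventually, rule allI, rule upper)
  qed
  have "filterlim (\<lambda>k. real (n k) * t) at_top sequentially"
    using filterlim_tendsto_pos_mult_at_top[OF tendsto_const assms filterlim_real_shift[of n, OF n]]
    by (simp add: mult.commute)
  then show "filterlim (\<lambda>k. nat \<lfloor>real (n k) * t\<rfloor>) sequentially sequentially"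
    by (intro filterlim_compose[OF filterlim_nat_sequentially] filterlim_compose[OF filterlim_floor_sequentially])
qed

text \<open>The density contributes n and the two powers n^(-beta*a) and n^(-beta*b), which explains
  the normalisation. What is left depends on i only through (1+i)/n.\<close>

lemma kern_linear:
  "indicator {0<..} t * real (n k) * kern \<beta> a b (n k) i / real (n k) powr (1 - (\<beta> * a + \<beta> * b))
   = indicator {0<..} t * (((1 + real i) / real (n k)) powr - (\<beta> * a) * (1 + (1 + real i) / real (n k)) powr - (\<beta> * b))"
  for t :: real
proof -
  have "1 + (1 + real i) / real (n k) = (1 + real i + real (n k)) / real (n k)"
    using n_pos[of k] by (simp add: field_simps)
  moreover have "real (n k) powr (1 - (\<beta> * a + \<beta> * b)) = real (n k) * (real (n k) powr - (\<beta> * a) * real (n k) powr - (\<beta> * b))"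
    using n_pos[of k] by (simp add: powr_diff powr_minus powr_add field_simps)
  ultimately show ?thesis
    using n_pos[of k] by (simp add: kern_def powr_divide)
qed

text \<open>The kernel decreases and the rescaled index lies to the right of t, so the limit is its
  own dominating function. The condition on beta * a makes it integrable at 0, the condition on the
  sum makes it integrable at infinity.\<close>

lemma index_scaling_linear:
  assumes "0 \<le> \<beta> * a" "\<beta> * a < 1" "\<beta> * a + \<beta> * b > 1"
  shows "index_scaling lborel \<beta> a b n (\<lambda>k t. nat \<lfloor>real (n k) * t\<rfloor>) (\<lambda>k t. indicator {0<..} t * real (n k))
     (\<lambda>k. real (n k) powr (1 - (\<beta> * a + \<beta> * b)))
     (\<lambda>t. indicator {0<..} t * (t powr - (\<beta> * a) * (1 + t) powr - (\<beta> * b)))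
     (\<lambda>t. indicator {0<..} t * (t powr - (\<beta> * a) * (1 + t) powr - (\<beta> * b)))"
proof
  fix k :: nat
  show "distr (density lborel (\<lambda>t. ennreal (indicator {0<..} t * real (n k)))) (count_space UNIV) (\<lambda>t. nat \<lfloor>real (n k) * t\<rfloor>) = count_space UNIV"
  proof (rule distr_count_space_eqI)
    fix i :: nat
    \<comment> \<open>The density vanishes at 0, so that point, which belongs to the cell of i = 0,
      has to be removed; it is a null set.\<close>
    let ?S = "{real i / real (n k)..<(real i + 1) / real (n k)} - {0}"
    have mem: "0 < t \<and> nat \<lfloor>real (n k) * t\<rfloor> = i \<longleftrightarrow> t \<in> ?S" for t
    proof -
      have "nat \<lfloor>real (n k) * t\<rfloor> = i \<longleftrightarrow> real i \<le> real (n k) * t \<and> real (n k) * t < real i + 1" if "t > 0"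
      proof -
        have "0 \<le> \<lfloor>real (n k) * t\<rfloor>" using that by simp
        then have "nat \<lfloor>real (n k) * t\<rfloor> = i \<longleftrightarrow> \<lfloor>real (n k) * t\<rfloor> = int i" by linarith
        then show ?thesis by (simp add: floor_eq_iff)
      qed
      moreover have "t > 0" if "t \<in> ?S" 
      proof -
        have "0 \<le> real i / real (n k)" by simp
        also have "\<dots> \<le> t" using that by simp
        finally show ?thesis using that by simp
      qed
      ultimately show ?thesis
        using n_pos[of k] by (auto simp: field_simps)
    qed
    have "(\<integral>\<^sup>+t. ennreal (indicator {0<..} t * real (n k)) * indicator ((\<lambda>t. nat \<lfloor>real (n k) * t\<rfloor>) -` {i} \<inter> space lborel) t \<partial>lborel)
        = (\<integral>\<^sup>+t. ennreal (real (n k)) * indicator ?S t \<partial>lborel)"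
      using mem by (intro nn_integral_cong) (auto simp: indicator_def)
    also have "\<dots> = ennreal (real (n k)) * emeasure lborel ?S" by (rule nn_integral_cmult_indicator) auto
    also have "emeasure lborel ?S = emeasure lborel {real i / real (n k)..<(real i + 1) / real (n k)}"
      by (rule emeasure_Diff_null_set) auto
    also have "\<dots> = ennreal (1 / real (n k))"
      using n_pos[of k] by (subst emeasure_lborel_Ico) (auto simp: field_simps diff_divide_distrib[symmetric])
    also have "ennreal (real (n k)) * ennreal (1 / real (n k)) = 1"
      using n_pos[of k] by (simp add: ennreal_mult[symmetric])
    finally show "(\<integral>\<^sup>+t. ennreal (indicator {0<..} t * real (n k)) * indicator ((\<lambda>t. nat \<lfloor>real (n k) * t\<rfloor>) -` {i} \<inter> space lborel) t \<partial>lborel) = 1" .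
  qed auto
  show "real (n k) powr (1 - (\<beta> * a + \<beta> * b)) > 0" using n_pos[of k] by simp
  fix t :: real
  show "indicator {0<..} t * real (n k) * kern \<beta> a b (n k) (nat \<lfloor>real (n k) * t\<rfloor>) / real (n k) powr (1 - (\<beta> * a + \<beta> * b))
      \<le> indicator {0<..} t * (t powr - (\<beta> * a) * (1 + t) powr - (\<beta> * b))"
  proof (cases "t > 0")
    case True
    let ?x = "(1 + real (nat \<lfloor>real (n k) * t\<rfloor>)) / real (n k)"
    have "t \<le> ?x" using linear_index_tendsto(2)[OF True] .
    then have "?x powr - (\<beta> * a) * (1 + ?x) powr - (\<beta> * b) \<le> t powr - (\<beta> * a) * (1 + t) powr - (\<beta> * b)"
      using True assms b by (intro mult_mono powr_mono2') auto
    then show ?thesis unfolding kern_linear using True by simp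
  qed simp
next
  show "AE t in lborel. (\<lambda>k. indicator {0<..} t * real (n k) * kern \<beta> a b (n k) (nat \<lfloor>real (n k) * t\<rfloor>) / real (n k) powr (1 - (\<beta> * a + \<beta> * b)))
      \<longlonglongrightarrow> indicator {0<..} t * (t powr - (\<beta> * a) * (1 + t) powr - (\<beta> * b))"
  proof (rule AE_I2)
    fix t :: real
    show "(\<lambda>k. indicator {0<..} t * real (n k) * kern \<beta> a b (n k) (nat \<lfloor>real (n k) * t\<rfloor>) / real (n k) powr (1 - (\<beta> * a + \<beta> * b)))
      \<longlonglongrightarrow> indicator {0<..} t * (t powr - (\<beta> * a) * (1 + t) powr - (\<beta> * b))"
    proof (cases "t > 0")
      case True
      then show ?thesis unfolding kern_linear
        by (intro tendsto_intros linear_index_tendsto(1)) auto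
    qed simp
  qed
  show "integrable lborel (\<lambda>t. indicator {0<..} t * (t powr - (\<beta> * a) * (1 + t) powr - (\<beta> * b)))"
    using assms b by (intro integrable_powr_kernel) auto
qed (auto simp: n_pos)

section \<open>The critical exponent on the logarithmic scale\<close>

lemma log_index:
  assumes "t \<ge> 0"
  shows "1 \<le> real (n k) powr t"
    and "1 + real (nat \<lfloor>real (n k) powr t\<rfloor> - 1) = of_int \<lfloor>real (n k) powr t\<rfloor>"
    and "real (n k) powr t \<le> 2 * of_int \<lfloor>real (n k) powr t\<rfloor>"
    and "(1::real) \<le> of_int \<lfloor>real (n k) powr t\<rfloor>"
proof -
  show 1: "1 \<le> real (n k) powr t" using n_pos[of k] assms by (intro ge_one_powr_ge_zero) auto
  then have 2: "1 \<le> \<lfloor>real (n k) powr t\<rfloor>" by simp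
  \<comment> \<open>The floor is at least 1 for t >= 0, so the truncated subtraction is exact, and
    \<open>- 1\<close> is compensated by the \<open>1 +\<close> in the kernel.\<close>
  then have "int (nat \<lfloor>real (n k) powr t\<rfloor> - 1) = \<lfloor>real (n k) powr t\<rfloor> - 1" by linarith
  then show "1 + real (nat \<lfloor>real (n k) powr t\<rfloor> - 1) = of_int \<lfloor>real (n k) powr t\<rfloor>"
    by (metis add.commute diff_add_cancel of_int_1 of_int_add of_int_of_nat_eq)
  show 3: "(1::real) \<le> of_int \<lfloor>real (n k) powr t\<rfloor>" using 2 by linarith
  show "real (n k) powr t \<le> 2 * of_int \<lfloor>real (n k) powr t\<rfloor>" using 3 by linarith
qed

lemma log_index_tendsto:
  assumes "t > 0"
  shows "(\<lambda>k. real (n k) powr t / of_int \<lfloor>real (n k) powr t\<rfloor>) \<longlonglongrightarrow> 1"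
    and "filterlim (\<lambda>k. nat \<lfloor>real (n k) powr t\<rfloor> - 1) sequentially sequentially"
    and "t < 1 \<Longrightarrow> (\<lambda>k. of_int \<lfloor>real (n k) powr t\<rfloor> / real (n k)) \<longlonglongrightarrow> 0"
    and "t > 1 \<Longrightarrow> filterlim (\<lambda>k. of_int \<lfloor>real (n k) powr t\<rfloor> / real (n k)) at_top sequentially"
proof -
  have top: "filterlim (\<lambda>k. real (n k) powr t) at_top sequentially"
    by (rule filterlim_compose[OF real_powr_at_top[OF assms] filterlim_real_shift[of n, OF n]])
  have ftop: "filterlim (\<lambda>k. \<lfloor>real (n k) powr t\<rfloor>) at_top sequentially"
    by (rule filterlim_compose[OF filterlim_floor_sequentially top])
  then have frtop: "filterlim (\<lambda>k. of_int \<lfloor>real (n k) powr t\<rfloor> :: real) at_top sequentially"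
    by (rule filterlim_compose[OF filterlim_real_of_int_at_top])
  have fpos: "(of_int \<lfloor>real (n k) powr t\<rfloor> :: real) \<ge> 1" for k using log_index(4)[of t k] assms by simp
  show "(\<lambda>k. real (n k) powr t / of_int \<lfloor>real (n k) powr t\<rfloor>) \<longlonglongrightarrow> 1"
  proof (rule tendsto_sandwich[OF _ _ tendsto_const, of 1 _ sequentially "\<lambda>k. 1 + 1 / of_int \<lfloor>real (n k) powr t\<rfloor>"])
    show "\<forall>\<^sub>F k in sequentially. 1 \<le> real (n k) powr t / of_int \<lfloor>real (n k) powr t\<rfloor>"
    proof (intro always_eventually allI)
      fix k show "1 \<le> real (n k) powr t / of_int \<lfloor>real (n k) powr t\<rfloor>"
        using fpos[of k] of_int_floor_le[of "real (n k) powr t"] by (subst le_divide_eq_1_pos) auto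
    qed
    show "\<forall>\<^sub>F k in sequentially. real (n k) powr t / of_int \<lfloor>real (n k) powr t\<rfloor> \<le> 1 + 1 / of_int \<lfloor>real (n k) powr t\<rfloor>"
    proof (intro always_eventually allI)
      fix k
      have "real (n k) powr t \<le> of_int \<lfloor>real (n k) powr t\<rfloor> + 1" by linarith
      then have "real (n k) powr t / of_int \<lfloor>real (n k) powr t\<rfloor> \<le> (of_int \<lfloor>real (n k) powr t\<rfloor> + 1) / of_int \<lfloor>real (n k) powr t\<rfloor>"
        using fpos[of k] by (intro divide_right_mono) auto
      then show "real (n k) powr t / of_int \<lfloor>real (n k) powr t\<rfloor> \<le> 1 + 1 / of_int \<lfloor>real (n k) powr t\<rfloor>"
        using fpos[of k] by (simp add: add_divide_distrib)
    qed
    have "(\<lambda>k. 1 / of_int \<lfloor>real (n k) powr t\<rfloor> :: real) \<longlonglongrightarrow> 0"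
      by (rule tendsto_divide_0[OF tendsto_const filterlim_at_top_imp_at_infinity[OF frtop]])
    from tendsto_add[OF tendsto_const[of 1] this]
    show "(\<lambda>k. 1 + 1 / of_int \<lfloor>real (n k) powr t\<rfloor> :: real) \<longlonglongrightarrow> 1" by simp
  qed
  have "filterlim (\<lambda>k. nat \<lfloor>real (n k) powr t\<rfloor>) sequentially sequentially"
    by (rule filterlim_compose[OF filterlim_nat_sequentially ftop])
  then show "filterlim (\<lambda>k. nat \<lfloor>real (n k) powr t\<rfloor> - 1) sequentially sequentially"
    by (rule filterlim_compose[OF filterlim_minus_const_nat_at_top])
  have pw: "real (n k) powr t / real (n k) = real (n k) powr (t - 1)" for k
    using n_pos[of k] by (simp add: powr_diff)
  show "(\<lambda>k. of_int \<lfloor>real (n k) powr t\<rfloor> / real (n k)) \<longlonglongrightarrow> 0" if "t < 1"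
  proof (rule tendsto_sandwich[OF _ _ tendsto_const, of 0 _ sequentially "\<lambda>k. real (n k) powr (t - 1)"])
    show "\<forall>\<^sub>F k in sequentially. of_int \<lfloor>real (n k) powr t\<rfloor> / real (n k) \<le> real (n k) powr (t - 1)"
      unfolding pw[symmetric] by (intro always_eventually allI divide_right_mono) auto
    show "(\<lambda>k. real (n k) powr (t - 1)) \<longlonglongrightarrow> 0"
      using that by (intro tendsto_neg_powr filterlim_real_shift n) auto
  qed auto
  show "filterlim (\<lambda>k. of_int \<lfloor>real (n k) powr t\<rfloor> / real (n k)) at_top sequentially" if "t > 1"
  proof (rule filterlim_at_top_mono)
    show "filterlim (\<lambda>k. (1 / 2) * real (n k) powr (t - 1)) at_top sequentially"
      using that by (intro filterlim_tendsto_pos_mult_at_top[OF tendsto_const] 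
          filterlim_compose[OF real_powr_at_top filterlim_real_shift[of n, OF n]]) auto
    show "\<forall>\<^sub>F k in sequentially. (1 / 2) * real (n k) powr (t - 1) \<le> of_int \<lfloor>real (n k) powr t\<rfloor> / real (n k)"
    proof (intro always_eventually allI)
      fix k
      have "(1 / 2) * real (n k) powr t \<le> of_int \<lfloor>real (n k) powr t\<rfloor>" using log_index(3)[of t k] assms by simp
      then show "(1 / 2) * real (n k) powr (t - 1) \<le> of_int \<lfloor>real (n k) powr t\<rfloor> / real (n k)"
        unfolding pw[symmetric] using n_pos[of k] by (simp add: field_simps)
    qed
  qed
qed

text \<open>The cell of i consists of the t with 1 + i <= n^t < 2 + i, and the density is the
  derivative of n^t. So the mass of the cell is (2 + i) - (1 + i) = 1.\<close>

lemma distr_log_index: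
  "distr (density lborel (\<lambda>t. ennreal (indicator {0..} t * (ln (real (n k)) * real (n k) powr t))))
     (count_space UNIV) (\<lambda>t. nat \<lfloor>real (n k) powr t\<rfloor> - 1) = count_space UNIV"
proof (rule distr_count_space_eqI)
  fix i :: nat
  let ?n = "real (n k)"
  have ln: "ln ?n > 0" using n[of k] by simp
  define p q where "p = ln (1 + real i) / ln ?n" and "q = ln (2 + real i) / ln ?n"
  have pq: "0 \<le> p" "p \<le> q" using ln by (auto simp: p_def q_def divide_right_mono)
  have npow: "?n powr p = 1 + real i" "?n powr q = 2 + real i"
    using ln n_pos[of k] by (simp_all add: powr_def p_def q_def)
  have mono: "?n powr s \<le> ?n powr t \<longleftrightarrow> s \<le> t" for s t using n[of k] by simp
  have mem: "0 \<le> t \<and> nat \<lfloor>?n powr t\<rfloor> - 1 = i \<longleftrightarrow> t \<in> {p..<q}" for t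
  proof -
    have "nat \<lfloor>?n powr t\<rfloor> - 1 = i \<longleftrightarrow> t \<in> {p..<q}" if "0 \<le> t"
    proof -
      have "1 \<le> \<lfloor>?n powr t\<rfloor>" using log_index(1)[OF that, of k] by simp
      then have "nat \<lfloor>?n powr t\<rfloor> - 1 = i \<longleftrightarrow> \<lfloor>?n powr t\<rfloor> = 1 + int i" by linarith
      also have "\<dots> \<longleftrightarrow> ?n powr p \<le> ?n powr t \<and> \<not> ?n powr q \<le> ?n powr t"
        unfolding npow by (auto simp: floor_eq_iff)
      finally show ?thesis unfolding mono by auto
    qed
    then show ?thesis using pq by auto
  qed
  have "(\<integral>\<^sup>+t. ennreal (indicator {0..} t * (ln ?n * ?n powr t)) * indicator ((\<lambda>t. nat \<lfloor>?n powr t\<rfloor> - 1) -` {i} \<inter> space lborel) t \<partial>lborel)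
      = (\<integral>\<^sup>+t. ennreal (ln ?n * ?n powr t) * indicator {p..<q} t \<partial>lborel)"
    using mem by (intro nn_integral_cong) (auto simp: indicator_def)
  \<comment> \<open>Closing the interval changes a null set and makes the fundamental theorem of
    calculus applicable.\<close>
  also have "\<dots> = (\<integral>\<^sup>+t. ennreal (ln ?n * ?n powr t) * indicator {p..q} t \<partial>lborel)"
    using AE_lborel_singleton[of q] by (intro nn_integral_cong_AE) (auto elim!: eventually_mono simp: indicator_def)
  also have "\<dots> = ennreal (?n powr q - ?n powr p)"
    using ln n_pos[of k] pq
    by (intro nn_integral_FTC_Icc) (auto intro!: derivative_eq_intros simp: mult.commute)
  finally show "(\<integral>\<^sup>+t. ennreal (indicator {0..} t * (ln ?n * ?n powr t)) * indicator ((\<lambda>t. nat \<lfloor>?n powr t\<rfloor> - 1) -` {i} \<inter> space lborel) t \<partial>lborel) = 1"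
    by (simp add: npow)
qed auto

text \<open>With beta * a = 1 the first power is the reciprocal of the floor of n^t and cancels the
  factor n^t of the density up to rounding; ln n goes into the normalisation. Only a cut-off factor,
  active from t = 1 on, survives.\<close>

lemma kern_log:
  assumes "\<beta> * a = 1" and t: "t \<ge> 0"
  shows "indicator {0..} t * (ln (real (n k)) * real (n k) powr t) * kern \<beta> a b (n k) (nat \<lfloor>real (n k) powr t\<rfloor> - 1)
      / (real (n k) powr - (\<beta> * b) * ln (real (n k)))
      = real (n k) powr t / of_int \<lfloor>real (n k) powr t\<rfloor> * (of_int \<lfloor>real (n k) powr t\<rfloor> / real (n k) + 1) powr - (\<beta> * b)"
proof -
  let ?q = "of_int \<lfloor>real (n k) powr t\<rfloor> :: real"
  have q: "?q \<ge> 1" by (rule log_index(4)[OF t])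
  have "kern \<beta> a b (n k) (nat \<lfloor>real (n k) powr t\<rfloor> - 1) = (1 / ?q) * (?q + real (n k)) powr - (\<beta> * b)"
    unfolding kern_def log_index(2)[OF t] assms using q by (simp add: powr_minus_divide)
  moreover have "?q / real (n k) + 1 = (?q + real (n k)) / real (n k)"
    using n_pos[of k] by (simp add: field_simps)
  moreover have "ln (real (n k)) > 0" using n[of k] by simp
  ultimately show ?thesis
    using q n_pos[of k] t by (simp add: powr_divide)
qed

text \<open>The cut-off tends to 1 for t < 1, where n^t is negligible against n, and to 0 for t > 1.
  So the limit is the uniform distribution on the unit interval.\<close>

lemma index_scaling_log:
  assumes "\<beta> * a = 1"
  shows "index_scaling lborel \<beta> a b n (\<lambda>k t. nat \<lfloor>real (n k) powr t\<rfloor> - 1)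
     (\<lambda>k t. indicator {0..} t * (ln (real (n k)) * real (n k) powr t))
     (\<lambda>k. real (n k) powr - (\<beta> * b) * ln (real (n k)))
     (\<lambda>t. indicator {0<..<1} t)
     (\<lambda>t. indicator {0..} t * (2 * 2 powr (\<beta> * b) * exp (\<beta> * b) * exp (- (\<beta> * b) * t)))"
proof
  have ln: "ln (real (n k)) > 0" for k using n[of k] by simp
  define x where "x k t = (of_int \<lfloor>real (n k) powr t\<rfloor> / real (n k) :: real)" for k t
  note eq = kern_log[OF assms, folded x_def]
  fix k :: nat
  show "real (n k) powr - (\<beta> * b) * ln (real (n k)) > 0" using ln n_pos[of k] by simp
  show "0 \<le> indicator {0..} t * (ln (real (n k)) * real (n k) powr t)" for t :: real
    using ln[of k] by simp
  show "distr (density lborel (\<lambda>t. ennreal (indicator {0..} t * (ln (real (n k)) * real (n k) powr t))))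
     (count_space UNIV) (\<lambda>t. nat \<lfloor>real (n k) powr t\<rfloor> - 1) = count_space UNIV"
    by (rule distr_log_index)
  fix t :: real
  show "indicator {0..} t * (ln (real (n k)) * real (n k) powr t) * kern \<beta> a b (n k) (nat \<lfloor>real (n k) powr t\<rfloor> - 1)
      / (real (n k) powr - (\<beta> * b) * ln (real (n k)))
     \<le> indicator {0..} t * (2 * 2 powr (\<beta> * b) * exp (\<beta> * b) * exp (- (\<beta> * b) * t))"
  proof (cases "t \<ge> 0")
    case True
    \<comment> \<open>The domination must decay in t uniformly in n. For t >= 1, ln n >= 1 gives
      n^(t-1) >= e^(t-1), and taking the floor costs at most a factor 2; for t < 1 the claim is
      trivial.\<close>
    have "exp (t - 1) / 2 \<le> x k t + 1"
    proof (cases "t \<ge> 1")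
      case True
      have "exp (t - 1) \<le> real (n k) powr (t - 1)"
      proof -
        have "1 \<le> ln (real (n k))"
          using n[of k] exp_le by (subst ln_ge_iff) auto
        then have "1 * (t - 1) \<le> ln (real (n k)) * (t - 1)" using True by (intro mult_right_mono) auto
        then show ?thesis using n_pos[of k] by (simp add: powr_def mult.commute)
      qed
      also have "\<dots> = real (n k) powr t / real (n k)" using n_pos[of k] by (simp add: powr_diff)
      also have "\<dots> \<le> 2 * x k t"
        using log_index(3)[OF \<open>t \<ge> 0\<close>, of k] n_pos[of k] by (simp add: x_def divide_right_mono)
      finally show ?thesis by simp
    next
      case False
      then have "exp (t - 1) \<le> 1" by simp
      moreover have "x k t \<ge> 0" using log_index(4)[OF \<open>t \<ge> 0\<close>, of k] by (simp add: x_def)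
      ultimately show ?thesis by linarith
    qed
    then have "(x k t + 1) powr - (\<beta> * b) \<le> (exp (t - 1) / 2) powr - (\<beta> * b)"
      using b by (intro powr_mono2') auto
    also have "\<dots> = 2 powr (\<beta> * b) * exp (\<beta> * b) * exp (- (\<beta> * b) * t)"
      by (simp add: powr_divide powr_minus_divide exp_powr_real field_simps exp_add[symmetric] exp_minus)
    finally have *: "(x k t + 1) powr - (\<beta> * b) \<le> 2 powr (\<beta> * b) * exp (\<beta> * b) * exp (- (\<beta> * b) * t)" .
    have "real (n k) powr t / of_int \<lfloor>real (n k) powr t\<rfloor> \<le> 2"
      using log_index(3,4)[OF True, of k] by (simp add: divide_le_eq)
    then have "real (n k) powr t / of_int \<lfloor>real (n k) powr t\<rfloor> * (x k t + 1) powr - (\<beta> * b)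
        \<le> 2 * (2 powr (\<beta> * b) * exp (\<beta> * b) * exp (- (\<beta> * b) * t))"
      using * by (intro mult_mono) auto
    then show ?thesis unfolding eq[OF True] using True by (simp add: mult.assoc)
  qed simp
next
  have ln: "ln (real (n k)) > 0" for k using n[of k] by simp
  define x where "x k t = (of_int \<lfloor>real (n k) powr t\<rfloor> / real (n k) :: real)" for k t
  note eq = kern_log[OF assms, folded x_def]
  show "AE t in lborel. (\<lambda>k. indicator {0..} t * (ln (real (n k)) * real (n k) powr t) * kern \<beta> a b (n k) (nat \<lfloor>real (n k) powr t\<rfloor> - 1)
      / (real (n k) powr - (\<beta> * b) * ln (real (n k)))) \<longlonglongrightarrow> indicator {0<..<1} t"
    \<comment> \<open>Both endpoints are true exceptions: the sequence tends to 1 at t = 0 and to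
      2^(-beta*b) at t = 1, while the indicator vanishes at both.\<close>
    using AE_lborel_singleton[of 0] AE_lborel_singleton[of 1]
  proof eventually_elim
    case (elim t)
    consider "t < 0" | "0 < t" "t < 1" | "1 < t" using elim by linarith
    then show ?case
    proof cases
      case 2
      have "(\<lambda>k. real (n k) powr t / of_int \<lfloor>real (n k) powr t\<rfloor> * (x k t + 1) powr - (\<beta> * b)) \<longlonglongrightarrow> 1 * (0 + 1) powr - (\<beta> * b)"
        unfolding x_def using 2 by (intro tendsto_intros log_index_tendsto) auto
      then show ?thesis using 2 eq[of t] by simp
    next
      case 3
      have "filterlim (\<lambda>k. x k t + 1) at_top sequentially"
        unfolding x_def using 3 by (subst add.commute) (intro filterlim_tendsto_add_at_top[OF tendsto_const] log_index_tendsto, auto)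
      then have "(\<lambda>k. (x k t + 1) powr - (\<beta> * b)) \<longlonglongrightarrow> 0"
        using b by (intro tendsto_neg_powr) auto
      then have "(\<lambda>k. real (n k) powr t / of_int \<lfloor>real (n k) powr t\<rfloor> * (x k t + 1) powr - (\<beta> * b)) \<longlonglongrightarrow> 1 * 0"
        using 3 by (intro tendsto_mult log_index_tendsto) auto
      then show ?thesis using 3 eq[of t] by simp
    qed simp
  qed
  have "(\<lambda>t. exp (- (\<beta> * b) * t)) integrable_on {0..}"
    using integrable_on_exp_minus_to_infinity[OF b, of 0] by simp
  then have "integrable lborel (\<lambda>t. indicator {0..} t * exp (- (\<beta> * b) * t))"
    by (intro integrable_lborel_nonneg_hk) auto
  from integrable_mult_right[OF this, of "2 * 2 powr (\<beta> * b) * exp (\<beta> * b)"]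
  show "integrable lborel (\<lambda>t. indicator {0..} t * (2 * 2 powr (\<beta> * b) * exp (\<beta> * b) * exp (- (\<beta> * b) * t)))"
    by (simp add: mult_ac)
qed auto

end

section \<open>The limits of the covariance\<close>

lemma V_eq: "V \<alpha> x y = x * y / norm (x, y) powr (2 - \<alpha>)"
  by (cases "(x, y) = 0") (auto simp: V_altdef)

lemma V_scale: "l > 0 \<Longrightarrow> V \<alpha> (l * x) (l * y) = l powr \<alpha> * V \<alpha> x y"
proof -
  assume l: "l > 0"
  have "norm (l * x, l * y) = l * norm (x, y)"
    using norm_scaleR[of l "(x, y)"] l by simp
  then show ?thesis
    using l by (simp add: V_eq powr_mult powr_diff power2_eq_square)
qed

text \<open>Split |x| = |x|^a |x|^(1-a) and |y| = |y|^(alpha-a) |y|^(1-(alpha-a)). The conditions on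
  \<open>a\<close> make both complementary exponents nonnegative; they add up to 2 - alpha, so the
  complementary factors are absorbed by the denominator of V.\<close>

lemma abs_V_le:
  assumes "x \<noteq> 0" "y \<noteq> 0" "\<alpha> - 1 \<le> a" "a \<le> 1"
  shows "\<bar>V \<alpha> x y\<bar> \<le> \<bar>x\<bar> powr a * \<bar>y\<bar> powr (\<alpha> - a)"
proof -
  have pos: "norm (x, y) > 0" using assms by (simp add: zero_prod_def)
  have "\<bar>x\<bar> powr (1 - a) * \<bar>y\<bar> powr (1 - (\<alpha> - a)) \<le> norm (x, y) powr (1 - a) * norm (x, y) powr (1 - (\<alpha> - a))"
    using norm_fst_le[of x y] norm_snd_le[of y x] assms by (intro mult_mono powr_mono2) auto
  also have "\<dots> = norm (x, y) powr (2 - \<alpha>)" by (simp add: powr_add[symmetric])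
  finally have *: "\<bar>x\<bar> powr (1 - a) * \<bar>y\<bar> powr (1 - (\<alpha> - a)) \<le> norm (x, y) powr (2 - \<alpha>)" .
  have "\<bar>x\<bar> * \<bar>y\<bar> = (\<bar>x\<bar> powr a * \<bar>x\<bar> powr (1 - a)) * (\<bar>y\<bar> powr (\<alpha> - a) * \<bar>y\<bar> powr (1 - (\<alpha> - a)))"
    using assms by (simp add: powr_add[symmetric])
  also have "\<dots> = \<bar>x\<bar> powr a * \<bar>y\<bar> powr (\<alpha> - a) * (\<bar>x\<bar> powr (1 - a) * \<bar>y\<bar> powr (1 - (\<alpha> - a)))"
    by (simp add: mult_ac)
  also have "\<dots> \<le> \<bar>x\<bar> powr a * \<bar>y\<bar> powr (\<alpha> - a) * norm (x, y) powr (2 - \<alpha>)"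
    by (intro mult_left_mono *) auto
  finally show ?thesis using pos by (simp add: V_eq abs_mult divide_le_eq)
qed

text \<open>Pull the common scale \<open>g\<close> of the second argument out of V by homogeneity.
  The first argument then carries g * r, and g^alpha = (g*r)^a * g^b / r^a distributes the powers
  over the two coordinates.\<close>

lemma V_factor:
  assumes "p > 0" "P > 0" "q > 0" "Q > 0" and r: "r = (P / p) powr \<beta>1 * (Q / q) powr \<beta>2" and "a + b = \<alpha>"
  shows "V \<alpha> (w * p powr - \<beta>1 * q powr - \<beta>2) (w' * P powr - \<beta>1 * Q powr - \<beta>2) =
    (p powr - (\<beta>1 * a) * P powr - (\<beta>1 * b)) * (q powr - (\<beta>2 * a) * Q powr - (\<beta>2 * b)) * (V \<alpha> (w * r) w' / r powr a)"
proof -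
  define g where "g = P powr - \<beta>1 * Q powr - \<beta>2"
  have g: "g > 0" and r0: "r > 0" using assms by (simp_all add: g_def)
  have pq: "p powr - \<beta>1 * q powr - \<beta>2 = g * r"
    using assms by (simp add: g_def r powr_divide powr_minus field_simps)
  have "V \<alpha> (w * p powr - \<beta>1 * q powr - \<beta>2) (w' * P powr - \<beta>1 * Q powr - \<beta>2) = V \<alpha> (g * (w * r)) (g * w')"
    using pq by (simp add: mult_ac) (simp add: g_def mult_ac)
  also have "\<dots> = g powr \<alpha> * V \<alpha> (w * r) w'" by (rule V_scale[OF g])
  also have "g powr \<alpha> = (g * r) powr a * g powr b / r powr a"
    using g r0 \<open>a + b = \<alpha>\<close> by (simp add: powr_mult powr_add[symmetric])
  also have "(g * r) powr a * g powr b = (p powr - (\<beta>1 * a) * P powr - (\<beta>1 * b)) * (q powr - (\<beta>2 * a) * Q powr - (\<beta>2 * b))"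
    unfolding pq[symmetric] using assms by (simp add: g_def powr_mult powr_powr mult_ac)
  finally show ?thesis by simp
qed

lemma tendsto_V [tendsto_intros]:
  assumes "(f \<longlongrightarrow> x) F" "(g \<longlongrightarrow> y) F" "x \<noteq> 0"
  shows "((\<lambda>k. V \<alpha> (f k) (g k)) \<longlongrightarrow> V \<alpha> x y) F"
  unfolding V_eq using assms by (intro tendsto_intros) (auto simp: zero_prod_def)

text \<open>When the first argument dominates, V becomes linear in the second. By homogeneity the
  quotient equals w w' / |(w, w'/r)|^(2-alpha), where w'/r tends to 0, and W / |W|^(2-alpha) is the
  signed power of W.\<close>

lemma tendsto_V_rescaled:
  assumes w: "w \<longlonglongrightarrow> W" "W \<noteq> 0" and w': "w' \<longlonglongrightarrow> W'" and r: "filterlim r at_top sequentially"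
  shows "(\<lambda>k. V \<alpha> (w k * r k) (w' k) / r k powr (\<alpha> - 1)) \<longlonglongrightarrow> signed_powr W (\<alpha> - 1) * W'"
proof -
  have "(\<lambda>k. w' k / r k) \<longlonglongrightarrow> 0"
    by (rule tendsto_divide_0[OF w' filterlim_at_top_imp_at_infinity[OF r]])
  then have "(\<lambda>k. w k * w' k / norm (w k, w' k / r k) powr (2 - \<alpha>)) \<longlonglongrightarrow> W * W' / norm (W, 0 :: real) powr (2 - \<alpha>)"
    using w w' by (intro tendsto_intros) auto
  also have "W * W' / norm (W, 0 :: real) powr (2 - \<alpha>) = signed_powr W (\<alpha> - 1) * W'"
  proof -
    have "\<bar>W\<bar> powr (2 - \<alpha>) * \<bar>W\<bar> powr (\<alpha> - 1) = \<bar>W\<bar>"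
      using w(2) by (simp add: powr_add[symmetric])
    then have "W = sgn W * (\<bar>W\<bar> powr (2 - \<alpha>) * \<bar>W\<bar> powr (\<alpha> - 1))" by (simp add: sgn_mult_abs)
    then show ?thesis using w(2) by (simp add: signed_powr_def norm_Pair field_simps)
  qed
  finally have *: "(\<lambda>k. w k * w' k / norm (w k, w' k / r k) powr (2 - \<alpha>)) \<longlonglongrightarrow> signed_powr W (\<alpha> - 1) * W'" .
  have "\<forall>\<^sub>F k in sequentially. r k > 0" using r by (simp add: filterlim_at_top_dense)
  then have "\<forall>\<^sub>F k in sequentially. w k * w' k / norm (w k, w' k / r k) powr (2 - \<alpha>) = V \<alpha> (w k * r k) (w' k) / r k powr (\<alpha> - 1)"
  proof eventually_elim
    case (elim k)
    have "V \<alpha> (w k * r k) (w' k) = V \<alpha> (r k * w k) (r k * (w' k / r k))" using elim by (simp add: mult.commute)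
    also have "\<dots> = r k powr \<alpha> * V \<alpha> (w k) (w' k / r k)" by (rule V_scale[OF elim])
    also have "r k powr \<alpha> = r k powr (\<alpha> - 1) * r k" using elim by (simp add: powr_diff)
    finally show ?case using elim by (simp add: V_eq)
  qed
  with * show ?thesis by (rule Lim_transform_eventually)
qed

section \<open>The weights and the bounded factor of the covariance sum\<close>

locale weighted_field =
  fixes \<alpha> \<beta>1 \<beta>2 :: real and w :: "nat \<Rightarrow> nat \<Rightarrow> real" and w_right w_top :: "nat \<Rightarrow> real"
  assumes alpha: "0 < \<alpha>" "\<alpha> \<le> 2"
    and beta: "\<beta>1 > 1 / \<alpha>" "\<beta>2 > 1 / \<alpha>"
    and w_nonzero: "\<And>i j. w i j \<noteq> 0"
    and A1: "((\<lambda>(i, j). w i j) \<longlongrightarrow> 1) (sequentially \<times>\<^sub>F sequentially)"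
    and A2: "\<And>i. (\<lambda>j. w i j) \<longlonglongrightarrow> w_right i" "\<And>i. w_right i > 0"
    and A3: "\<And>j. (\<lambda>i. w i j) \<longlonglongrightarrow> w_top j" "\<And>j. w_top j > 0"
begin

lemma beta_pos: "\<beta>1 > 0" "\<beta>2 > 0" "\<beta>1 * \<alpha> > 1" "\<beta>2 * \<alpha> > 1"
proof -
  have "1 / \<alpha> > 0" using alpha by simp
  then show "\<beta>1 > 0" "\<beta>2 > 0" using beta by linarith+
  show "\<beta>1 * \<alpha> > 1" "\<beta>2 * \<alpha> > 1" using beta alpha by (auto simp: divide_less_eq)
qed

text \<open>The limit along both indices bounds the weights on a far quadrant only. The finitely
  many remaining rows and columns are bounded because each of them converges. The 2 in
  \<open>C\<close> comes from |w - 1| < 1.\<close>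

lemma w_bounded: obtains C where "C \<ge> 1" "\<And>i j. \<bar>w i j\<bar> \<le> C"
proof -
  have "\<forall>\<^sub>F p in sequentially \<times>\<^sub>F sequentially. dist (case p of (i, j) \<Rightarrow> w i j) 1 < 1"
    using A1 by (rule tendstoD) simp
  then obtain P Q where P: "eventually P sequentially" and Q: "eventually Q sequentially"
    and PQ: "\<And>i j. P i \<Longrightarrow> Q j \<Longrightarrow> dist (w i j) 1 < 1"
    unfolding eventually_prod_filter by auto
  obtain N where N: "\<And>i. i \<ge> N \<Longrightarrow> P i" using P by (auto simp: eventually_sequentially)
  obtain N' where N': "\<And>i. i \<ge> N' \<Longrightarrow> Q i" using Q by (auto simp: eventually_sequentially)
  have "\<exists>B. \<forall>j. \<bar>w i j\<bar> \<le> B" for i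
    using convergent_imp_Bseq[OF convergentI[OF A2(1)[of i]]] unfolding Bseq_def by auto
  then obtain B where B: "\<And>i j. \<bar>w i j\<bar> \<le> B i" by metis
  have "\<exists>D. \<forall>i. \<bar>w i j\<bar> \<le> D" for j
    using convergent_imp_Bseq[OF convergentI[OF A3(1)[of j]]] unfolding Bseq_def by auto
  then obtain D where D: "\<And>i j. \<bar>w i j\<bar> \<le> D j" by metis
  have nonneg: "B i \<ge> 0" "D i \<ge> 0" for i
    using B[of i 0] D[of 0 i] by linarith+
  define C where "C = 2 + sum B {..<N} + sum D {..<N'}"
  have s: "sum B {..<N} \<ge> 0" "sum D {..<N'} \<ge> 0" using nonneg by (auto intro: sum_nonneg)
  have "\<bar>w i j\<bar> \<le> C" for i j
  proof -
    consider "i < N" | "j < N'" | "i \<ge> N" "j \<ge> N'" by linarith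
    then show ?thesis
    proof cases
      case 1
      then have "B i \<le> sum B {..<N}" using nonneg by (intro member_le_sum) auto
      then show ?thesis using B[of i j] s by (simp add: C_def)
    next
      case 2
      then have "D j \<le> sum D {..<N'}" using nonneg by (intro member_le_sum) auto
      then show ?thesis using D[of i j] s by (simp add: C_def)
    next
      case 3
      then have "\<bar>w i j - 1\<bar> < 1" using PQ[OF N N'] by (simp add: dist_real_def)
      then show ?thesis using s by (simp add: C_def)
    qed
  qed
  moreover have "C \<ge> 1" using s by (simp add: C_def)
  ultimately show ?thesis using that by blast
qed

lemma field_coeff_nonzero: "field_coeff w \<beta>1 \<beta>2 i j \<noteq> 0"
  using w_nonzero by (simp add: field_coeff_def)

lemma integrable_field_coeff:
  "integrable (count_space UNIV) (\<lambda>(i, j). \<bar>field_coeff w \<beta>1 \<beta>2 i j\<bar> powr \<alpha>)"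
proof -
  obtain C where C: "C \<ge> 1" "\<And>i j. \<bar>w i j\<bar> \<le> C" using w_bounded by blast
  let ?C = "count_space (UNIV :: nat set)"
  interpret pair_sigma_finite ?C ?C
    by (simp add: pair_sigma_finite_def sigma_finite_measure_count_space_countable)
  have "integrable (?C \<Otimes>\<^sub>M ?C) (\<lambda>(i, j). (1 + real i) powr - (\<beta>1 * \<alpha>) * (1 + real j) powr - (\<beta>2 * \<alpha>))"
    using beta_pos by (intro integrable_pair_mult integrable_count_space_powr)
  then have "integrable (count_space UNIV) (\<lambda>(i, j). (1 + real i) powr - (\<beta>1 * \<alpha>) * (1 + real j) powr - (\<beta>2 * \<alpha>))"
    by (simp add: pair_measure_countable)
  from integrable_mult_right[OF this, of "C powr \<alpha>"]
  show ?thesis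
  proof (rule Bochner_Integration.integrable_bound[OF _ _ AE_I2])
    fix p :: "nat \<times> nat"
    obtain i j where p: "p = (i, j)" by force
    have "\<bar>field_coeff w \<beta>1 \<beta>2 i j\<bar> powr \<alpha> = \<bar>w i j\<bar> powr \<alpha> * ((1 + real i) powr - (\<beta>1 * \<alpha>) * (1 + real j) powr - (\<beta>2 * \<alpha>))"
      by (simp add: field_coeff_def abs_mult powr_mult powr_powr)
    also have "\<dots> \<le> C powr \<alpha> * ((1 + real i) powr - (\<beta>1 * \<alpha>) * (1 + real j) powr - (\<beta>2 * \<alpha>))"
      using C alpha by (intro mult_right_mono powr_mono2) auto
    finally show "norm (case p of (i, j) \<Rightarrow> \<bar>field_coeff w \<beta>1 \<beta>2 i j\<bar> powr \<alpha>)
        \<le> norm (C powr \<alpha> * (case p of (i, j) \<Rightarrow> (1 + real i) powr - (\<beta>1 * \<alpha>) * (1 + real j) powr - (\<beta>2 * \<alpha>)))"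
      by (simp add: p)
  qed auto
qed

definition cov :: "nat \<Rightarrow> nat \<Rightarrow> real" where
  "cov n m = (LINT p|count_space UNIV. (case p of (i, j) \<Rightarrow>
      V \<alpha> (field_coeff w \<beta>1 \<beta>2 i j) (field_coeff w \<beta>1 \<beta>2 (i + n) (j + m))))"

text \<open>What \<open>V_factor\<close> leaves after the two kernels are split off. Dividing by the
  power \<open>a\<close> of the ratios removes exactly the growth in the first argument that
  \<open>abs_V_le\<close> permits.\<close>

definition G :: "real \<Rightarrow> nat \<Rightarrow> nat \<Rightarrow> nat \<Rightarrow> nat \<Rightarrow> real" where
  "G a n m i j = V \<alpha> (w i j * (ratio \<beta>1 n i * ratio \<beta>2 m j)) (w (i + n) (j + m)) / (ratio \<beta>1 n i * ratio \<beta>2 m j) powr a"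

lemma cov_eq:
  assumes "a + b = \<alpha>"
  shows "cov n m = (LINT p|count_space UNIV. kern \<beta>1 a b n (fst p) * kern \<beta>2 a b m (snd p) * G a n m (fst p) (snd p))"
  unfolding cov_def
proof (rule Bochner_Integration.integral_cong[OF refl])
  fix p :: "nat \<times> nat"
  obtain i j where p: "p = (i, j)" by force
  show "(case p of (i, j) \<Rightarrow> V \<alpha> (field_coeff w \<beta>1 \<beta>2 i j) (field_coeff w \<beta>1 \<beta>2 (i + n) (j + m)))
      = kern \<beta>1 a b n (fst p) * kern \<beta>2 a b m (snd p) * G a n m (fst p) (snd p)"
    using V_factor[of "1 + real i" "1 + real i + real n" "1 + real j" "1 + real j + real m" _ \<beta>1 \<beta>2 a b \<alpha> "w i j" "w (i + n) (j + m)", OF _ _ _ _ refl assms]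
    by (simp add: p field_coeff_def G_def kern_def ratio_def add.assoc[symmetric])
qed

lemma G_bounded:
  assumes "0 \<le> a" "a \<le> 1" "\<alpha> - 1 \<le> a" "a \<le> \<alpha>"
  obtains C where "\<And>n m i j. \<bar>G a n m i j\<bar> \<le> C"
proof -
  obtain C where C: "C \<ge> 1" "\<And>i j. \<bar>w i j\<bar> \<le> C" using w_bounded by blast
  have "\<bar>G a n m i j\<bar> \<le> C powr a * C powr (\<alpha> - a)" for n m i j
  proof -
    define r where "r = ratio \<beta>1 n i * ratio \<beta>2 m j"
    have r: "r > 0" using ratio_ge_1[of \<beta>1 n i] ratio_ge_1[of \<beta>2 m j] beta_pos by (simp add: r_def)
    have "\<bar>V \<alpha> (w i j * r) (w (i + n) (j + m))\<bar> \<le> \<bar>w i j * r\<bar> powr a * \<bar>w (i + n) (j + m)\<bar> powr (\<alpha> - a)"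
      using r w_nonzero assms by (intro abs_V_le) auto
    also have "\<dots> = \<bar>w i j\<bar> powr a * \<bar>w (i + n) (j + m)\<bar> powr (\<alpha> - a) * r powr a"
      using r by (simp add: abs_mult powr_mult)
    also have "\<dots> \<le> C powr a * C powr (\<alpha> - a) * r powr a"
      using C assms by (intro mult_right_mono mult_mono powr_mono2) auto
    finally show ?thesis using r by (simp add: G_def r_def[symmetric] divide_le_eq)
  qed
  then show ?thesis using that by blast
qed

lemma w_tendsto_1:
  assumes "filterlim i sequentially sequentially" "filterlim j sequentially sequentially"
  shows "(\<lambda>k. w (i k) (j k)) \<longlonglongrightarrow> 1"
  using filterlim_compose[OF A1 filterlim_Pair[OF assms]] by simp

text \<open>The shifts \<open>n k\<close> and \<open>m k\<close> alone drive both indices to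
  infinity, whatever \<open>i\<close> and \<open>j\<close> do. So the weight of the second
  coefficient leaves no trace in any of the limits.\<close>

lemma w_shift_tendsto_1:
  assumes "\<And>k. n k \<ge> k + 3" "\<And>k. m k \<ge> k + 3"
  shows "(\<lambda>k. w (i k + n k) (j k + m k)) \<longlonglongrightarrow> 1"
proof (rule w_tendsto_1)
  show "filterlim (\<lambda>k. i k + n k) sequentially sequentially"
    by (rule filterlim_at_top_mono[OF filterlim_ident], rule always_eventually)
       (use assms(1) in \<open>auto intro: order_trans[OF le_add1] trans_le_add2\<close>)
  show "filterlim (\<lambda>k. j k + m k) sequentially sequentially"
    by (rule filterlim_at_top_mono[OF filterlim_ident], rule always_eventually)
       (use assms(2) in \<open>auto intro: order_trans[OF le_add1] trans_le_add2\<close>)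
qed

lemma cov_tendsto:
  fixes \<mu>1 :: "'x measure" and \<mu>2 :: "'y measure"
  assumes s1: "index_scaling \<mu>1 \<beta>1 a b n \<iota>1 J1 \<nu>1 \<kappa>1 K1"
    and s2: "index_scaling \<mu>2 \<beta>2 a b m \<iota>2 J2 \<nu>2 \<kappa>2 K2"
    and ab: "0 \<le> a" "a \<le> 1" "\<alpha> - 1 \<le> a" "a \<le> \<alpha>" "a + b = \<alpha>"
    and lim: "\<And>x y. \<kappa>1 x \<noteq> 0 \<Longrightarrow> \<kappa>2 y \<noteq> 0 \<Longrightarrow>
        (\<lambda>k. G a (n k) (m k) (\<iota>1 k x) (\<iota>2 k y)) \<longlonglongrightarrow> H (x, y)"
    and H: "H \<in> borel_measurable (\<mu>1 \<Otimes>\<^sub>M \<mu>2)"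
  shows "(\<lambda>k. cov (n k) (m k) / (\<nu>1 k * \<nu>2 k)) \<longlonglongrightarrow> (LINT z|(\<mu>1 \<Otimes>\<^sub>M \<mu>2). \<kappa>1 (fst z) * \<kappa>2 (snd z) * H z)"
    and "integrable (\<mu>1 \<Otimes>\<^sub>M \<mu>2) (\<lambda>z. \<kappa>1 (fst z) * \<kappa>2 (snd z) * H z)"
proof -
  obtain C where C: "\<And>n m i j. \<bar>G a n m i j\<bar> \<le> C" using G_bounded[OF ab(1-4)] by blast
  have lim': "AE z in \<mu>1 \<Otimes>\<^sub>M \<mu>2. \<kappa>1 (fst z) \<noteq> 0 \<longrightarrow> \<kappa>2 (snd z) \<noteq> 0 \<longrightarrow>
        (\<lambda>k. G a (n k) (m k) (\<iota>1 k (fst z)) (\<iota>2 k (snd z))) \<longlonglongrightarrow> H z"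
    using lim by (intro AE_I2) auto
  note T = tendsto_double_sum_scaling[where G = "\<lambda>k. G a (n k) (m k)", OF s1 s2 C lim' H]
  show "(\<lambda>k. cov (n k) (m k) / (\<nu>1 k * \<nu>2 k)) \<longlonglongrightarrow> (LINT z|(\<mu>1 \<Otimes>\<^sub>M \<mu>2). \<kappa>1 (fst z) * \<kappa>2 (snd z) * H z)"
    unfolding cov_eq[OF ab(5)] by (rule T(1))
  show "integrable (\<mu>1 \<Otimes>\<^sub>M \<mu>2) (\<lambda>z. \<kappa>1 (fst z) * \<kappa>2 (snd z) * H z)" by (rule T(2))
qed

text \<open>The second ratio is at least 1, so divergence of the first already forces the product to
  diverge. Hence the second coordinate may be in any regime.\<close>

lemma G_tendsto_of_ratio_at_top:
  assumes nm: "\<And>k. n k \<ge> k + 3" "\<And>k. m k \<ge> k + 3"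
    and "filterlim (\<lambda>k. ratio \<beta>1 (n k) (i k)) at_top sequentially"
    and "(\<lambda>k. w (i k) (j k)) \<longlonglongrightarrow> W" "W \<noteq> 0"
  shows "(\<lambda>k. G (\<alpha> - 1) (n k) (m k) (i k) (j k)) \<longlonglongrightarrow> signed_powr W (\<alpha> - 1)"
proof -
  have "filterlim (\<lambda>k. ratio \<beta>1 (n k) (i k) * ratio \<beta>2 (m k) (j k)) at_top sequentially"
  proof (rule filterlim_at_top_mono[OF assms(3)], rule always_eventually, rule allI)
    fix k
    have "ratio \<beta>1 (n k) (i k) * 1 \<le> ratio \<beta>1 (n k) (i k) * ratio \<beta>2 (m k) (j k)"
      using ratio_ge_1[of \<beta>1 "n k" "i k"] ratio_ge_1[of \<beta>2 "m k" "j k"] beta_pos by (intro mult_left_mono) auto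
    then show "ratio \<beta>1 (n k) (i k) \<le> ratio \<beta>1 (n k) (i k) * ratio \<beta>2 (m k) (j k)" by simp
  qed
  from tendsto_V_rescaled[OF assms(4,5) w_shift_tendsto_1[OF nm, of i j] this]
  show ?thesis by (simp add: G_def)
qed

text \<open>This serves every case but the second: the first coordinate is unscaled or logarithmic
  there, so its ratio diverges. It remains to identify the limit \<open>W\<close> of the weight at
  the rescaled indices.\<close>

lemma cov_tendsto_dominant_first:
  fixes \<mu>1 :: "'x measure" and \<mu>2 :: "'y measure"
  assumes nm: "\<And>k. n k \<ge> k + 3" "\<And>k. m k \<ge> k + 3" and "\<alpha> > 1"
    and s1: "index_scaling \<mu>1 \<beta>1 (\<alpha> - 1) 1 n \<iota>1 J1 \<nu>1 \<kappa>1 K1"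
    and s2: "index_scaling \<mu>2 \<beta>2 (\<alpha> - 1) 1 m \<iota>2 J2 \<nu>2 \<kappa>2 K2"
    and ratio: "\<And>x. \<kappa>1 x \<noteq> 0 \<Longrightarrow> filterlim (\<lambda>k. ratio \<beta>1 (n k) (\<iota>1 k x)) at_top sequentially"
    and W: "\<And>x y. \<kappa>1 x \<noteq> 0 \<Longrightarrow> \<kappa>2 y \<noteq> 0 \<Longrightarrow> (\<lambda>k. w (\<iota>1 k x) (\<iota>2 k y)) \<longlonglongrightarrow> W (x, y)" "\<And>z. W z \<noteq> 0"
    and [measurable]: "W \<in> borel_measurable (\<mu>1 \<Otimes>\<^sub>M \<mu>2)"
  shows "(\<lambda>k. cov (n k) (m k) / (\<nu>1 k * \<nu>2 k)) \<longlonglongrightarrow>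
      (LINT z|(\<mu>1 \<Otimes>\<^sub>M \<mu>2). \<kappa>1 (fst z) * \<kappa>2 (snd z) * signed_powr (W z) (\<alpha> - 1))"
    and "integrable (\<mu>1 \<Otimes>\<^sub>M \<mu>2) (\<lambda>z. \<kappa>1 (fst z) * \<kappa>2 (snd z) * signed_powr (W z) (\<alpha> - 1))"
proof -
  have lim: "(\<lambda>k. G (\<alpha> - 1) (n k) (m k) (\<iota>1 k x) (\<iota>2 k y)) \<longlonglongrightarrow> signed_powr (W (x, y)) (\<alpha> - 1)"
    if "\<kappa>1 x \<noteq> 0" "\<kappa>2 y \<noteq> 0" for x y
    using that by (intro G_tendsto_of_ratio_at_top nm ratio W)
  have meas: "(\<lambda>z. signed_powr (W z) (\<alpha> - 1)) \<in> borel_measurable (\<mu>1 \<Otimes>\<^sub>M \<mu>2)"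
    unfolding signed_powr_def by measurable
  show "(\<lambda>k. cov (n k) (m k) / (\<nu>1 k * \<nu>2 k)) \<longlonglongrightarrow>
      (LINT z|(\<mu>1 \<Otimes>\<^sub>M \<mu>2). \<kappa>1 (fst z) * \<kappa>2 (snd z) * signed_powr (W z) (\<alpha> - 1))"
    and "integrable (\<mu>1 \<Otimes>\<^sub>M \<mu>2) (\<lambda>z. \<kappa>1 (fst z) * \<kappa>2 (snd z) * signed_powr (W z) (\<alpha> - 1))"
    using cov_tendsto[OF s1 s2 _ _ _ _ _ lim meas] \<open>\<alpha> > 1\<close> alpha by auto
qed

lemma w_right_bounded: obtains C where "\<And>i. w_right i \<le> C"
proof -
  obtain C where C: "\<And>i j. \<bar>w i j\<bar> \<le> C" using w_bounded by metis
  have "w_right i \<le> C" for i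
    by (rule LIMSEQ_le_const2[OF A2(1)]) (use C in \<open>auto intro: order_trans[OF abs_ge_self]\<close>)
  then show ?thesis using that by blast
qed

lemma w_top_bounded: obtains C where "\<And>j. w_top j \<le> C"
proof -
  obtain C where C: "\<And>i j. \<bar>w i j\<bar> \<le> C" using w_bounded by metis
  have "w_top j \<le> C" for j
    by (rule LIMSEQ_le_const2[OF A3(1)]) (use C in \<open>auto intro: order_trans[OF abs_ge_self]\<close>)
  then show ?thesis using that by blast
qed

lemma integrable_weighted_powr:
  assumes "\<And>i. 0 < v i" "\<And>i. v i \<le> C" "\<beta> * (\<alpha> - 1) > 1" "\<alpha> > 1"
  shows "integrable (count_space (UNIV :: nat set)) (\<lambda>i. (1 + real i) powr - (\<beta> * (\<alpha> - 1)) * v i powr (\<alpha> - 1))"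
proof (rule Bochner_Integration.integrable_bound[OF _ _ AE_I2])
  show "integrable (count_space UNIV) (\<lambda>i. (1 + real i) powr - (\<beta> * (\<alpha> - 1)) * C powr (\<alpha> - 1))"
    using assms(3) by (intro integrable_mult_left integrable_count_space_powr)
  fix i :: nat
  have "v i powr (\<alpha> - 1) \<le> C powr (\<alpha> - 1)"
    using assms by (intro powr_mono2) (auto simp: less_imp_le)
  then show "norm ((1 + real i) powr - (\<beta> * (\<alpha> - 1)) * v i powr (\<alpha> - 1)) \<le> norm ((1 + real i) powr - (\<beta> * (\<alpha> - 1)) * C powr (\<alpha> - 1))"
    by (simp add: mult_left_mono)
qed auto

lemma beta_less: "\<alpha> > 1 \<Longrightarrow> \<beta> > 1 / (\<alpha> - 1) \<longleftrightarrow> \<beta> * (\<alpha> - 1) > 1"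
    "\<alpha> > 1 \<Longrightarrow> \<beta> < 1 / (\<alpha> - 1) \<longleftrightarrow> \<beta> * (\<alpha> - 1) < 1"
    "\<alpha> > 1 \<Longrightarrow> \<beta> = 1 / (\<alpha> - 1) \<longleftrightarrow> \<beta> * (\<alpha> - 1) = 1"
  by (auto simp: field_simps)

section \<open>The six limits along sequences of lags\<close>

context
  fixes n m :: "nat \<Rightarrow> nat"
  assumes nm: "\<And>k. n k \<ge> k + 3" "\<And>k. m k \<ge> k + 3"
begin

lemma beta_pos': "\<beta>1 * 1 > 0" "\<beta>2 * 1 > 0"
  using beta_pos by auto

lemma ratio_log1:
  assumes "(indicator {0<..<1} t :: real) \<noteq> 0"
  shows "filterlim (\<lambda>k. ratio \<beta>1 (n k) (nat \<lfloor>real (n k) powr t\<rfloor> - 1)) at_top sequentially"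
proof -
  have t: "0 < t" "t < 1" using assms by (auto simp: indicator_def split: if_splits)
  show ?thesis
  proof (rule filterlim_ratio_at_top[OF beta_pos(1) _ nm(1)])
    show "(\<lambda>k. (1 + real (nat \<lfloor>real (n k) powr t\<rfloor> - 1)) / real (n k)) \<longlonglongrightarrow> 0"
      using log_index_tendsto(3)[OF nm(1) beta_pos'(1) t] log_index(2)[OF nm(1) beta_pos'(1), of t] t by simp
  qed
qed

lemma log_index1:
  assumes "(indicator {0<..<1} t :: real) \<noteq> 0"
  shows "filterlim (\<lambda>k. nat \<lfloor>real (n k) powr t\<rfloor> - 1) sequentially sequentially"
  using assms by (intro log_index_tendsto(2)[OF nm(1) beta_pos'(1)]) (auto simp: indicator_def split: if_splits)

lemma log_index2:
  assumes "(indicator {0<..<1} t :: real) \<noteq> 0"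
  shows "filterlim (\<lambda>k. nat \<lfloor>real (m k) powr t\<rfloor> - 1) sequentially sequentially"
  using assms by (intro log_index_tendsto(2)[OF nm(2) beta_pos'(2)]) (auto simp: indicator_def split: if_splits)

lemma linear_index2:
  assumes "indicator {0<..} t * c \<noteq> (0 :: real)"
  shows "filterlim (\<lambda>k. nat \<lfloor>real (m k) * t\<rfloor>) sequentially sequentially"
  using assms by (intro linear_index_tendsto(3)[OF nm(2) beta_pos'(2)]) (auto simp: indicator_def split: if_splits)

text \<open>Neither index is rescaled, so the weights are seen at fixed positions, where they may be
  negative; hence the signed power. The integrability part \<open>T(2)\<close> turns the integral
  over pairs into the iterated series.\<close>

lemma cov_limit_1:
  assumes "\<alpha> > 1" "\<beta>1 * (\<alpha> - 1) > 1" "\<beta>2 * (\<alpha> - 1) > 1"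
  shows "(\<lambda>k. cov (n k) (m k) / (real (n k) powr (- \<beta>1) * real (m k) powr (- \<beta>2))) \<longlonglongrightarrow>
     (\<Sum>i. \<Sum>j. signed_powr (w i j) (\<alpha> - 1) * (1 + real i) powr (- \<beta>1 * (\<alpha> - 1)) * (1 + real j) powr (- \<beta>2 * (\<alpha> - 1)))"
proof -
  note s = index_scaling_identity[OF nm(1) beta_pos'(1) assms(2)] index_scaling_identity[OF nm(2) beta_pos'(2) assms(3)]
  have C: "count_space UNIV \<Otimes>\<^sub>M count_space UNIV = (count_space UNIV :: (nat \<times> nat) measure)"
    by (simp add: pair_measure_countable)
  have W: "case_prod w \<in> borel_measurable (count_space UNIV \<Otimes>\<^sub>M count_space UNIV)"
    by (simp add: C)
  have nz: "case_prod w z \<noteq> 0" for z using w_nonzero by (cases z) simp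
  note T = cov_tendsto_dominant_first[OF nm \<open>\<alpha> > 1\<close> s _ _ nz W, OF ratio_identity[OF nm(1) beta_pos'(1) beta_pos(1)], simplified, unfolded C]
  show ?thesis
    using T(1) integral_count_space_nat_prod[OF T(2)] by (simp add: mult_ac)
qed

text \<open>The first index stays fixed while the second tends to infinity on the linear scale, so
  the weight tends to \<open>w_right\<close>. The limiting integrand is a product, and the series
  separates from the integral.\<close>

lemma cov_limit_3:
  assumes "\<alpha> > 1" "\<beta>1 * (\<alpha> - 1) > 1" "\<beta>2 * (\<alpha> - 1) < 1"
  shows "(\<lambda>k. cov (n k) (m k) / (real (n k) powr (- \<beta>1) * real (m k) powr (1 - \<beta>2 * \<alpha>))) \<longlonglongrightarrow>
     (\<Sum>i. w_right i powr (\<alpha> - 1) * (1 + real i) powr (- \<beta>1 * (\<alpha> - 1)))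
          * (LINT u:{0<..}|lborel. u powr (- \<beta>2 * (\<alpha> - 1)) * (1 + u) powr (- \<beta>2))"
proof -
  let ?C = "count_space (UNIV :: nat set)"
  interpret pair_sigma_finite ?C "lborel :: real measure"
    by (simp add: pair_sigma_finite_def sigma_finite_measure_count_space_countable lborel.sigma_finite_measure_axioms)
  have b2: "0 \<le> \<beta>2 * (\<alpha> - 1)" "\<beta>2 * (\<alpha> - 1) + \<beta>2 * 1 > 1"
    using beta_pos assms by (auto simp: algebra_simps)
  note s = index_scaling_identity[OF nm(1) beta_pos'(1) assms(2)] index_scaling_linear[OF nm(2) beta_pos'(2) b2(1) assms(3) b2(2)]
  let ?k2 = "\<lambda>u::real. indicator {0<..} u * (u powr - (\<beta>2 * (\<alpha> - 1)) * (1 + u) powr - (\<beta>2 * 1)) :: real"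
  obtain C where C: "\<And>i. w_right i \<le> C" using w_right_bounded by blast
  have i1: "integrable ?C (\<lambda>i. (1 + real i) powr - (\<beta>1 * (\<alpha> - 1)) * w_right i powr (\<alpha> - 1))"
    by (rule integrable_weighted_powr[OF A2(2) C assms(2,1)])
  have i2: "integrable lborel ?k2"
    using s(2) unfolding index_scaling_def index_scaling_axioms_def by blast
  have W: "(\<lambda>k. w i (nat \<lfloor>real (m k) * u\<rfloor>)) \<longlonglongrightarrow> w_right (fst (i, u))" if "?k2 u \<noteq> 0" for i u
    using filterlim_compose[OF A2(1) linear_index2[OF that], of i] by simp
  have nz: "w_right (fst z) \<noteq> 0" for z :: "nat \<times> real" using A2(2)[of "fst z"] by simp
  have pos: "signed_powr (w_right i) (\<alpha> - 1) = w_right i powr (\<alpha> - 1)" for i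
    using A2(2)[of i] by (simp add: signed_powr_def)
  have meas: "(\<lambda>z. w_right (fst z)) \<in> borel_measurable (?C \<Otimes>\<^sub>M (lborel :: real measure))"
    by (rule measurable_compose[OF measurable_fst]) simp
  have "(\<lambda>k. cov (n k) (m k) / (real (n k) powr - (\<beta>1 * 1) * real (m k) powr (1 - (\<beta>2 * (\<alpha> - 1) + \<beta>2 * 1)))) \<longlonglongrightarrow>
     (LINT z|(?C \<Otimes>\<^sub>M lborel). (1 + real (fst z)) powr - (\<beta>1 * (\<alpha> - 1)) * ?k2 (snd z) * signed_powr (w_right (fst z)) (\<alpha> - 1))"
    by (rule cov_tendsto_dominant_first(1)[OF nm \<open>\<alpha> > 1\<close> s ratio_identity[OF nm(1) beta_pos'(1) beta_pos(1)] W nz meas])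
  also have "(LINT z|(?C \<Otimes>\<^sub>M lborel). (1 + real (fst z)) powr - (\<beta>1 * (\<alpha> - 1)) * ?k2 (snd z) * signed_powr (w_right (fst z)) (\<alpha> - 1))
      = (LINT z|(?C \<Otimes>\<^sub>M lborel). (case z of (i, u) \<Rightarrow> ((1 + real i) powr - (\<beta>1 * (\<alpha> - 1)) * w_right i powr (\<alpha> - 1)) * ?k2 u))"
    unfolding pos by (simp add: case_prod_unfold mult_ac)
  also have "\<dots> = (LINT i|?C. (1 + real i) powr - (\<beta>1 * (\<alpha> - 1)) * w_right i powr (\<alpha> - 1)) * (LINT u|lborel. ?k2 u)"
    by (rule integral_pair_mult[OF i1 i2])
  finally show ?thesis
    unfolding integral_count_space_nat[OF i1] by (simp add: set_lebesgue_integral_def algebra_simps)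
qed

lemma log_limit_integral: "(LINT t|(lborel :: real measure). indicator {0<..<1} t) = (1 :: real)"
  "integrable lborel (indicator {0<..<1} :: real \<Rightarrow> real)"
  using measure_lborel_Ioo[of 0 1] by simp_all

text \<open>Both rescaled indices tend to infinity, so the weight tends to 1, and the logarithmic
  coordinate contributes just the length of the unit interval.\<close>

lemma cov_limit_4:
  assumes "\<alpha> > 1" "\<beta>1 * (\<alpha> - 1) = 1" "\<beta>2 * (\<alpha> - 1) < 1"
  shows "(\<lambda>k. cov (n k) (m k) / (real (n k) powr (- \<beta>1) * real (m k) powr (1 - \<beta>2 * \<alpha>) * ln (real (n k)))) \<longlonglongrightarrow>
          (LINT v:{0<..}|lborel. v powr (- \<beta>2 * (\<alpha> - 1)) * (1 + v) powr (- \<beta>2))"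
proof -
  have b2: "0 \<le> \<beta>2 * (\<alpha> - 1)" "\<beta>2 * (\<alpha> - 1) + \<beta>2 * 1 > 1"
    using beta_pos assms by (auto simp: algebra_simps)
  note s = index_scaling_log[OF nm(1) beta_pos'(1) assms(2)] index_scaling_linear[OF nm(2) beta_pos'(2) b2(1) assms(3) b2(2)]
  let ?k2 = "\<lambda>u::real. indicator {0<..} u * (u powr - (\<beta>2 * (\<alpha> - 1)) * (1 + u) powr - (\<beta>2 * 1)) :: real"
  have i2: "integrable lborel ?k2"
    using s(2) unfolding index_scaling_def index_scaling_axioms_def by blast
  have W: "(\<lambda>k. w (nat \<lfloor>real (n k) powr t\<rfloor> - 1) (nat \<lfloor>real (m k) * u\<rfloor>)) \<longlonglongrightarrow> 1"
    if "(indicator {0<..<1} t :: real) \<noteq> 0" "?k2 u \<noteq> 0" for t u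
    by (rule w_tendsto_1[OF log_index1[OF that(1)] linear_index2[OF that(2)]])
  have "(\<lambda>k. cov (n k) (m k) / ((real (n k) powr - (\<beta>1 * 1) * ln (real (n k))) * real (m k) powr (1 - (\<beta>2 * (\<alpha> - 1) + \<beta>2 * 1)))) \<longlonglongrightarrow>
     (LINT z|((lborel :: real measure) \<Otimes>\<^sub>M (lborel :: real measure)). indicator {0<..<1} (fst z) * ?k2 (snd z) * signed_powr 1 (\<alpha> - 1))"
    by (rule cov_tendsto_dominant_first(1)[where W = "\<lambda>_. 1", OF nm \<open>\<alpha> > 1\<close> s ratio_log1 W]) auto
  also have "(LINT z|((lborel :: real measure) \<Otimes>\<^sub>M (lborel :: real measure)). indicator {0<..<1} (fst z) * ?k2 (snd z) * signed_powr 1 (\<alpha> - 1))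
      = (LINT z|((lborel :: real measure) \<Otimes>\<^sub>M (lborel :: real measure)). (case z of (t, u) \<Rightarrow> indicator {0<..<1} t * ?k2 u))"
    by (simp add: signed_powr_def case_prod_unfold)
  also have "\<dots> = (LINT t|(lborel :: real measure). indicator {0<..<1} t) * (LINT u|lborel. ?k2 u)"
    by (rule lborel_pair.integral_pair_mult[OF log_limit_integral(2) i2])
  finally show ?thesis
    by (simp add: log_limit_integral(1) set_lebesgue_integral_def algebra_simps)
qed

text \<open>On the logarithmic scale the first index tends to infinity while the second stays fixed,
  whence \<open>w_top\<close>.\<close>

lemma cov_limit_5:
  assumes "\<alpha> > 1" "\<beta>1 * (\<alpha> - 1) = 1" "\<beta>2 * (\<alpha> - 1) > 1"
  shows "(\<lambda>k. cov (n k) (m k) / (real (n k) powr (- \<beta>1) * real (m k) powr (- \<beta>2) * ln (real (n k)))) \<longlonglongrightarrow>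
          (\<Sum>j. w_top j powr (\<alpha> - 1) * (1 + real j) powr (- \<beta>2 * (\<alpha> - 1)))"
proof -
  let ?C = "count_space (UNIV :: nat set)"
  interpret pair_sigma_finite "lborel :: real measure" ?C
    by (simp add: pair_sigma_finite_def sigma_finite_measure_count_space_countable lborel.sigma_finite_measure_axioms)
  note s = index_scaling_log[OF nm(1) beta_pos'(1) assms(2)] index_scaling_identity[OF nm(2) beta_pos'(2) assms(3)]
  obtain C where C: "\<And>i. w_top i \<le> C" using w_top_bounded by blast
  have i2: "integrable ?C (\<lambda>j. (1 + real j) powr - (\<beta>2 * (\<alpha> - 1)) * w_top j powr (\<alpha> - 1))"
    by (rule integrable_weighted_powr[OF A3(2) C assms(3,1)])
  have W: "(\<lambda>k. w (nat \<lfloor>real (n k) powr t\<rfloor> - 1) j) \<longlonglongrightarrow> w_top (snd (t, j))"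
    if "(indicator {0<..<1} t :: real) \<noteq> 0" for t j
    using filterlim_compose[OF A3(1) log_index1[OF that], of j] by simp
  have nz: "w_top (snd z) \<noteq> 0" for z :: "real \<times> nat" using A3(2)[of "snd z"] by simp
  have pos: "signed_powr (w_top i) (\<alpha> - 1) = w_top i powr (\<alpha> - 1)" for i
    using A3(2)[of i] by (simp add: signed_powr_def)
  have meas: "(\<lambda>z. w_top (snd z)) \<in> borel_measurable ((lborel :: real measure) \<Otimes>\<^sub>M ?C)"
    by (rule measurable_compose[OF measurable_snd]) simp
  have "(\<lambda>k. cov (n k) (m k) / ((real (n k) powr - (\<beta>1 * 1) * ln (real (n k))) * real (m k) powr - (\<beta>2 * 1))) \<longlonglongrightarrow>
     (LINT z|((lborel :: real measure) \<Otimes>\<^sub>M ?C). indicator {0<..<1} (fst z) * (1 + real (snd z)) powr - (\<beta>2 * (\<alpha> - 1)) * signed_powr (w_top (snd z)) (\<alpha> - 1))"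
    by (rule cov_tendsto_dominant_first(1)[OF nm \<open>\<alpha> > 1\<close> s ratio_log1 W nz meas])
  also have "(LINT z|((lborel :: real measure) \<Otimes>\<^sub>M ?C). indicator {0<..<1} (fst z) * (1 + real (snd z)) powr - (\<beta>2 * (\<alpha> - 1)) * signed_powr (w_top (snd z)) (\<alpha> - 1))
      = (LINT z|((lborel :: real measure) \<Otimes>\<^sub>M ?C). (case z of (t, j) \<Rightarrow> indicator {0<..<1} t * ((1 + real j) powr - (\<beta>2 * (\<alpha> - 1)) * w_top j powr (\<alpha> - 1))))"
    unfolding pos by (simp add: case_prod_unfold mult_ac)
  also have "\<dots> = (LINT t|(lborel :: real measure). indicator {0<..<1} t) * (LINT j|?C. (1 + real j) powr - (\<beta>2 * (\<alpha> - 1)) * w_top j powr (\<alpha> - 1))"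
    by (rule integral_pair_mult[OF log_limit_integral(2) i2])
  finally show ?thesis
    unfolding integral_count_space_nat[OF i2] by (simp add: log_limit_integral(1) mult_ac)
qed

lemma cov_limit_6:
  assumes "\<alpha> > 1" "\<beta>1 * (\<alpha> - 1) = 1" "\<beta>2 * (\<alpha> - 1) = 1"
  shows "(\<lambda>k. cov (n k) (m k) / (real (n k) powr (- \<beta>1) * real (m k) powr (- \<beta>2) * ln (real (n k)) * ln (real (m k)))) \<longlonglongrightarrow> 1"
proof -
  note s = index_scaling_log[OF nm(1) beta_pos'(1) assms(2)] index_scaling_log[OF nm(2) beta_pos'(2) assms(3)]
  have W: "(\<lambda>k. w (nat \<lfloor>real (n k) powr t\<rfloor> - 1) (nat \<lfloor>real (m k) powr u\<rfloor> - 1)) \<longlonglongrightarrow> 1"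
    if "(indicator {0<..<1} t :: real) \<noteq> 0" "(indicator {0<..<1} u :: real) \<noteq> 0" for t u
    by (rule w_tendsto_1[OF log_index1[OF that(1)] log_index2[OF that(2)]])
  have "(\<lambda>k. cov (n k) (m k) / ((real (n k) powr - (\<beta>1 * 1) * ln (real (n k))) * (real (m k) powr - (\<beta>2 * 1) * ln (real (m k))))) \<longlonglongrightarrow>
     (LINT z|((lborel :: real measure) \<Otimes>\<^sub>M (lborel :: real measure)). indicator {0<..<1} (fst z) * indicator {0<..<1} (snd z) * signed_powr 1 (\<alpha> - 1))"
    by (rule cov_tendsto_dominant_first(1)[where W = "\<lambda>_. 1", OF nm \<open>\<alpha> > 1\<close> s ratio_log1 W]) auto
  also have "(LINT z|((lborel :: real measure) \<Otimes>\<^sub>M (lborel :: real measure)). indicator {0<..<1} (fst z) * indicator {0<..<1} (snd z) * signed_powr 1 (\<alpha> - 1))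
      = (LINT z|((lborel :: real measure) \<Otimes>\<^sub>M (lborel :: real measure)). (case z of (t, u) \<Rightarrow> indicator {0<..<1} t * indicator {0<..<1} u))"
    by (simp add: signed_powr_def case_prod_unfold)
  also have "\<dots> = (LINT t|(lborel :: real measure). indicator {0<..<1} t) * (LINT u|(lborel :: real measure). indicator {0<..<1} u)"
    by (rule lborel_pair.integral_pair_mult[OF log_limit_integral(2) log_limit_integral(2)])
  finally show ?thesis
    by (simp add: log_limit_integral(1) mult_ac)
qed

text \<open>On the linear scale both ratios have finite limits, so V does not degenerate, and all
  weights tend to 1. The exponents \<open>a\<close> and \<open>b\<close> serve the domination and
  cancel from the limit; leaving them free allows one argument for alpha <= 1 and alpha > 1.\<close>

lemma cov_limit_2:
  assumes ab: "0 \<le> a" "a \<le> 1" "\<alpha> - 1 \<le> a" "a < \<alpha>" "a + b = \<alpha>" and "\<beta>1 * a < 1" "\<beta>2 * a < 1"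
  shows "(\<lambda>k. cov (n k) (m k) / (real (n k) powr (1 - \<alpha> * \<beta>1) * real (m k) powr (1 - \<alpha> * \<beta>2))) \<longlonglongrightarrow>
      (LINT s:{0<..}|lborel. LINT t:{0<..}|lborel.
            V \<alpha> (t powr (- \<beta>1) * s powr (- \<beta>2)) ((t + 1) powr (- \<beta>1) * (s + 1) powr (- \<beta>2)))"
proof -
  have b: "b = \<alpha> - a" using ab by simp
  have bb: "\<beta>1 * b > 0" "\<beta>2 * b > 0" using beta_pos ab by (auto simp: b)
  have c1: "0 \<le> \<beta>1 * a" "\<beta>1 * a + \<beta>1 * b > 1" and c2: "0 \<le> \<beta>2 * a" "\<beta>2 * a + \<beta>2 * b > 1"
    using beta_pos ab by (auto simp: b algebra_simps)
  note s = index_scaling_linear[OF nm(1) bb(1) c1(1) assms(6) c1(2)] index_scaling_linear[OF nm(2) bb(2) c2(1) assms(7) c2(2)]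
  let ?k = "\<lambda>\<beta> t::real. indicator {0<..} t * (t powr - (\<beta> * a) * (1 + t) powr - (\<beta> * b)) :: real"
  define R where "R t s = ((t + 1) / t) powr \<beta>1 * ((s + 1) / s) powr \<beta>2" for t s :: real
  define H where "H = (\<lambda>(t, s). V \<alpha> (R t s) 1 / R t s powr a)"
  have lim: "(\<lambda>k. G a (n k) (m k) (nat \<lfloor>real (n k) * t\<rfloor>) (nat \<lfloor>real (m k) * s\<rfloor>)) \<longlonglongrightarrow> H (t, s)"
    if "?k \<beta>1 t \<noteq> 0" "?k \<beta>2 s \<noteq> 0" for t s
  proof -
    have ts: "t > 0" "s > 0" using that by (auto simp: indicator_def split: if_splits)
    have R: "R t s > 0" using ts by (simp add: R_def)
    have "(\<lambda>k. V \<alpha> (w (nat \<lfloor>real (n k) * t\<rfloor>) (nat \<lfloor>real (m k) * s\<rfloor>) *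
          (ratio \<beta>1 (n k) (nat \<lfloor>real (n k) * t\<rfloor>) * ratio \<beta>2 (m k) (nat \<lfloor>real (m k) * s\<rfloor>)))
          (w (nat \<lfloor>real (n k) * t\<rfloor> + n k) (nat \<lfloor>real (m k) * s\<rfloor> + m k)) /
          (ratio \<beta>1 (n k) (nat \<lfloor>real (n k) * t\<rfloor>) * ratio \<beta>2 (m k) (nat \<lfloor>real (m k) * s\<rfloor>)) powr a)
        \<longlonglongrightarrow> V \<alpha> (1 * R t s) 1 / R t s powr a"
      unfolding R_def
      by (intro tendsto_intros w_shift_tendsto_1[OF nm] w_tendsto_1 tendsto_ratio
          linear_index_tendsto[OF nm(1) beta_pos'(1)] linear_index_tendsto[OF nm(2) beta_pos'(2)] ts nm)
        (use R ts in \<open>auto simp: R_def\<close>)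
    then show ?thesis by (simp add: G_def H_def)
  qed
  have meas: "H \<in> borel_measurable (lborel \<Otimes>\<^sub>M lborel)"
    unfolding H_def R_def V_def by measurable
  have le: "a \<le> \<alpha>" using ab by simp
  have T: "(\<lambda>k. cov (n k) (m k) / (real (n k) powr (1 - (\<beta>1 * a + \<beta>1 * b)) * real (m k) powr (1 - (\<beta>2 * a + \<beta>2 * b))))
      \<longlonglongrightarrow> (LINT z|(lborel \<Otimes>\<^sub>M lborel). ?k \<beta>1 (fst z) * ?k \<beta>2 (snd z) * H z)"
    "integrable (lborel \<Otimes>\<^sub>M lborel) (\<lambda>z. ?k \<beta>1 (fst z) * ?k \<beta>2 (snd z) * H z)"
    by (rule cov_tendsto[OF s ab(1-3) le ab(5) _ meas], erule (1) lim)+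
  let ?F = "\<lambda>t s. V \<alpha> (t powr (- \<beta>1) * s powr (- \<beta>2)) ((t + 1) powr (- \<beta>1) * (s + 1) powr (- \<beta>2))"
  \<comment> \<open>\<open>V_factor\<close> with unit weights, read from right to left: the kernels
    and \<open>H\<close> recombine into V of pure powers.\<close>
  have eq: "?k \<beta>1 t * ?k \<beta>2 s * H (t, s) = indicator {0<..} s * (indicator {0<..} t * ?F t s)" for t s
  proof (cases "t > 0 \<and> s > 0")
    case True
    then show ?thesis
      using V_factor[of t "t + 1" s "s + 1" "R t s" \<beta>1 \<beta>2 a b \<alpha> 1 1] ab(5)
      by (simp add: H_def R_def add.commute)
  qed (auto simp: indicator_def)
  have eq': "(\<lambda>z. ?k \<beta>1 (fst z) * ?k \<beta>2 (snd z) * H z) = (\<lambda>(t, s). indicator {0<..} s * (indicator {0<..} t * ?F t s))"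
  proof (rule ext)
    fix z :: "real \<times> real"
    show "?k \<beta>1 (fst z) * ?k \<beta>2 (snd z) * H z = (case z of (t, s) \<Rightarrow> indicator {0<..} s * (indicator {0<..} t * ?F t s))"
      using eq[of "fst z" "snd z"] by (simp only: prod.collapse case_prod_unfold)
  qed
  have "integrable (lborel \<Otimes>\<^sub>M lborel) (\<lambda>(t, s). indicator {0<..} s * (indicator {0<..} t * ?F t s))"
    using T(2) unfolding eq' .
  \<comment> \<open>The product measure carries pairs (t, s), whereas the iterated integral has t
    innermost; hence \<open>integral_snd\<close>.\<close>
  then have "(LINT s|lborel. LINT t|lborel. indicator {0<..} s * (indicator {0<..} t * ?F t s))
      = (LINT z|(lborel \<Otimes>\<^sub>M lborel). (case z of (t, s) \<Rightarrow> indicator {0<..} s * (indicator {0<..} t * ?F t s)))"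
    by (rule lborel_pair.integral_snd)
  also have "\<dots> = (LINT z|(lborel \<Otimes>\<^sub>M lborel). ?k \<beta>1 (fst z) * ?k \<beta>2 (snd z) * H z)"
    by (simp only: eq')
  also have "(LINT s|lborel. LINT t|lborel. indicator {0<..} s * (indicator {0<..} t * ?F t s))
      = (LINT s:{0<..}|lborel. LINT t:{0<..}|lborel. ?F t s)"
    by (simp add: set_lebesgue_integral_def)
  finally have "(LINT z|(lborel \<Otimes>\<^sub>M lborel). ?k \<beta>1 (fst z) * ?k \<beta>2 (snd z) * H z)
      = (LINT s:{0<..}|lborel. LINT t:{0<..}|lborel. ?F t s)" ..
  moreover have "1 - (\<beta> * a + \<beta> * b) = 1 - \<alpha> * \<beta>" for \<beta>
    by (simp add: b algebra_simps)
  ultimately show ?thesis using T(1) by (simp only:)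
qed

end

end

theorem theorem1:
  fixes \<alpha> \<beta>1 \<beta>2 :: real
    and M :: "'a measure"
    and \<epsilon> :: "int \<times> int \<Rightarrow> 'a \<Rightarrow> real"
    and X :: "int \<Rightarrow> int \<Rightarrow> 'a \<Rightarrow> real"
    and w :: "nat \<Rightarrow> nat \<Rightarrow> real"
    and w_right w_top :: "nat \<Rightarrow> real"
    and \<rho> :: "nat \<Rightarrow> nat \<Rightarrow> real"
  assumes alpha: "0 < \<alpha>" "\<alpha> \<le> 2"
    and beta: "\<beta>1 > 1 / \<alpha>" "\<beta>2 > 1 / \<alpha>"
    and prob: "prob_space M"
    and innov: "iid_symmetric_stable \<alpha> M \<epsilon>"
    and field: "linear_random_field M (field_coeff w \<beta>1 \<beta>2) \<epsilon> X"
    and w_nonzero: "\<And>i j. w i j \<noteq> 0"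
    and A1: "((\<lambda>(i, j). w i j) \<longlongrightarrow> 1) (sequentially \<times>\<^sub>F sequentially)"
    and A2: "\<And>i. (\<lambda>j. w i j) \<longlonglongrightarrow> w_right i" "\<And>i. w_right i > 0"
    and A3: "\<And>j. (\<lambda>i. w i j) \<longlonglongrightarrow> w_top j" "\<And>j. w_top j > 0"
  defines "\<rho> \<equiv> rho \<alpha> M (field_coeff w \<beta>1 \<beta>2) X"
  shows
    "(1 < \<alpha> \<and> \<beta>1 > 1 / (\<alpha> - 1) \<and> \<beta>2 > 1 / (\<alpha> - 1) \<longrightarrow>
       ((\<lambda>(n, m). \<rho> n m / (real n powr (- \<beta>1) * real m powr (- \<beta>2))) \<longlongrightarrow>
         (\<Sum>i. \<Sum>j. signed_powr (w i j) (\<alpha> - 1)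
            * (1 + real i) powr (- \<beta>1 * (\<alpha> - 1)) * (1 + real j) powr (- \<beta>2 * (\<alpha> - 1))))
       (sequentially \<times>\<^sub>F sequentially))
   \<and> ((1 < \<alpha> \<and> \<beta>1 < 1 / (\<alpha> - 1) \<and> \<beta>2 < 1 / (\<alpha> - 1)) \<or> \<alpha> \<le> 1 \<longrightarrow>
       ((\<lambda>(n, m). \<rho> n m / (real n powr (1 - \<alpha> * \<beta>1) * real m powr (1 - \<alpha> * \<beta>2))) \<longlongrightarrow>
         (LINT s:{0<..}|lborel. LINT t:{0<..}|lborel.
            V \<alpha> (t powr (- \<beta>1) * s powr (- \<beta>2)) ((t + 1) powr (- \<beta>1) * (s + 1) powr (- \<beta>2))))
       (sequentially \<times>\<^sub>F sequentially))
   \<and> (1 < \<alpha> \<and> \<beta>1 > 1 / (\<alpha> - 1) \<and> \<beta>2 < 1 / (\<alpha> - 1) \<longrightarrow>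
       ((\<lambda>(n, m). \<rho> n m / (real n powr (- \<beta>1) * real m powr (1 - \<beta>2 * \<alpha>))) \<longlongrightarrow>
         (\<Sum>i. w_right i powr (\<alpha> - 1) * (1 + real i) powr (- \<beta>1 * (\<alpha> - 1)))
          * (LINT u:{0<..}|lborel. u powr (- \<beta>2 * (\<alpha> - 1)) * (1 + u) powr (- \<beta>2)))
       (sequentially \<times>\<^sub>F sequentially))
   \<and> (1 < \<alpha> \<and> \<beta>1 = 1 / (\<alpha> - 1) \<and> \<beta>2 < 1 / (\<alpha> - 1) \<longrightarrow>
       ((\<lambda>(n, m). \<rho> n m / (real n powr (- \<beta>1) * real m powr (1 - \<beta>2 * \<alpha>) * ln (real n))) \<longlongrightarrow>
         (LINT v:{0<..}|lborel. v powr (- \<beta>2 * (\<alpha> - 1)) * (1 + v) powr (- \<beta>2)))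
       (sequentially \<times>\<^sub>F sequentially))
   \<and> (1 < \<alpha> \<and> \<beta>1 = 1 / (\<alpha> - 1) \<and> \<beta>2 > 1 / (\<alpha> - 1) \<longrightarrow>
       ((\<lambda>(n, m). \<rho> n m / (real n powr (- \<beta>1) * real m powr (- \<beta>2) * ln (real n))) \<longlongrightarrow>
         (\<Sum>j. w_top j powr (\<alpha> - 1) * (1 + real j) powr (- \<beta>2 * (\<alpha> - 1))))
       (sequentially \<times>\<^sub>F sequentially))
   \<and> (1 < \<alpha> \<and> \<beta>1 = 1 / (\<alpha> - 1) \<and> \<beta>2 = 1 / (\<alpha> - 1) \<longrightarrow>
       ((\<lambda>(n, m). \<rho> n m / (real n powr (- \<beta>1) * real m powr (- \<beta>2) * ln (real n) * ln (real m))) \<longlongrightarrow> 1)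
       (sequentially \<times>\<^sub>F sequentially))"
proof -
  interpret weighted_field \<alpha> \<beta>1 \<beta>2 w w_right w_top
    by unfold_locales (fact alpha beta w_nonzero A1 A2 A3)+
  have \<rho>: "\<rho> n m = cov n m" for n m
    unfolding \<rho>_def cov_def
    by (rule rho_eq_integral[OF alpha(1) integrable_field_coeff prob innov field field_coeff_nonzero alpha(2)])
  have case2: "((\<lambda>(n, m). cov n m / (real n powr (1 - \<alpha> * \<beta>1) * real m powr (1 - \<alpha> * \<beta>2))) \<longlongrightarrow>
         (LINT s:{0<..}|lborel. LINT t:{0<..}|lborel.
            V \<alpha> (t powr (- \<beta>1) * s powr (- \<beta>2)) ((t + 1) powr (- \<beta>1) * (s + 1) powr (- \<beta>2))))
       (sequentially \<times>\<^sub>F sequentially)"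
    if "(1 < \<alpha> \<and> \<beta>1 < 1 / (\<alpha> - 1) \<and> \<beta>2 < 1 / (\<alpha> - 1)) \<or> \<alpha> \<le> 1"
  proof (rule tendsto_prod_sequentiallyI)
    fix n m :: "nat \<Rightarrow> nat"
    assume nm: "\<And>k. n k \<ge> k + 3" "\<And>k. m k \<ge> k + 3"
    show "(\<lambda>k. cov (n k) (m k) / (real (n k) powr (1 - \<alpha> * \<beta>1) * real (m k) powr (1 - \<alpha> * \<beta>2))) \<longlonglongrightarrow>
         (LINT s:{0<..}|lborel. LINT t:{0<..}|lborel.
            V \<alpha> (t powr (- \<beta>1) * s powr (- \<beta>2)) ((t + 1) powr (- \<beta>1) * (s + 1) powr (- \<beta>2)))"
    proof (cases "\<alpha> \<le> 1")
      case True
      \<comment> \<open>With a = 0 the requirement beta * a < 1 holds automatically, so no upper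
        bound on the exponents appears for alpha <= 1.\<close>
      then show ?thesis using cov_limit_2[OF nm, of 0 \<alpha>] alpha by simp
    next
      case False
      then show ?thesis using cov_limit_2[OF nm, of "\<alpha> - 1" 1] alpha that beta_less(2) by simp
    qed
  qed
  show ?thesis
    unfolding \<rho>
    by (intro conjI impI case2;
        (assumption |
         (rule tendsto_prod_sequentiallyI, elim conjE,
          (rule cov_limit_1 cov_limit_3 cov_limit_4 cov_limit_5 cov_limit_6;
           (assumption | erule (1) beta_less[THEN iffD1] | simp)))))
qed

end
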